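(* Let $H$ be an intersecting graph with $r\ge1$ edges. Let $G$ be a graph whose vertex set is partitioned into blocks of size at least $b$, and let $d$ be the maximum average degree of any block. If $b\ge4d/r$, then $G$ has a transversal avoiding $H$, which can be found in randomized polynomial time.
   Context: Graphs are finite and undirected. A graph $H$ is intersecting if $f\cap f'\ne\emptyset$ for all edges $f,f'$ of $H$ (edges viewed as 2-element vertex sets). The average degree of a block $V_i$ is the average over $v\in V_i$ of the degree of $v$ in $G$; $d$ is the maximum of this over all blocks. A transversal is a set $A$ of vertices containing exactly one vertex from each block; it avoids $H$ if the subgraph of $G$ induced on $A$ contains no copy of $H$ as a subgraph. *)

theory Defs
  imports
    "HOL-Probability.Probability"
    "HOL-Library.Disjoint_Sets"
    "HOL-Computational_Algebra.Polynomial"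
begin

section \<open>Graphs, blocks and transversals\<close>

record 'a graph =
  verts :: "'a set"
  edges :: "'a set set"

definition ugraph :: "'a graph \<Rightarrow> bool" where
  "ugraph G \<longleftrightarrow> finite (verts G) \<and> (\<forall>e\<in>edges G. e \<subseteq> verts G \<and> card e = 2)"

definition intersecting :: "'a graph \<Rightarrow> bool" where
  "intersecting H \<longleftrightarrow> (\<forall>f\<in>edges H. \<forall>f'\<in>edges H. f \<inter> f' \<noteq> {})"

definition degree_in :: "'a graph \<Rightarrow> 'a \<Rightarrow> nat" where
  "degree_in G v = card {e \<in> edges G. v \<in> e}"

definition average_degree :: "'a graph \<Rightarrow> 'a set \<Rightarrow> real" where
  "average_degree G B = (\<Sum>v\<in>B. real (degree_in G v)) / real (card B)"

definition max_average_degree :: "'a graph \<Rightarrow> 'a set set \<Rightarrow> real" where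
  "max_average_degree G P = Max (average_degree G ` P)"

definition transversal :: "'a set set \<Rightarrow> 'a set \<Rightarrow> bool" where
  "transversal P A \<longleftrightarrow> A \<subseteq> \<Union>P \<and> (\<forall>B\<in>P. \<exists>!v. v \<in> A \<inter> B)"

definition induced :: "'a graph \<Rightarrow> 'a set \<Rightarrow> 'a graph" where
  "induced G A = \<lparr>verts = A, edges = {e \<in> edges G. e \<subseteq> A}\<rparr>"

definition contains_copy :: "'a graph \<Rightarrow> 'h graph \<Rightarrow> bool" where
  "contains_copy G H \<longleftrightarrow>
     (\<exists>\<phi>. inj_on \<phi> (verts H) \<and> \<phi> ` verts H \<subseteq> verts G \<and> (\<forall>e\<in>edges H. \<phi> ` e \<in> edges G))"

definition avoids :: "'a graph \<Rightarrow> 'a set \<Rightarrow> 'h graph \<Rightarrow> bool" where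
  "avoids G A H \<longleftrightarrow> \<not> contains_copy (induced G A) H"

text \<open>
  Everything the theorem assumes except the numerical condition relating \<open>b\<close>, \<open>d\<close> and \<open>r\<close>.
  Blocks are nonempty by \<open>partition_on\<close>.
\<close>

definition block_setting ::
  "'h graph \<Rightarrow> nat \<Rightarrow> 'a graph \<Rightarrow> 'a set set \<Rightarrow> real \<Rightarrow> real \<Rightarrow> bool" where
  "block_setting H r G P b d \<longleftrightarrow>
     ugraph H \<and> intersecting H \<and> r = card (edges H) \<and> r \<ge> 1 \<and>
     ugraph G \<and> partition_on (verts G) P \<and>
     (\<forall>B\<in>P. real (card B) \<ge> b) \<and> d = max_average_degree G P"


section \<open>Randomized polynomial time\<close>

text \<open>
  The machine model is a random access machine with fair coin flips, presented as a structured
  language. A state consists of registers and an addressable memory, both holding natural numbers.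
  Every executed instruction and every evaluated test costs one time unit. The only arithmetic
  operations are addition and (truncated) subtraction, so \<open>t\<close> steps increase the bit length of the
  stored numbers by at most \<open>t\<close>, plus a constant depending on the program; hence unit cost agrees
  with Turing machine time up to a polynomial.
\<close>

datatype prog =
    Const nat nat      \<comment> \<open>register \<open>i\<close> := constant\<close>
  | Add nat nat nat
  | Sub nat nat nat
  | Load nat nat       \<comment> \<open>register \<open>i\<close> := memory cell addressed by register \<open>j\<close>\<close>
  | Store nat nat      \<comment> \<open>memory cell addressed by register \<open>i\<close> := register \<open>j\<close>\<close>
  | Flip nat           \<comment> \<open>register \<open>i\<close> := fair coin, 0 or 1\<close>
  | Seq prog prog
  | If nat prog prog   \<comment> \<open>tests whether register \<open>i\<close> is nonzero\<close>
  | While nat prog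

type_synonym state = "(nat \<Rightarrow> nat) \<times> (nat \<Rightarrow> nat)"

text \<open>
  \<open>run c s\<close> is the joint distribution of the final state and the number of steps; the missing
  probability mass is the probability of divergence.
\<close>

partial_function (spmf) run :: "prog \<Rightarrow> state \<Rightarrow> (state \<times> nat) spmf" where
  "run c s = (case s of (R, M) \<Rightarrow> (case c of
       Const i n \<Rightarrow> return_spmf ((R(i := n), M), 1)
     | Add i j k \<Rightarrow> return_spmf ((R(i := R j + R k), M), 1)
     | Sub i j k \<Rightarrow> return_spmf ((R(i := R j - R k), M), 1)
     | Load i j \<Rightarrow> return_spmf ((R(i := M (R j)), M), 1)
     | Store i j \<Rightarrow> return_spmf ((R, M(R i := R j)), 1)
     | Flip i \<Rightarrow> bind_spmf coin_spmf (\<lambda>x. return_spmf ((R(i := of_bool x), M), 1))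
     | Seq p q \<Rightarrow>
         bind_spmf (run p (R, M)) (\<lambda>(s', t).
         bind_spmf (run q s') (\<lambda>(s'', t'). return_spmf (s'', t + t')))
     | If i p q \<Rightarrow>
         bind_spmf (run (if R i \<noteq> 0 then p else q) (R, M)) (\<lambda>(s', t). return_spmf (s', 1 + t))
     | While i p \<Rightarrow>
         (if R i = 0 then return_spmf ((R, M), 1)
          else bind_spmf (run p (R, M)) (\<lambda>(s', t).
               bind_spmf (run (While i p) s') (\<lambda>(s'', t'). return_spmf (s'', 1 + t + t'))))))"

text \<open>
  Input and output are lists of numbers, stored in the memory from address 0 on, with the length
  in register 0.
\<close>

definition input_state :: "nat list \<Rightarrow> state" where
  "input_state w =
     ((\<lambda>i. if i = 0 then length w else 0), (\<lambda>i. if i < length w then w ! i else 0))"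

definition output_of :: "state \<Rightarrow> nat list" where
  "output_of s = map (snd s) [0..<fst s 0]"

definition expected_time :: "prog \<Rightarrow> nat list \<Rightarrow> ennreal" where
  "expected_time c w = (\<integral>\<^sup>+ x. of_nat (snd x) \<partial>measure_spmf (run c (input_state w)))"

text \<open>
  Las Vegas search: on every instance \<open>x\<close> in \<open>I\<close> the program halts almost surely, each output it
  can produce is a correct solution, and its expected running time is polynomial in the length of
  the encoded instance. The encodings used must have entries bounded by their length, so that the
  length is polynomially equivalent to the bit size.
\<close>

definition randomized_poly_time ::
  "('i \<Rightarrow> nat list) \<Rightarrow> 'i set \<Rightarrow> ('i \<Rightarrow> nat list \<Rightarrow> bool) \<Rightarrow> bool" where
  "randomized_poly_time enc I sol \<longleftrightarrow>
     (\<exists>c (p :: nat poly). \<forall>x\<in>I.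
        lossless_spmf (run c (input_state (enc x))) \<and>
        (\<forall>(s, t)\<in>set_spmf (run c (input_state (enc x))). sol x (output_of s)) \<and>
        expected_time c (enc x) \<le> of_nat (poly p (length (enc x))))"


section \<open>Encoding of instances\<close>

definition numbered :: "nat graph \<Rightarrow> bool" where
  "numbered G \<longleftrightarrow> verts G = {0..<card (verts G)}"

definition adjacency :: "nat graph \<Rightarrow> nat list" where
  "adjacency G =
     concat (map (\<lambda>u. map (\<lambda>v. of_bool ({u, v} \<in> edges G)) [0..<card (verts G)])
       [0..<card (verts G)])"

text \<open>Each vertex is labelled by the least vertex of its block.\<close>

definition block_labels :: "nat graph \<Rightarrow> nat set set \<Rightarrow> nat list" where
  "block_labels G P = map (\<lambda>v. LEAST u. \<exists>B\<in>P. u \<in> B \<and> v \<in> B) [0..<card (verts G)]"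

definition encode :: "nat graph \<times> nat graph \<times> nat set set \<Rightarrow> nat list" where
  "encode = (\<lambda>(H, G, P).
     [card (verts H), card (verts G)] @ adjacency H @ adjacency G @ block_labels G P)"

end

theory Submission
  imports Defs
begin

text \<open>
  Fix one vertex in every block and call an edge of \<open>G\<close> selected if both its ends are chosen. A copy
  of \<open>H\<close> in a transversal consists of \<open>r\<close> selected edges, any two of which intersect. So it is enough
  to reach a choice without such a family, by the following process: start with a uniformly random choice; while there is an intersecting family \<open>C\<close> of at least \<open>r\<close>
  selected edges, pick an edge of \<open>C\<close> uniformly at random and resample the two blocks that it meets.

  An edge between blocks \<open>B\<close> and \<open>B'\<close> is selected with probability \<open>1 / (|B| |B'|)\<close> and is picked from \<open>C\<close>
  with probability at most \<open>1 / r\<close>. The products \<open>1 / (r |B| |B'|)\<close> of the edges that meet a given block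
  sum to at most \<open>d / (r b) \<le> 1 / 4\<close>, which is the critical case of the local lemma for events that
  depend on two variables each. The usual proof follows the log of resampled edges and encodes the
  history of each round as a witness tree. Here the histories are heaps (sequences up to exchanging
  neighbours that meet no common block), and their total weight as seen from a choice \<open>\<sigma>\<close> serves as a
  potential. Pyramids, the heaps with one last piece, correspond to rounds. Three facts carry the proof.

    \<^item> Resampling a block averages the potential over the vertex of that block (\<open>potential_resample\<close>).
    \<^item> In a round, the expected potential drops by at least 1 (\<open>potential_drift\<close>). Since the edges of \<open>C\<close>
      intersect, at most one of them can come first in a heap; so placing the picked edge in front of
      a pyramid is injective, and no pyramid is charged more than once.
    \<^item> For a uniformly random choice, the expected potential is at most the number of blocks
      (\<open>mass_pyramids\<close>). A pyramid is its last edge together with at most one pyramid for each of the two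
      blocks of that edge, and \<open>4 = (1 + 4 / 4)\<^sup>2\<close> solves the resulting recursion.

  A choice of least potential therefore admits no family \<open>C\<close>, which proves existence. For the algorithm,
  the same potential bounds the expected number of rounds by the number of blocks. An intersecting
  family of edges is a star or a triangle, so the program finds one by scanning the chosen neighbours
  of every vertex. Its cost is bounded in a calculus of expected running times in which
  divergence and wrong outputs have infinite cost: a finite bound yields almost sure termination,
  correctness and the time bound at once (\<open>ert_finite\<close>). The loop rule \<open>ert_While_le\<close> accepts any potential
  that pays for one iteration in expectation.
\<close>

section \<open>Heaps of resampled edges and the potential\<close>

text \<open>
  \<open>E\<close> contains only edges that join different blocks, as no other edge can be selected. The condition \<open>load\<close>
  is the hypothesis of the local lemma at one block: it adds up, over the edges that meet the block,
  the probability of being selected times \<open>1 / r\<close>.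
\<close>

locale blocks =
  fixes V :: "'v set" and blk :: "'v \<Rightarrow> 'b" and E :: "'v set set" and r :: nat
  assumes finite_V: "finite V"
    and E_sub: "e \<in> E \<Longrightarrow> e \<subseteq> V" and E_card: "e \<in> E \<Longrightarrow> card e = 2"
    and E_inj: "e \<in> E \<Longrightarrow> inj_on blk e"
    and r_pos: "r \<ge> 1"
    and load: "l \<in> blk ` V \<Longrightarrow>
      (\<Sum>e | e \<in> E \<and> l \<in> blk ` e. 1 / (real r * (\<Prod>m\<in>blk ` e. real (card {v\<in>V. blk v = m})))) \<le> 1 / 4"
begin

definition labels where "labels = blk ` V"
definition block where "block l = {v\<in>V. blk v = l}"

lemma finite_labels [simp]: "finite labels" by (simp add: labels_def finite_V)
lemma finite_block [simp]: "finite (block l)" by (simp add: block_def finite_V)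
lemma block_ne: "l \<in> labels \<Longrightarrow> block l \<noteq> {}" by (auto simp: labels_def block_def)
lemma card_block_pos [simp]: "l \<in> labels \<Longrightarrow> card (block l) > 0" by (simp add: block_ne card_gt_0_iff)
lemma finite_E [simp]: "finite E" using E_sub finite_V by (meson Pow_iff finite_Pow_iff finite_subset subsetI)
lemma blk_edge: "e \<in> E \<Longrightarrow> blk ` e \<subseteq> labels" using E_sub by (auto simp: labels_def)
lemma finite_edge: "e \<in> E \<Longrightarrow> finite e" using E_card card.infinite by fastforce
lemma finite_blk_E: "e \<in> E \<Longrightarrow> finite (blk ` e)" by (simp add: finite_edge)
lemma card_blk_E: "e \<in> E \<Longrightarrow> card (blk ` e) = 2" by (simp add: E_inj E_card card_image)
lemma edge_block:
  assumes "e \<in> E" "l \<in> blk ` e" shows "card {x\<in>block l. x \<in> e} = 1"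
proof -
  obtain v where "v \<in> e" "blk v = l" using assms by auto
  then have "{x\<in>block l. x \<in> e} = {v}"
    using E_inj[OF assms(1)] E_sub[OF assms(1)] by (auto simp: block_def inj_on_def)
  then show ?thesis by simp
qed

text \<open>
  A heap of edges is encoded by listing, for every block, the edges that meet it, earliest first. Two
  sequences of edges yield the same lists exactly if they differ by exchanging neighbours without
  a common block. In this encoding the cancellation law for a first piece is immediate.
\<close>

definition void :: "'b \<Rightarrow> 'v set list" where "void = (\<lambda>_. [])"
definition piece :: "'v set \<Rightarrow> 'b \<Rightarrow> 'v set list" where "piece e = (\<lambda>l. if l \<in> blk ` e then [e] else [])"
definition comp :: "('b \<Rightarrow> 'v set list) \<Rightarrow> ('b \<Rightarrow> 'v set list) \<Rightarrow> ('b \<Rightarrow> 'v set list)" (infixr "\<oplus>" 65)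
  where "h \<oplus> g = (\<lambda>l. h l @ g l)"
definition touches :: "'v set \<Rightarrow> ('b \<Rightarrow> 'v set list) \<Rightarrow> bool" where
  "touches e h \<longleftrightarrow> (\<exists>l\<in>blk ` e. h l \<noteq> [])"
definition wf_heap :: "('b \<Rightarrow> 'v set list) \<Rightarrow> bool" where
  "wf_heap h \<longleftrightarrow> (\<forall>l. \<forall>e\<in>set (h l). e \<in> E \<and> l \<in> blk ` e)"

text \<open>
  An edge occurs in the lists of two blocks. Giving each occurrence the factor \<open>1 / sqrt r\<close> gives the
  edge the factor \<open>1 / r\<close>, and keeps the weights products over blocks.
\<close>

definition kappa :: real where "kappa = 1 / sqrt r"
text \<open>
  Up to the factors \<open>1 / r\<close>, the probability that every edge of the heap is selected when its turn comes
  and each block is drawn afresh for every edge in its list.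
\<close>

definition mass :: "('b \<Rightarrow> 'v set list) \<Rightarrow> real" where
  "mass h = (\<Prod>l\<in>labels. (kappa / card (block l)) ^ length (h l))"
text \<open>
  The correction for a block whose present vertex is known: the first edge in its list then fits with
  certainty or not at all, instead of with probability \<open>1 / card (block l)\<close>.
\<close>

definition ratio :: "('b \<Rightarrow> 'v) \<Rightarrow> ('b \<Rightarrow> 'v set list) \<Rightarrow> 'b \<Rightarrow> real" where
  "ratio \<sigma> h l = (if h l = [] then 1 else card (block l) * of_bool (\<sigma> l \<in> hd (h l)))"
text \<open>
  Blocks in \<open>D\<close> are regarded as still undrawn, the others hold the vertex given by \<open>\<sigma>\<close>.
\<close>

definition weight :: "'b set \<Rightarrow> ('b \<Rightarrow> 'v) \<Rightarrow> ('b \<Rightarrow> 'v set list) \<Rightarrow> real" where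
  "weight D \<sigma> h = mass h * (\<Prod>l\<in>labels - D. ratio \<sigma> h l)"

lemma kappa_pos: "kappa > 0" using r_pos by (simp add: kappa_def)
lemma kappa_sq: "kappa * kappa = 1 / r" by (simp add: kappa_def)
lemma mass_nonneg [simp]: "mass h \<ge> 0" unfolding mass_def using kappa_pos by (intro prod_nonneg) auto
lemma ratio_nonneg [simp]: "ratio \<sigma> h l \<ge> 0" by (simp add: ratio_def)
lemma weight_nonneg [simp]: "weight D \<sigma> h \<ge> 0" unfolding weight_def by (intro mult_nonneg_nonneg prod_nonneg) auto

lemma mass_void [simp]: "mass void = 1" by (simp add: mass_def void_def)
lemma mass_comp: "mass (h \<oplus> g) = mass h * mass g" by (simp add: mass_def comp_def power_add prod.distrib)
lemma mass_piece: assumes "e \<in> E" shows "mass (piece e) = (\<Prod>l\<in>blk ` e. kappa / card (block l))"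
proof -
  have "mass (piece e) = (\<Prod>l\<in>labels. if l \<in> blk ` e then kappa / card (block l) else 1)"
    unfolding mass_def piece_def by (intro prod.cong) auto
  also have "\<dots> = (\<Prod>l\<in>labels \<inter> blk ` e. kappa / card (block l))" by (subst prod.inter_restrict) auto
  also have "labels \<inter> blk ` e = blk ` e" using blk_edge[OF assms] by auto
  finally show ?thesis .
qed
lemma mass_piece_eq: assumes "e \<in> E" shows "mass (piece e) = 1 / (r * (\<Prod>l\<in>blk ` e. real (card (block l))))"
proof -
  have "(\<Prod>l\<in>blk ` e. kappa) = 1 / r"
    using card_blk_E[OF assms] by (simp add: power2_eq_square kappa_sq)
  then show ?thesis by (simp add: mass_piece[OF assms] prod_dividef)
qed
lemma weight_labels: "weight labels \<sigma> h = mass h" by (simp add: weight_def)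

lemma weight_cong: "(\<And>l. l \<in> labels - D \<Longrightarrow> \<sigma> l = \<sigma>' l) \<Longrightarrow> weight D \<sigma> h = weight D \<sigma>' h"
  unfolding weight_def ratio_def by (intro arg_cong2[where f="(*)"] refl prod.cong) auto

text \<open>
  The first edge in the list of \<open>l\<close> contains exactly one vertex of that block, so the correction factor
  averages to 1.
\<close>

lemma weight_resample:
  assumes h: "wf_heap h" and l: "l \<in> labels"
  shows "(\<Sum>x\<in>block l. weight D (\<sigma>(l := x)) h) / card (block l) = weight (insert l D) \<sigma> h"
proof (cases "l \<in> D")
  case True
  have "weight D (\<sigma>(l := x)) h = weight D \<sigma> h" for x
    using True by (intro weight_cong) auto
  then show ?thesis using True block_ne[OF l] by (simp add: insert_absorb)
next
  case False
  then have eq: "labels - D = insert l (labels - insert l D)" using l by auto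
  define c where "c = mass h * (\<Prod>m\<in>labels - insert l D. ratio \<sigma> h m)"
  have "weight D (\<sigma>(l := x)) h = c * ratio (\<sigma>(l := x)) h l" for x
  proof -
    have "(\<Prod>m\<in>labels - insert l D. ratio (\<sigma>(l := x)) h m) = (\<Prod>m\<in>labels - insert l D. ratio \<sigma> h m)"
      by (intro prod.cong) (auto simp: ratio_def)
    then show ?thesis unfolding weight_def by (subst eq, subst prod.insert) (auto simp: c_def)
  qed
  moreover have "(\<Sum>x\<in>block l. ratio (\<sigma>(l := x)) h l) = card (block l)"
  proof (cases "h l = []")
    case True
    then show ?thesis by (simp add: ratio_def)
  next
    case False
    then have "hd (h l) \<in> set (h l)" by simp
    then have "card {x\<in>block l. x \<in> hd (h l)} = 1" using h edge_block by (auto simp: wf_heap_def)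
    moreover have "block l \<inter> {x. x \<in> hd (h l)} = {x\<in>block l. x \<in> hd (h l)}" by auto
    ultimately have "(\<Sum>x\<in>block l. of_bool (x \<in> hd (h l))) = (1 :: real)"
      by (simp add: sum_of_bool_eq)
    then show ?thesis using False by (simp add: ratio_def sum_distrib_left[symmetric])
  qed
  ultimately have "(\<Sum>x\<in>block l. weight D (\<sigma>(l := x)) h) = c * card (block l)"
    by (simp flip: sum_distrib_left)
  then show ?thesis using block_ne[OF l] by (simp add: c_def weight_def)
qed

text \<open>
  An arbitrary order of the two ends, so that the blocks of an edge can be told apart.
\<close>

definition end1 where "end1 e = (SOME a. a \<in> e)"
definition end2 where "end2 e = (SOME b. b \<in> e - {end1 e})"

lemma edge_ends: assumes "e \<in> E" shows "blk ` e = {blk (end1 e), blk (end2 e)}" "blk (end1 e) \<noteq> blk (end2 e)"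
proof -
  obtain a b where e: "e = {a, b}" "a \<noteq> b" using E_card[OF assms] by (auto simp: card_2_iff)
  have 1: "end1 e \<in> e" unfolding end1_def using e by (intro someI_ex[of "\<lambda>a. a \<in> e"]) auto
  have 2: "end2 e \<in> e - {end1 e}" unfolding end2_def using e 1 by (intro someI_ex[of "\<lambda>a. a \<in> e - {end1 e}"]) auto
  have e12: "e = {end1 e, end2 e}" using 1 2 e by auto
  then show "blk ` e = {blk (end1 e), blk (end2 e)}" by (metis image_insert image_empty)
  show "blk (end1 e) \<noteq> blk (end2 e)" using 1 2 E_inj[OF assms] by (auto simp: inj_on_def)
qed

text \<open>
  Pyramids with last piece \<open>e\<close>, by height. Below \<open>e\<close>, first come the pieces that must precede the last piece
  at the first block of \<open>e\<close>: they form a pyramid that ends at this block, or nothing. The rest ends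
  at the second block. A heap may arise from several pairs; this is harmless, as only upper
  bounds for sums over pyramids are needed.
\<close>

primrec pyr :: "nat \<Rightarrow> 'v set \<Rightarrow> ('b \<Rightarrow> 'v set list) set" where
  "pyr 0 e = {}"
| "pyr (Suc n) e =
    (\<lambda>(p, q). p \<oplus> q \<oplus> piece e) `
      ((insert void (\<Union>f\<in>{f\<in>E. blk (end1 e) \<in> blk ` f}. pyr n f)) \<times>
       (insert void (\<Union>f\<in>{f\<in>E. blk (end2 e) \<in> blk ` f}. pyr n f)))"

definition layer where "layer n l = insert void (\<Union>f\<in>{f\<in>E. l \<in> blk ` f}. pyr n f)"
lemma pyr_Suc: "pyr (Suc n) e = (\<lambda>(p, q). p \<oplus> q \<oplus> piece e) ` (layer n (blk (end1 e)) \<times> layer n (blk (end2 e)))"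
  by (simp add: layer_def)
declare pyr.simps(2) [simp del]

lemma finite_pyr [simp]: "finite (pyr n e)"
  by (induction n arbitrary: e) (auto simp: pyr_Suc layer_def)
lemma finite_layer [simp]: "finite (layer n l)" by (simp add: layer_def)

lemma pyr_mono: "pyr n e \<subseteq> pyr (Suc n) e"
proof (induction n arbitrary: e)
  case (Suc n)
  have "layer n l \<subseteq> layer (Suc n) l" for l using Suc by (auto simp: layer_def)
  then show ?case unfolding pyr_Suc[of n] pyr_Suc[of "Suc n"] by (intro image_mono Sigma_mono) auto
qed simp

lemma pyr_wf: "e \<in> E \<Longrightarrow> h \<in> pyr n e \<Longrightarrow> wf_heap h"
proof (induction n arbitrary: e h)
  case (Suc n)
  have "wf_heap p" if "p \<in> layer n l" for p l
    using that Suc.IH by (auto simp: layer_def wf_heap_def void_def)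
  then show ?case using Suc.prems by (auto simp: pyr_Suc comp_def wf_heap_def piece_def split: if_splits)
qed simp

lemma pyr_root: "h \<in> pyr n e \<Longrightarrow> l \<in> blk ` e \<Longrightarrow> h l \<noteq> []"
  by (cases n) (auto simp: pyr_Suc comp_def piece_def)

lemma piece_in_pyr: "piece e \<in> pyr (Suc n) e"
  unfolding pyr_Suc by (rule image_eqI[where x="(void, void)"]) (auto simp: layer_def comp_def void_def)

lemma piece_comm: "\<not> touches e h \<Longrightarrow> piece e \<oplus> h = h \<oplus> piece e"
  by (auto simp: touches_def comp_def piece_def fun_eq_iff)

lemma comp_assoc: "(a \<oplus> b) \<oplus> c = a \<oplus> (b \<oplus> c)" by (simp add: comp_def)

text \<open>
  The new piece \<open>f\<close> joins the earliest part of the decomposition that it touches. If it touches neither part,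
  then it meets \<open>e\<close> itself. The part belonging to a common block is void, since its last piece would meet this
  block and be touched by \<open>f\<close>; so \<open>f\<close> alone can take the place of that part.
\<close>

lemma push_pyr: "e \<in> E \<Longrightarrow> f \<in> E \<Longrightarrow> h \<in> pyr n e \<Longrightarrow> touches f h \<Longrightarrow> piece f \<oplus> h \<in> pyr (Suc n) e"
proof (induction n arbitrary: e h)
  case (Suc n)
  obtain p q where h: "h = p \<oplus> q \<oplus> piece e" and p: "p \<in> layer n (blk (end1 e))" and q: "q \<in> layer n (blk (end2 e))"
    using Suc.prems by (auto simp: pyr_Suc)
  have mono: "layer n l \<subseteq> layer (Suc n) l" for l using pyr_mono[of n] unfolding layer_def by blast
  have step: "piece f \<oplus> g \<in> layer (Suc n) l" if "g \<in> layer n l" "touches f g" for g l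
    using that Suc.IH Suc.prems by (auto simp: layer_def touches_def void_def)
  have new: "piece f \<in> layer (Suc n) l" if "l \<in> blk ` f" for l
    using that piece_in_pyr[of f n] Suc.prems by (auto simp: layer_def)
  have empty: "g = void" if "g \<in> layer n l" "l \<in> blk ` f" "\<not> touches f g" for g l
    using that pyr_root by (fastforce simp: layer_def touches_def)
  have I: "p' \<oplus> q' \<oplus> piece e \<in> pyr (Suc (Suc n)) e"
    if "p' \<in> layer (Suc n) (blk (end1 e))" "q' \<in> layer (Suc n) (blk (end2 e))" for p' q'
    unfolding pyr_Suc[of "Suc n"] using that by auto
  consider "touches f p" | "\<not> touches f p" "touches f q" | "\<not> touches f p" "\<not> touches f q" by blast
  then show ?case
  proof cases
    case 1
    then show ?thesis using I[OF step[OF p] subsetD[OF mono q]] by (simp add: h comp_assoc)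
  next
    case 2
    have "piece f \<oplus> h = p \<oplus> (piece f \<oplus> q) \<oplus> piece e"
      using piece_comm[OF 2(1)] by (simp add: h flip: comp_assoc)
    then show ?thesis using I[OF subsetD[OF mono p] step[OF q 2(2)]] by simp
  next
    case 3
    have "touches f (piece e)" using Suc.prems(4) 3 by (auto simp: h touches_def comp_def)
    then obtain l where "l \<in> blk ` f" "l \<in> blk ` e" by (auto simp: touches_def piece_def split: if_splits)
    then have "l = blk (end1 e) \<or> l = blk (end2 e)" unfolding edge_ends(1)[OF Suc.prems(1)] by simp
    with \<open>l \<in> blk ` f\<close> consider "blk (end1 e) \<in> blk ` f" | "blk (end2 e) \<in> blk ` f" by metis
    then show ?thesis
    proof cases
      case 1
      then have "p = void" using empty[OF p] 3 by auto
      then have "piece f \<oplus> h = piece f \<oplus> q \<oplus> piece e" by (simp add: h comp_def void_def)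
      then show ?thesis using I[OF new[OF 1] subsetD[OF mono q]] by simp
    next
      case 2
      then have "q = void" using empty[OF q] 3 by auto
      then have "piece f \<oplus> h = p \<oplus> piece f \<oplus> piece e"
        using piece_comm[OF 3(1)] by (simp add: h comp_def void_def fun_eq_iff)
      then show ?thesis using I[OF subsetD[OF mono p] new[OF 2]] by simp
    qed
  qed
qed simp

lemma load_mass: assumes "l \<in> labels" shows "(\<Sum>e | e \<in> E \<and> l \<in> blk ` e. mass (piece e)) \<le> 1 / 4"
proof -
  have "(\<Sum>e | e \<in> E \<and> l \<in> blk ` e. mass (piece e)) =
     (\<Sum>e | e \<in> E \<and> l \<in> blk ` e. 1 / (real r * (\<Prod>m\<in>blk ` e. real (card {v\<in>V. blk v = m}))))"
    by (intro sum.cong) (auto simp: mass_piece_eq block_def)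
  then show ?thesis using load[of l] assms by (simp add: labels_def)
qed

lemma sum_UN_le: "finite I \<Longrightarrow> (\<And>i. i \<in> I \<Longrightarrow> finite (A i)) \<Longrightarrow> sum mass (\<Union>i\<in>I. A i) \<le> (\<Sum>i\<in>I. sum mass (A i))"
proof (induction rule: finite_induct)
  case (insert x F)
  have "sum mass (\<Union>i\<in>insert x F. A i) \<le> sum mass (A x) + sum mass (\<Union>i\<in>F. A i)"
    using insert by (simp add: sum_Un sum_nonneg)
  then show ?case using insert by simp
qed simp

text \<open>
  The factor 4 reproduces itself: the parts at one block have total mass at most \<open>1 + 4 \<cdot> (1/4) = 2\<close>,
  and \<open>2 \<cdot> 2 = 4\<close>.
\<close>

lemma mass_pyr: "e \<in> E \<Longrightarrow> sum mass (pyr n e) \<le> 4 * mass (piece e)"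
proof (induction n arbitrary: e)
  case (Suc n)
  have lay: "sum mass (layer n l) \<le> 2" if "l \<in> labels" for l
  proof -
    have "sum mass (layer n l) \<le> mass void + sum mass (\<Union>f\<in>{f\<in>E. l \<in> blk ` f}. pyr n f)"
      unfolding layer_def by (subst sum.insert_if) (auto simp: finite_subset[OF _ finite_E])
    also have "sum mass (\<Union>f\<in>{f\<in>E. l \<in> blk ` f}. pyr n f) \<le> (\<Sum>f\<in>{f\<in>E. l \<in> blk ` f}. sum mass (pyr n f))"
      by (rule sum_UN_le) auto
    also have "\<dots> \<le> (\<Sum>f\<in>{f\<in>E. l \<in> blk ` f}. 4 * mass (piece f))"
      by (intro sum_mono Suc.IH) auto
    also have "\<dots> \<le> 1" using load_mass[OF that] by (simp flip: sum_distrib_left)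
    finally show ?thesis by simp
  qed
  have ends: "blk (end1 e) \<in> labels" "blk (end2 e) \<in> labels" using edge_ends[OF Suc.prems] blk_edge[OF Suc.prems] by auto
  have "sum mass (pyr (Suc n) e) \<le> (\<Sum>(p, q)\<in>layer n (blk (end1 e)) \<times> layer n (blk (end2 e)). mass p * mass q * mass (piece e))"
    unfolding pyr_Suc by (rule order_trans[OF sum_image_le]) (auto simp: mass_comp o_def case_prod_beta mult.assoc)
  also have "\<dots> = (\<Sum>p\<in>layer n (blk (end1 e)). \<Sum>q\<in>layer n (blk (end2 e)). mass p * mass q * mass (piece e))"
    by (simp add: sum.cartesian_product)
  also have "\<dots> = sum mass (layer n (blk (end1 e))) * sum mass (layer n (blk (end2 e))) * mass (piece e)"
    by (simp only: sum_product) (simp only: sum_distrib_right)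
  also have "\<dots> \<le> (2 * 2) * mass (piece e)"
    using lay ends by (intro mult_right_mono mult_mono) (auto simp: sum_nonneg)
  finally show ?case by simp
qed simp

definition pyramids where "pyramids = (\<Union>n. \<Union>e\<in>E. pyr n e)"

lemma pyramids_wf: "h \<in> pyramids \<Longrightarrow> wf_heap h" using pyr_wf by (auto simp: pyramids_def)
lemma piece_in_pyramids: "e \<in> E \<Longrightarrow> piece e \<in> pyramids"
  using piece_in_pyr[of e 0] unfolding pyramids_def by blast
lemma push_in_pyramids: assumes "f \<in> E" "h \<in> pyramids" "touches f h" shows "piece f \<oplus> h \<in> pyramids"
proof -
  obtain n e where "e \<in> E" "h \<in> pyr n e" using assms by (auto simp: pyramids_def)
  then have "piece f \<oplus> h \<in> pyr (Suc n) e" using push_pyr assms by blast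
  then show ?thesis using \<open>e \<in> E\<close> unfolding pyramids_def by blast
qed

text \<open>
  The bound for one last edge is summed over all edges by distributing them to the blocks that they meet.
\<close>

lemma mass_pyramids: "(\<integral>\<^sup>+ h. ennreal (mass h) \<partial>count_space pyramids) \<le> of_nat (card labels)"
proof -
  define A where "A n = (\<Union>e\<in>E. pyr n e)" for n
  have fin: "finite (A n)" for n by (simp add: A_def)
  have mono: "A n \<subseteq> A (Suc n)" for n unfolding A_def using pyr_mono by blast
  have mono': "m \<le> n \<Longrightarrow> A m \<subseteq> A n" for m n using mono by (rule lift_Suc_mono_le)
  have bnd: "(\<integral>\<^sup>+ h. ennreal (mass h) * indicator (A n) h \<partial>count_space UNIV) \<le> of_nat (card labels)" for n
  proof -
    have "sum mass (A n) \<le> (\<Sum>e\<in>E. 4 * mass (piece e))"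
      unfolding A_def by (rule order_trans[OF sum_UN_le]) (auto intro!: sum_mono mass_pyr)
    also have "\<dots> \<le> (\<Sum>e\<in>E. \<Sum>l\<in>blk ` e. 4 * mass (piece e))"
      using card_blk_E by (intro sum_mono) auto
    also have "\<dots> = (\<Sum>e\<in>E. \<Sum>l | l \<in> labels \<and> l \<in> blk ` e. 4 * mass (piece e))"
      using blk_edge by (intro sum.cong) auto
    also have "\<dots> = (\<Sum>l\<in>labels. \<Sum>e | e \<in> E \<and> l \<in> blk ` e. 4 * mass (piece e))"
      by (rule sum.swap_restrict) auto
    also have "\<dots> \<le> (\<Sum>l\<in>labels. 1)"
    proof (rule sum_mono)
      fix l assume "l \<in> labels"
      from load_mass[OF this] show "(\<Sum>e | e \<in> E \<and> l \<in> blk ` e. 4 * mass (piece e)) \<le> 1"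
        unfolding sum_distrib_left[symmetric] by linarith
    qed
    finally have "sum mass (A n) \<le> card labels" by simp
    then show ?thesis using fin
      by (simp add: nn_integral_count_space_indicator[symmetric] nn_integral_count_space_finite
            ennreal_of_nat_eq_real_of_nat sum_ennreal ennreal_leI)
  qed
  have pyramids: "pyramids = (\<Union>n. A n)" by (simp add: pyramids_def A_def)
  have "(\<integral>\<^sup>+ h. ennreal (mass h) \<partial>count_space pyramids) = (\<integral>\<^sup>+ h. (SUP n. ennreal (mass h) * indicator (A n) h) \<partial>count_space UNIV)"
  proof (subst nn_integral_count_space_indicator, simp, intro nn_integral_cong)
    fix h show "ennreal (mass h) * indicator pyramids h = (SUP n. ennreal (mass h) * indicator (A n) h)"
    proof (rule antisym)
      show "ennreal (mass h) * indicator pyramids h \<le> (SUP n. ennreal (mass h) * indicator (A n) h)"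
      proof (cases "h \<in> pyramids")
        case True
        then obtain n where "h \<in> A n" by (auto simp: pyramids)
        then show ?thesis using True by (intro SUP_upper2[of n]) auto
      qed simp
      show "(SUP n. ennreal (mass h) * indicator (A n) h) \<le> ennreal (mass h) * indicator pyramids h"
        by (intro SUP_least mult_left_mono) (auto simp: pyramids split: split_indicator)
    qed
  qed
  also have "\<dots> = (SUP n. \<integral>\<^sup>+ h. ennreal (mass h) * indicator (A n) h \<partial>count_space UNIV)"
    using mono' by (intro nn_integral_monotone_convergence_SUP)
      (auto simp: incseq_def le_fun_def intro!: mult_left_mono split: split_indicator)
  also have "\<dots> \<le> of_nat (card labels)" using bnd by (intro SUP_least)
  finally show ?thesis .
qed

text \<open>
  For \<open>D = {}\<close> this bounds the expected number of rounds from \<open>\<sigma>\<close> on: a pyramid is the possible history of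
  its last piece, and different rounds have different histories.
\<close>

definition potential :: "'b set \<Rightarrow> ('b \<Rightarrow> 'v) \<Rightarrow> ennreal" where
  "potential D \<sigma> = (\<integral>\<^sup>+ h. ennreal (weight D \<sigma> h) \<partial>count_space pyramids)"

lemma potential_cong: "(\<And>l. l \<in> labels - D \<Longrightarrow> \<sigma> l = \<sigma>' l) \<Longrightarrow> potential D \<sigma> = potential D \<sigma>'"
  unfolding potential_def using weight_cong[of D \<sigma> \<sigma>'] by simp

lemma potential_labels: "potential labels \<sigma> \<le> of_nat (card labels)"
  using mass_pyramids by (simp add: potential_def weight_labels)

lemma potential_resample:
  assumes l: "l \<in> labels"
  shows "(\<Sum>x\<in>block l. potential D (\<sigma>(l := x))) / of_nat (card (block l)) = potential (insert l D) \<sigma>"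
proof -
  have "(\<Sum>x\<in>block l. potential D (\<sigma>(l := x))) / of_nat (card (block l)) =
     (\<integral>\<^sup>+ h. (\<Sum>x\<in>block l. ennreal (weight D (\<sigma>(l := x)) h)) / of_nat (card (block l)) \<partial>count_space pyramids)"
    unfolding potential_def by (simp add: nn_integral_sum nn_integral_divide del: sum_ennreal)
  also have "\<dots> = potential (insert l D) \<sigma>"
    unfolding potential_def
  proof (intro nn_integral_cong)
    fix h assume "h \<in> space (count_space pyramids)"
    then have "wf_heap h" using pyramids_wf by simp
    then have "weight (insert l D) \<sigma> h = (\<Sum>x\<in>block l. weight D (\<sigma>(l := x)) h) / card (block l)"
      using weight_resample l by simp
    moreover have "real (card (block l)) > 0" using card_block_pos[OF l] by linarith
    ultimately show "(\<Sum>x\<in>block l. ennreal (weight D (\<sigma>(l := x)) h)) / of_nat (card (block l)) = ennreal (weight (insert l D) \<sigma> h)"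
      by (simp only: sum_ennreal weight_nonneg ennreal_of_nat_eq_real_of_nat divide_ennreal sum_nonneg)
  qed
  finally show ?thesis .
qed

text \<open>
  Meeting the selected edge \<open>e\<close> first and then the edges of \<open>h\<close> is the same as redrawing the blocks of \<open>e\<close> and
  then meeting the edges of \<open>h\<close>; the factor \<open>1 / r\<close> belongs to \<open>e\<close>.
\<close>

lemma weight_push:
  assumes e: "e \<in> E" and \<sigma>: "\<And>l. l \<in> blk ` e \<Longrightarrow> \<sigma> l \<in> e"
  shows "weight {} \<sigma> (piece e \<oplus> h) = weight (blk ` e) \<sigma> h / r"
proof -
  have "(\<Prod>l\<in>labels. ratio \<sigma> (piece e \<oplus> h) l) =
     (\<Prod>l\<in>blk ` e. ratio \<sigma> (piece e \<oplus> h) l) * (\<Prod>l\<in>labels - blk ` e. ratio \<sigma> (piece e \<oplus> h) l)"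
    using blk_edge[OF e] by (subst prod.subset_diff[of "blk ` e" labels]) (auto simp: mult.commute)
  also have "(\<Prod>l\<in>blk ` e. ratio \<sigma> (piece e \<oplus> h) l) = (\<Prod>l\<in>blk ` e. real (card (block l)))"
    by (intro prod.cong refl) (use \<sigma> in \<open>simp add: ratio_def comp_def piece_def\<close>)
  also have "(\<Prod>l\<in>labels - blk ` e. ratio \<sigma> (piece e \<oplus> h) l) = (\<Prod>l\<in>labels - blk ` e. ratio \<sigma> h l)"
    by (intro prod.cong refl) (simp add: ratio_def comp_def piece_def)
  finally have *: "weight {} \<sigma> (piece e \<oplus> h) = mass (piece e) * (\<Prod>l\<in>blk ` e. real (card (block l))) * weight (blk ` e) \<sigma> h"
    by (simp add: weight_def mass_comp)
  have "(\<Prod>l\<in>blk ` e. real (card (block l))) \<noteq> 0"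
    using blk_edge[OF e] block_ne by (auto simp: finite_blk_E[OF e])
  then show ?thesis unfolding * using r_pos by (simp add: mass_piece_eq[OF e])
qed

lemma weight_untouched:
  assumes e: "e \<in> E" and "\<not> touches e h"
  shows "weight (blk ` e) \<sigma> h = weight {} \<sigma> h"
proof -
  have "(\<Prod>l\<in>labels - blk ` e. ratio \<sigma> h l) = (\<Prod>l\<in>labels. ratio \<sigma> h l)"
    by (rule prod.mono_neutral_left) (use assms(2) in \<open>auto simp: touches_def ratio_def\<close>)
  then show ?thesis by (simp add: weight_def)
qed

lemma weight_piece:
  assumes e: "e \<in> E" and \<sigma>: "\<And>l. l \<in> blk ` e \<Longrightarrow> \<sigma> l \<in> e"
  shows "weight {} \<sigma> (piece e) = 1 / r"
proof -
  have "weight {} \<sigma> (piece e \<oplus> void) = weight (blk ` e) \<sigma> void / r"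
    by (rule weight_push[OF e \<sigma>])
  also have "weight (blk ` e) \<sigma> void = 1"
    by (simp add: weight_def) (simp add: void_def ratio_def)
  finally have "weight {} \<sigma> (piece e \<oplus> void) = 1 / r" .
  then show ?thesis by (simp add: comp_def void_def)
qed

text \<open>
  The edge \<open>c x\<close> is chosen with probability \<open>1 / card Z \<le> 1 / r\<close> and its blocks are redrawn. A pyramid \<open>h\<close>
  touched by \<open>c x\<close> then contributes at most as much as the pyramid with \<open>c x\<close> placed in front did before; a
  pyramid not touched contributes \<open>1 / card Z\<close> times what it did before. The remaining term 1 is paid for by the
  pyramids consisting of a single edge \<open>c x\<close>, each of weight \<open>1 / r\<close>. No pyramid \<open>g\<close> is used twice: if \<open>g\<close> starts with
  \<open>c x\<close>, then it determines \<open>x\<close> and, as the family is intersecting, it is touched by all its members;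
  otherwise it is used at most once for every \<open>x\<close>, with factor \<open>1 / card Z\<close>.
\<close>

lemma potential_drift:
  assumes Z: "finite Z" "card Z \<ge> r" and inj: "inj_on c Z" and cE: "\<And>x. x \<in> Z \<Longrightarrow> c x \<in> E"
    and \<sigma>: "\<And>x l. x \<in> Z \<Longrightarrow> l \<in> blk ` c x \<Longrightarrow> \<sigma> l \<in> c x"
    and int: "\<And>x y. x \<in> Z \<Longrightarrow> y \<in> Z \<Longrightarrow> c x \<inter> c y \<noteq> {}"
  shows "1 + (\<Sum>x\<in>Z. potential (blk ` c x) \<sigma>) / of_nat (card Z) \<le> potential {} \<sigma>"
proof -
  define z where "z = card Z"
  have z: "z \<ge> r" "z > 0" using Z r_pos by (auto simp: z_def)
  define w where "w h = ennreal (weight {} \<sigma> h)" for h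
  define P where "P x = (\<lambda>h. piece (c x) \<oplus> h) ` {h\<in>pyramids. touches (c x) h}" for x
  define N where "N x = {h\<in>pyramids. \<not> touches (c x) h}" for x
  (* the share of the pyramid g that pays for the choice of c x: as a single edge, with c x in front, or untouched *)
  define k where "k x g = (indicator {piece (c x)} g + indicator (P x) g + indicator (N x) g / of_nat z :: ennreal)" for x g
  have PX: "P x \<subseteq> pyramids" if "x \<in> Z" for x using push_in_pyramids cE that by (auto simp: P_def)
  have NX: "N x \<subseteq> pyramids" for x by (auto simp: N_def)
  have pX: "piece (c x) \<in> pyramids" if "x \<in> Z" for x using piece_in_pyramids cE that by auto

  have one: "1 \<le> (\<Sum>x\<in>Z. w (piece (c x)))"
  proof -
    have "(\<Sum>x\<in>Z. w (piece (c x))) = (\<Sum>x\<in>Z. ennreal (1 / r))"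
      unfolding w_def by (intro sum.cong refl arg_cong[where f=ennreal] weight_piece cE \<sigma>) auto
    also have "\<dots> = ennreal (z / r)"
      by (subst sum_ennreal) (auto simp: z_def)
    also have "\<dots> \<ge> ennreal 1" using z r_pos by (intro ennreal_leI) (simp add: field_simps)
    finally show ?thesis by simp
  qed
  have each: "potential (blk ` c x) \<sigma> / of_nat z \<le>
      (\<integral>\<^sup>+ g. w g * indicator (P x) g \<partial>count_space pyramids) + (\<integral>\<^sup>+ g. w g * (indicator (N x) g / of_nat z) \<partial>count_space pyramids)"
    if x: "x \<in> Z" for x
  proof -
    let ?T = "{h\<in>pyramids. touches (c x) h}"
    have "potential (blk ` c x) \<sigma> / of_nat z = (\<integral>\<^sup>+ h. ennreal (weight (blk ` c x) \<sigma> h / z) \<partial>count_space pyramids)"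
      unfolding potential_def using z
      by (subst nn_integral_divide[symmetric]) (auto simp: divide_ennreal ennreal_of_nat_eq_real_of_nat intro!: nn_integral_cong)
    also have "\<dots> \<le> (\<integral>\<^sup>+ h. w (piece (c x) \<oplus> h) * indicator ?T h + w h * (indicator (N x) h / of_nat z) \<partial>count_space pyramids)"
    proof (intro nn_integral_mono)
      fix h assume "h \<in> space (count_space pyramids)"
      then have h: "h \<in> pyramids" by simp
      show "ennreal (weight (blk ` c x) \<sigma> h / z) \<le> w (piece (c x) \<oplus> h) * indicator ?T h + w h * (indicator (N x) h / of_nat z)"
      proof (cases "touches (c x) h")
        case True
        have "weight (blk ` c x) \<sigma> h / z \<le> weight (blk ` c x) \<sigma> h / r"
          using z r_pos by (intro divide_left_mono) auto
        then show ?thesis using True h weight_push[OF cE[OF x] \<sigma>[OF x]]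
          by (simp add: w_def N_def ennreal_leI)
      next
        case False
        then show ?thesis using h weight_untouched[OF cE[OF x] False] z
          by (simp add: w_def N_def divide_ennreal_def inverse_ennreal ennreal_of_nat_eq_real_of_nat flip: ennreal_mult)
             (simp add: field_simps)
      qed
    qed
    also have "\<dots> = (\<integral>\<^sup>+ h. w (piece (c x) \<oplus> h) * indicator ?T h \<partial>count_space pyramids) + (\<integral>\<^sup>+ g. w g * (indicator (N x) g / of_nat z) \<partial>count_space pyramids)"
      by (rule nn_integral_add) auto
    also have "(\<integral>\<^sup>+ h. w (piece (c x) \<oplus> h) * indicator ?T h \<partial>count_space pyramids) = (\<integral>\<^sup>+ h. w (piece (c x) \<oplus> h) \<partial>count_space ?T)"
      by (subst (1 2) nn_integral_count_space_indicator) (auto intro!: nn_integral_cong split: split_indicator)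
    also have "\<dots> = (\<integral>\<^sup>+ g. w g \<partial>count_space (P x))"
      unfolding P_def by (rule nn_integral_bij_count_space)
        (auto simp: bij_betw_def inj_on_def comp_def fun_eq_iff)
    also have "\<dots> = (\<integral>\<^sup>+ g. w g * indicator (P x) g \<partial>count_space pyramids)"
      using PX[OF x] by (subst (1 2) nn_integral_count_space_indicator) (auto intro!: nn_integral_cong split: split_indicator)
    finally show ?thesis .
  qed
  have single: "w (piece (c x)) = (\<integral>\<^sup>+ g. w g * indicator {piece (c x)} g \<partial>count_space pyramids)" if "x \<in> Z" for x
    using pX[OF that] by (subst nn_integral_count_space'[of "{piece (c x)}"]) auto
  have "1 + (\<Sum>x\<in>Z. potential (blk ` c x) \<sigma>) / of_nat z = 1 + (\<Sum>x\<in>Z. potential (blk ` c x) \<sigma> / of_nat z)"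
    by (simp add: divide_ennreal_def sum_distrib_right)
  also have "\<dots> \<le> (\<Sum>x\<in>Z. w (piece (c x))) + (\<Sum>x\<in>Z. (\<integral>\<^sup>+ g. w g * indicator (P x) g \<partial>count_space pyramids) + (\<integral>\<^sup>+ g. w g * (indicator (N x) g / of_nat z) \<partial>count_space pyramids))"
    by (intro add_mono one sum_mono each)
  also have "\<dots> = (\<Sum>x\<in>Z. (\<integral>\<^sup>+ g. w g * k x g \<partial>count_space pyramids))"
    unfolding sum.distrib[symmetric]
    by (intro sum.cong refl) (simp add: single k_def distrib_left nn_integral_add add.assoc)
  also have "\<dots> = (\<integral>\<^sup>+ g. w g * (\<Sum>x\<in>Z. k x g) \<partial>count_space pyramids)"
    by (simp add: nn_integral_sum sum_distrib_left)
  also have "\<dots> \<le> (\<integral>\<^sup>+ g. w g * 1 \<partial>count_space pyramids)"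
  proof (intro nn_integral_mono mult_left_mono)
    fix g
    define starts where "starts x = (\<forall>l\<in>blk ` c x. g l \<noteq> [] \<and> hd (g l) = c x)" for x
    have st: "starts x" if "g \<in> insert (piece (c x)) (P x)" for x
      using that by (auto simp: starts_def P_def comp_def piece_def)
    have touch: "\<exists>l. l \<in> blk ` c x \<and> l \<in> blk ` c y" if "x \<in> Z" "y \<in> Z" for x y
      using int[OF that] by auto
    show "(\<Sum>x\<in>Z. k x g) \<le> 1"
    proof (cases "\<exists>x\<in>Z. g \<in> insert (piece (c x)) (P x)")
      case True
      then obtain x where x: "x \<in> Z" "g \<in> insert (piece (c x)) (P x)" by blast
      have sx: "starts x" using st x by blast
      have zero: "k y g = 0" if y: "y \<in> Z" "y \<noteq> x" for y
      proof -
        obtain l where l: "l \<in> blk ` c x" "l \<in> blk ` c y" using touch x y by blast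
        have "c x \<noteq> c y" using inj x y by (auto simp: inj_on_def)
        then have "\<not> starts y" using l sx unfolding starts_def by metis
        then have "g \<notin> insert (piece (c y)) (P y)" using st by blast
        moreover have "g l \<noteq> []" using l(1) sx unfolding starts_def by blast
        then have "g \<notin> N y" using l(2) unfolding N_def touches_def by blast
        ultimately show ?thesis by (simp add: k_def)
      qed
      have "g \<notin> N x" using sx cE[OF x(1)] edge_ends(1) by (fastforce simp: N_def touches_def starts_def)
      moreover have "piece (c x) \<notin> P x"
        by (auto simp: P_def comp_def piece_def fun_eq_iff touches_def split: if_splits)
      ultimately have "k x g \<le> 1" by (auto simp: k_def indicator_def)
      then show ?thesis using zero x Z by (simp add: sum.remove[of Z x])
    next
      case False
      then have "(\<Sum>x\<in>Z. k x g) \<le> (\<Sum>x\<in>Z. 1 / of_nat z)"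
        by (intro sum_mono) (auto simp: k_def indicator_def)
      also have "\<dots> = 1" using z by (simp add: ennreal_times_divide ennreal_divide_self of_nat_less_top flip: z_def)
      finally show ?thesis .
    qed
  qed simp
  also have "\<dots> = potential {} \<sigma>" by (simp add: potential_def w_def)
  finally show ?thesis by (simp add: z_def)
qed

end

section \<open>From a potential to a transversal\<close>

lemma ex_le_average_ennreal:
  fixes f :: "'x \<Rightarrow> ennreal"
  assumes "finite A" "A \<noteq> {}"
  shows "\<exists>x\<in>A. f x \<le> sum f A / of_nat (card A)"
proof -
  obtain x where x: "x \<in> A" "\<And>y. y \<in> A \<Longrightarrow> f x \<le> f y"
    using ex_is_arg_min_if_finite[OF assms, of f] by (auto simp: is_arg_min_linorder)
  have c: "of_nat (card A) \<noteq> (0 :: ennreal)" "of_nat (card A) < (\<top> :: ennreal)"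
    using assms by (auto simp: of_nat_less_top)
  have "f x = of_nat (card A) * f x / of_nat (card A)"
    using c by (metis ennreal_mult_divide_eq mult.commute order_less_irrefl)
  also have "\<dots> \<le> sum f A / of_nat (card A)"
    using x(2) by (intro divide_right_mono_ennreal sum_bounded_below)
  finally show ?thesis using x(1) by blast
qed

context blocks
begin

definition states where "states = PiE labels block"
definition bad_family where
  "bad_family \<sigma> C \<longleftrightarrow> C \<subseteq> E \<and> card C \<ge> r \<and> (\<forall>e\<in>C. \<forall>l\<in>blk ` e. \<sigma> l \<in> e) \<and> (\<forall>e\<in>C. \<forall>f\<in>C. e \<inter> f \<noteq> {})"

text \<open>
  Fix the undrawn blocks one at a time, each at a vertex that is no worse than the average.
\<close>

lemma descend:
  assumes "D \<subseteq> labels" "\<sigma> \<in> states" shows "\<exists>\<sigma>'\<in>states. potential {} \<sigma>' \<le> potential D \<sigma>"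
  using finite_subset[OF assms(1) finite_labels] assms
proof (induction D arbitrary: \<sigma> rule: finite_induct)
  case (insert l D)
  then have l: "l \<in> labels" by auto
  obtain x where x: "x \<in> block l" "potential D (\<sigma>(l := x)) \<le> potential (insert l D) \<sigma>"
    using ex_le_average_ennreal[OF finite_block block_ne[OF l], of "\<lambda>x. potential D (\<sigma>(l := x))"] potential_resample[OF l, of D \<sigma>] by auto
  have "\<sigma>(l := x) \<in> states" using insert.prems l x(1) by (auto simp: states_def PiE_iff extensional_def)
  then obtain \<sigma>' where "\<sigma>' \<in> states" "potential {} \<sigma>' \<le> potential D (\<sigma>(l := x))" using insert by auto
  then show ?case using x(2) by (meson order_trans)
qed auto

text \<open>
  Take a choice of least potential, which is finite by averaging. If it admitted a bad family, the drift
  inequality would produce a choice whose potential is smaller by at least 1.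
\<close>

lemma good_state: "\<exists>\<sigma>\<in>states. \<nexists>C. bad_family \<sigma> C"
proof -
  have ne: "states \<noteq> {}" and fin: "finite states"
    using block_ne by (auto simp: states_def PiE_eq_empty_iff intro!: finite_PiE)
  obtain \<sigma> where \<sigma>: "\<sigma> \<in> states" "\<And>\<sigma>'. \<sigma>' \<in> states \<Longrightarrow> potential {} \<sigma> \<le> potential {} \<sigma>'"
    using ex_is_arg_min_if_finite[OF fin ne, of "potential {}"] by (auto simp: is_arg_min_linorder)
  have "potential {} \<sigma> \<le> of_nat (card labels)"
    using descend[OF subset_refl \<sigma>(1)] \<sigma>(2) potential_labels[of \<sigma>] by (meson order_trans)
  then have fin_Phi: "potential {} \<sigma> < \<top>" by (meson le_less_trans of_nat_less_top)
  have "False" if C: "bad_family \<sigma> C" for C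
  proof -
    have C': "C \<subseteq> E" "card C \<ge> r" "finite C" "C \<noteq> {}"
      using C r_pos finite_subset[OF _ finite_E] by (auto simp: bad_family_def)
    have "1 + (\<Sum>e\<in>C. potential (blk ` e) \<sigma>) / of_nat (card C) \<le> potential {} \<sigma>"
      using potential_drift[of C "\<lambda>e. e" \<sigma>] C C' by (auto simp: bad_family_def)
    moreover obtain e where e: "e \<in> C" "potential (blk ` e) \<sigma> \<le> (\<Sum>e\<in>C. potential (blk ` e) \<sigma>) / of_nat (card C)"
      using ex_le_average_ennreal[OF C'(3,4), of "\<lambda>e. potential (blk ` e) \<sigma>"] by auto
    moreover obtain \<sigma>' where "\<sigma>' \<in> states" "potential {} \<sigma>' \<le> potential (blk ` e) \<sigma>"
      using descend[OF blk_edge \<sigma>(1)] e C' by blast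
    ultimately have "1 + potential {} \<sigma> \<le> potential {} \<sigma>"
      using \<sigma>(2) by (meson add_left_mono order_trans)
    then show False using fin_Phi by (cases "potential {} \<sigma>") (auto simp flip: ennreal_1 ennreal_plus)
  qed
  then show ?thesis using \<sigma>(1) by blast
qed

end

definition cross :: "('v \<Rightarrow> 'b) \<Rightarrow> 'v graph \<Rightarrow> 'v set set" where
  "cross blk G = {e \<in> edges G. inj_on blk e}"

definition labels_blocks :: "('v \<Rightarrow> 'b) \<Rightarrow> 'v set set \<Rightarrow> bool" where
  "labels_blocks blk P \<longleftrightarrow> (\<forall>B\<in>P. \<forall>v\<in>B. {w\<in>\<Union>P. blk w = blk v} = B)"

text \<open>
  At most \<open>d \<cdot> card B\<close> edges meet a block \<open>B\<close>, and each contributes at most \<open>1 / (r \<cdot> card B \<cdot> b)\<close>, which gives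
  \<open>d / (r b) \<le> 1 / 4\<close>.
\<close>

lemma blocks_of_setting:
  assumes bs: "block_setting H r G P b d" and bd: "b \<ge> 4 * d / real r" and lb: "labels_blocks blk P"
  shows "blocks (verts G) blk (cross blk G) r"
proof
  have G: "finite (verts G)" "\<And>e. e \<in> edges G \<Longrightarrow> e \<subseteq> verts G \<and> card e = 2" and P: "partition_on (verts G) P"
    and r: "r \<ge> 1" and b: "\<And>B. B \<in> P \<Longrightarrow> real (card B) \<ge> b" and d: "d = max_average_degree G P"
    using bs by (auto simp: block_setting_def ugraph_def)
  have UP: "\<Union>P = verts G" using P by (simp add: partition_on_def)
  show "finite (verts G)" "1 \<le> r" by fact+
  show "e \<subseteq> verts G" "card e = 2" "inj_on blk e" if "e \<in> cross blk G" for e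
    using that G by (auto simp: cross_def)
  fix l assume "l \<in> blk ` verts G"
  then obtain v where v: "v \<in> verts G" "l = blk v" by blast
  then obtain B where B: "B \<in> P" "v \<in> B" using UP by blast
  have Bl: "{w\<in>verts G. blk w = l} = B" using lb B v(2) UP by (auto simp: labels_blocks_def)
  have blockP: "{w\<in>verts G. blk w = m} \<in> P" if m: "m \<in> blk ` verts G" for m
  proof -
    obtain w where w: "w \<in> verts G" "m = blk w" using m by blast
    then obtain B' where "B' \<in> P" "w \<in> B'" using UP by blast
    moreover have "{u\<in>verts G. blk u = m} = B'" using lb calculation w(2) UP by (auto simp: labels_blocks_def)
    ultimately show ?thesis by simp
  qed
  have finB: "finite B" using B UP G(1) by (metis Union_upper finite_subset)
  have Bpos: "card B > 0" using finB B by (auto simp: card_gt_0_iff)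
  have finE: "finite (edges G)" using G by (meson Pow_iff finite_Pow_iff finite_subset subsetI)
  have finP: "finite P" using UP G(1) by (simp add: finite_UnionD)
  define T where "T = {e \<in> cross blk G. l \<in> blk ` e}"
  define q where "q e = 1 / (real r * (\<Prod>m\<in>blk ` e. real (card {v \<in> verts G. blk v = m})))" for e
  (* positivity of d, and hence of b, is only available if some edge meets the block *)
  have "sum q T \<le> 1 / 4"
  proof (cases "T = {}")
    case False
    have "T \<subseteq> (\<Union>w\<in>B. {e\<in>edges G. w \<in> e})"
      using G Bl by (fastforce simp: T_def cross_def)
    then have "card T \<le> card (\<Union>w\<in>B. {e\<in>edges G. w \<in> e})"
      using finB finE by (intro card_mono) auto
    also have "\<dots> \<le> (\<Sum>w\<in>B. degree_in G w)"
      unfolding degree_in_def by (rule card_UN_le[OF finB])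
    finally have "real (card T) \<le> (\<Sum>w\<in>B. real (degree_in G w))"
      by (metis of_nat_le_iff of_nat_sum)
    also have "\<dots> = average_degree G B * card B" using Bpos by (simp add: average_degree_def)
    also have "\<dots> \<le> d * card B"
      unfolding d max_average_degree_def using finP B by (intro mult_right_mono Max_ge) auto
    finally have Td: "real (card T) \<le> d * card B" .
    have "finite T" using finE by (simp add: T_def cross_def)
    then have "card T > 0" using False by (simp add: card_gt_0_iff)
    then have dpos: "d > 0" using Td Bpos
      by (metis linorder_not_less mult_nonpos_nonneg of_nat_0_le_iff of_nat_0_less_iff order_less_le_trans)
    have rb: "4 * d \<le> real r * b" using bd r by (simp add: field_simps)
    then have bpos: "b > 0" using dpos r by (smt (verit) mult_nonneg_nonpos of_nat_0_le_iff)
    have "q e \<le> 1 / (real r * (real (card B) * b))"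
      if e: "e \<in> T" for e
    proof -
      have "card (blk ` e) = 2" using e G by (auto simp: T_def cross_def card_image)
      then obtain x y where xy: "blk ` e = {x, y}" "x \<noteq> y" by (meson card_2_iff)
      have "l \<in> blk ` e" using e unfolding T_def mem_Collect_eq by (rule conjunct2)
      then have "l = x \<or> l = y" unfolding xy(1) by simp
      then obtain m where m: "blk ` e = {l, m}" "l \<noteq> m" using xy by (metis insert_commute)
      have "e \<subseteq> verts G" using e G by (simp add: T_def cross_def)
      then have "m \<in> blk ` verts G" using m(1) by blast
      then have "real (card {v \<in> verts G. blk v = m}) \<ge> b" by (intro b blockP)
      then show ?thesis using m r Bpos bpos
        by (simp add: q_def Bl) (intro divide_left_mono mult_left_mono mult_pos_pos; simp)
    qed
    then have "sum q T \<le> (\<Sum>e\<in>T. 1 / (real r * (real (card B) * b)))"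
      by (rule sum_mono)
    also have "\<dots> = card T / (r * (card B * b))" by simp
    also have "\<dots> \<le> (d * card B) / (r * (card B * b))"
      using Td r Bpos bpos by (intro divide_right_mono) auto
    also have "\<dots> = d / (r * b)" using Bpos by simp
    also have "\<dots> \<le> 1 / 4" using rb r bpos by (simp add: field_simps)
    finally show ?thesis .
  qed simp
  then show "(\<Sum>e | e \<in> cross blk G \<and> l \<in> blk ` e. 1 / (real r * (\<Prod>m\<in>blk ` e. real (card {v \<in> verts G. blk v = m})))) \<le> 1 / 4"
    by (simp add: q_def T_def)
qed

text \<open>
  A copy of \<open>H\<close> in the induced subgraph maps the edges of \<open>H\<close> injectively to \<open>r\<close> selected edges, and they
  intersect because the edges of \<open>H\<close> do. They join different blocks, as a block holds only one chosen vertex.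
\<close>

lemma good_state_transversal:
  assumes bs: "block_setting H r G P b d" and lb: "labels_blocks blk P"
    and \<sigma>: "\<And>l. l \<in> blk ` verts G \<Longrightarrow> \<sigma> l \<in> verts G \<and> blk (\<sigma> l) = l"
    and good: "\<And>C. C \<subseteq> cross blk G \<Longrightarrow> card C = r \<Longrightarrow> (\<And>e l. e \<in> C \<Longrightarrow> l \<in> blk ` e \<Longrightarrow> \<sigma> l \<in> e) \<Longrightarrow>
       (\<And>e f. e \<in> C \<Longrightarrow> f \<in> C \<Longrightarrow> e \<inter> f \<noteq> {}) \<Longrightarrow> False"
  shows "transversal P (\<sigma> ` blk ` verts G)" "avoids G (\<sigma> ` blk ` verts G) H"
proof -
  define A where "A = \<sigma> ` blk ` verts G"
  have UP: "\<Union>P = verts G" using bs by (simp add: block_setting_def partition_on_def)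
  have A: "v \<in> verts G \<and> \<sigma> (blk v) = v" if "v \<in> A" for v
    using that \<sigma> by (auto simp: A_def)
  show "transversal P (\<sigma> ` blk ` verts G)"
    unfolding transversal_def A_def[symmetric]
  proof (intro conjI ballI)
    show "A \<subseteq> \<Union>P" using A UP by auto
    fix B assume B: "B \<in> P"
    then have "B \<noteq> {}" using bs by (auto simp: block_setting_def partition_on_def)
    then obtain v where v: "v \<in> B" by blast
    have Bv: "{w\<in>verts G. blk w = blk v} = B" using lb B v UP by (auto simp: labels_blocks_def)
    have vV: "v \<in> verts G" using v B UP by auto
    show "\<exists>!x. x \<in> A \<inter> B"
    proof (rule ex1I[of _ "\<sigma> (blk v)"])
      show "\<sigma> (blk v) \<in> A \<inter> B" using \<sigma>[of "blk v"] vV Bv by (auto simp: A_def)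
      fix x assume "x \<in> A \<inter> B"
      then show "x = \<sigma> (blk v)" using A[of x] Bv by auto
    qed
  qed
  show "avoids G (\<sigma> ` blk ` verts G) H"
    unfolding avoids_def A_def[symmetric]
  proof
    assume "contains_copy (induced G A) H"
    then obtain \<phi> where \<phi>: "inj_on \<phi> (verts H)" "\<And>e. e \<in> edges H \<Longrightarrow> \<phi> ` e \<in> edges G \<and> \<phi> ` e \<subseteq> A"
      by (auto simp: contains_copy_def induced_def)
    have H: "\<And>e. e \<in> edges H \<Longrightarrow> e \<subseteq> verts H" "intersecting H" "card (edges H) = r"
      using bs by (auto simp: block_setting_def ugraph_def)
    have inj: "inj_on (image \<phi>) (edges H)"
      using H(1) \<phi>(1) by (meson inj_on_image inj_on_subset Sup_least)
    show False
    proof (rule good[of "image \<phi> ` edges H"])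
      have "inj_on blk A" using A by (metis inj_onI)
      then show "image \<phi> ` edges H \<subseteq> cross blk G"
        using \<phi>(2) by (auto simp: cross_def intro: inj_on_subset)
      show "card (image \<phi> ` edges H) = r" using inj H(3) by (simp add: card_image)
      show "\<sigma> l \<in> e" if e: "e \<in> image \<phi> ` edges H" and l: "l \<in> blk ` e" for e l
      proof -
        obtain v where v: "v \<in> e" "l = blk v" using l by blast
        have "v \<in> A" using e v(1) \<phi>(2) by blast
        then show ?thesis using A v by metis
      qed
      show "e \<inter> f \<noteq> {}" if e: "e \<in> image \<phi> ` edges H" "f \<in> image \<phi> ` edges H" for e f
      proof -
        obtain e' f' where ef: "e' \<in> edges H" "f' \<in> edges H" "e = \<phi> ` e'" "f = \<phi> ` f'" using e by blast
        then obtain x where "x \<in> e'" "x \<in> f'" using H(2) unfolding intersecting_def by blast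
        then show ?thesis using ef by blast
      qed
    qed
  qed
qed

lemma ex_avoiding_transversal:
  assumes bs: "block_setting H r G P b d" and bd: "b \<ge> 4 * d / real r"
  shows "\<exists>A. transversal P A \<and> avoids G A H"
proof -
  define blk where "blk v = (THE B. B \<in> P \<and> v \<in> B)" for v
  have P: "partition_on (verts G) P" using bs by (simp add: block_setting_def)
  have bv: "blk v = B" if "B \<in> P" "v \<in> B" for v B
    unfolding blk_def using that P by (intro the_equality) (auto simp: partition_on_def disjoint_def)
  have lb: "labels_blocks blk P" using bv by (fastforce simp: labels_blocks_def)
  interpret blocks "verts G" blk "cross blk G" r by (rule blocks_of_setting[OF bs bd lb])
  obtain \<sigma> where \<sigma>: "\<sigma> \<in> states" and good: "\<nexists>C. bad_family \<sigma> C" using good_state by blast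
  have "\<sigma> l \<in> verts G \<and> blk (\<sigma> l) = l" if "l \<in> blk ` verts G" for l
    using \<sigma> that by (auto simp: states_def PiE_iff labels_def block_def)
  moreover have "False" if "C \<subseteq> cross blk G" "card C = r" "\<And>e l. e \<in> C \<Longrightarrow> l \<in> blk ` e \<Longrightarrow> \<sigma> l \<in> e"
    "\<And>e f. e \<in> C \<Longrightarrow> f \<in> C \<Longrightarrow> e \<inter> f \<noteq> {}" for C
  proof -
    have "bad_family \<sigma> C" unfolding bad_family_def using that by (intro conjI ballI) simp_all
    then show False using good by metis
  qed
  ultimately have "transversal P (\<sigma> ` blk ` verts G)" "avoids G (\<sigma> ` blk ` verts G) H"
    by (intro good_state_transversal[OF bs lb]; blast)+
  then show ?thesis by blast
qed

text \<open>
  Let \<open>{a, b}\<close> be an edge of a family that is not a star. Some edge misses \<open>a\<close>, hence is \<open>{b, c}\<close>; some edge misses \<open>b\<close>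
  and meets the other two, hence is \<open>{a, c}\<close>. Every edge that meets these three is one of them.
\<close>

lemma intersecting_star_or_triangle:
  assumes card2: "\<And>e. e \<in> C \<Longrightarrow> card e = 2" and int: "\<And>e f. e \<in> C \<Longrightarrow> f \<in> C \<Longrightarrow> e \<inter> f \<noteq> {}"
    and ne: "C \<noteq> {}"
  shows "(\<exists>u. \<forall>e\<in>C. u \<in> e) \<or> (\<exists>u p q. u \<noteq> p \<and> u \<noteq> q \<and> p \<noteq> q \<and> C = {{u, p}, {u, q}, {p, q}})"
proof (rule disjCI)
  assume notri: "\<not> (\<exists>u p q. u \<noteq> p \<and> u \<noteq> q \<and> p \<noteq> q \<and> C = {{u, p}, {u, q}, {p, q}})"
  show "\<exists>u. \<forall>e\<in>C. u \<in> e"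
  proof (rule ccontr)
    assume nostar: "\<nexists>u. \<forall>e\<in>C. u \<in> e"
    obtain a b where ab: "{a, b} \<in> C" "a \<noteq> b" using ne card2 by (metis card_2_iff ex_in_conv)
    obtain e where e: "e \<in> C" "a \<notin> e" using nostar by blast
    obtain f where f: "f \<in> C" "b \<notin> f" using nostar by blast
    have "b \<in> e" using int[OF ab(1) e(1)] e(2) by auto
    then obtain c where c: "e = {b, c}" "b \<noteq> c" using card2[OF e(1)]
      by (metis card_2_iff insert_commute insertE singletonD)
    have "a \<in> f" using int[OF ab(1) f(1)] f(2) by auto
    then have f': "f = {a, c}" using int[OF e(1) f(1)] f(2) c card2[OF f(1)] e(2)
      by (auto simp: card_2_iff)
    have ac: "a \<noteq> c" using e(2) c by auto
    have "C \<subseteq> {{a, b}, {a, c}, {b, c}}"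
    proof
      fix g assume g: "g \<in> C"
      obtain x y where xy: "g = {x, y}" "x \<noteq> y" using card2[OF g] by (auto simp: card_2_iff)
      have "a \<in> g \<or> b \<in> g" "b \<in> g \<or> c \<in> g" "a \<in> g \<or> c \<in> g"
        using int[OF g ab(1)] int[OF g e(1)] int[OF g f(1)] unfolding c(1) f' by blast+
      then show "g \<in> {{a, b}, {a, c}, {b, c}}" using ab(2) ac c(2) unfolding xy(1) by auto
    qed
    moreover have "{{a, b}, {a, c}, {b, c}} \<subseteq> C"
      using ab(1) e(1) f(1) unfolding c(1) f' by simp
    ultimately have "C = {{a, b}, {a, c}, {b, c}}" by (rule subset_antisym)
    then show False using notri ab(2) ac c(2) by blast
  qed
qed

section \<open>Expected running time as a weakest precondition\<close>

text \<open>
  Expected running time plus expected value of \<open>f\<close> in the final state. Divergence counts as infinite, so a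
  finite value certifies almost sure termination; if \<open>f\<close> is infinite on wrong results, it certifies
  correctness as well.
\<close>

definition ert :: "prog \<Rightarrow> (state \<Rightarrow> ennreal) \<Rightarrow> state \<Rightarrow> ennreal" where
  "ert c f s = (\<integral>\<^sup>+ x. (case x of None \<Rightarrow> \<top> | Some (s', t) \<Rightarrow> of_nat t + f s') \<partial>measure_pmf (run c s))"

lemma ert_mono: "(\<And>s. f s \<le> g s) \<Longrightarrow> ert c f s \<le> ert c g s"
  unfolding ert_def by (intro nn_integral_mono) (auto split: option.split intro: add_left_mono)

lemma nn_integral_pmf_add_const:
  "(\<integral>\<^sup>+ x. c + g x \<partial>measure_pmf p) = c + (\<integral>\<^sup>+ x. g x \<partial>measure_pmf p)"
  by (simp add: nn_integral_add measure_pmf.emeasure_space_1[simplified])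

lemma ert_add_const: "ert c (\<lambda>s. a + f s) s = a + ert c f s"
  unfolding ert_def nn_integral_pmf_add_const[symmetric]
  by (intro nn_integral_cong) (auto simp: algebra_simps split: option.split)

lemma ert_basic [simp]:
  "ert (Const i n) f (R, M) = 1 + f (R(i := n), M)"
  "ert (Add i j k) f (R, M) = 1 + f (R(i := R j + R k), M)"
  "ert (Sub i j k) f (R, M) = 1 + f (R(i := R j - R k), M)"
  "ert (Load i j) f (R, M) = 1 + f (R(i := M (R j)), M)"
  "ert (Store i j) f (R, M) = 1 + f (R, M(R i := R j))"
  by (simp_all add: ert_def run.simps)

lemma ert_Flip [simp]:
  "ert (Flip i) f (R, M) = 1 + (f (R(i := 0), M) + f (R(i := 1), M)) / 2"
proof -
  have "ert (Flip i) f (R, M) = (\<integral>\<^sup>+ b. 1 + f (R(i := of_bool b), M) \<partial>measure_pmf (pmf_of_set UNIV))"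
    by (simp add: ert_def run.simps bind_spmf_def spmf_of_set_def spmf_of_pmf_def)
  also have "\<dots> = (2 + (f (R(i := 0), M) + f (R(i := 1), M))) / 2"
    by (subst nn_integral_pmf_of_set) (auto simp: UNIV_bool algebra_simps simp flip: one_add_one)
  also have "\<dots> = 1 + (f (R(i := 0), M) + f (R(i := 1), M)) / 2"
    by (simp add: add_divide_distrib_ennreal)
  finally show ?thesis .
qed

lemma ert_Seq [simp]: "ert (Seq p q) f = ert p (ert q f)"
proof (rule ext)
  fix s :: state
  obtain R M where s: "s = (R, M)" by fastforce
  have "ert (Seq p q) f s = (\<integral>\<^sup>+ x. (case x of None \<Rightarrow> \<top> | Some (s', t) \<Rightarrow>
       (\<integral>\<^sup>+ y. of_nat t + (case y of None \<Rightarrow> \<top> | Some (s'', t') \<Rightarrow> of_nat t' + f s'') \<partial>measure_pmf (run q s'))) \<partial>measure_pmf (run p s))"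
    unfolding ert_def s by (subst run.simps)
      (auto simp: bind_spmf_def add.assoc intro!: nn_integral_cong split: option.split)
  also have "\<dots> = ert p (ert q f) s"
    unfolding ert_def
    by (intro nn_integral_cong) (auto simp: nn_integral_add measure_pmf.emeasure_space_1[simplified] split: option.split)
  finally show "ert (Seq p q) f s = ert p (ert q f) s" .
qed

lemma ert_If [simp]: "ert (If i p q) f (R, M) = 1 + ert (if R i \<noteq> 0 then p else q) f (R, M)"
proof -
  have "ert (If i p q) f (R, M) = (\<integral>\<^sup>+ x. 1 + (case x of None \<Rightarrow> \<top> | Some (s', t) \<Rightarrow> of_nat t + f s') \<partial>measure_pmf (run (if R i \<noteq> 0 then p else q) (R, M)))"
    unfolding ert_def by (subst run.simps)
      (auto simp: bind_spmf_def add.assoc intro!: nn_integral_cong split: option.split)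
  also have "\<dots> = 1 + ert (if R i \<noteq> 0 then p else q) f (R, M)"
    unfolding ert_def by (subst nn_integral_add) (auto simp: measure_pmf.emeasure_space_1[simplified])
  finally show ?thesis .
qed

lemma ert_While:
  "ert (While i p) f s = (if fst s i = 0 then 1 + f s else 1 + ert p (ert (While i p) f) s)"
proof -
  obtain R M where s: "s = (R, M)" by fastforce
  show ?thesis
  proof (cases "R i = 0")
    case True
    then show ?thesis by (simp add: s ert_def) (simp add: run.simps)
  next
    case False
    then have "ert (While i p) f s = (\<integral>\<^sup>+ x. 1 + (case x of None \<Rightarrow> \<top> | Some (s', t) \<Rightarrow>
       (\<integral>\<^sup>+ y. of_nat t + (case y of None \<Rightarrow> \<top> | Some (s'', t') \<Rightarrow> of_nat t' + f s'') \<partial>measure_pmf (run (While i p) s'))) \<partial>measure_pmf (run p s))"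
      unfolding ert_def s
      by (subst (1) run.simps)
        (auto simp: bind_spmf_def add.assoc nn_integral_pmf_add_const[symmetric]
            intro!: nn_integral_cong split: option.split)
    also have "\<dots> = 1 + (\<integral>\<^sup>+ x. (case x of None \<Rightarrow> \<top> | Some (s', t) \<Rightarrow> of_nat t + ert (While i p) f s') \<partial>measure_pmf (run p s))"
      unfolding nn_integral_pmf_add_const ert_def by simp
    also have "\<dots> = 1 + ert p (ert (While i p) f) s"
      by (simp add: ert_def[of p])
    finally show ?thesis using False by (simp add: s)
  qed
qed

text \<open>
  Truncate the cost of the loop at \<open>K\<close>, which gives \<open>G K\<close>. Since every unrolling costs at least one time unit, a bound
  \<open>G K \<le> \<alpha> \<Phi>\<close> with \<open>\<alpha> \<ge> 1\<close> improves to \<open>G K \<le> \<alpha> \<Phi> - (\<alpha> - 1)\<close>. Where \<open>\<Phi> < K\<close>, this shrinks \<open>\<alpha> - 1\<close> by the factor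
  \<open>1 - 1 / K\<close>; where \<open>\<Phi> \<ge> K\<close>, truncation alone gives \<open>G K \<le> \<Phi>\<close>. Iterating from the trivial bound yields \<open>G K \<le> \<Phi>\<close>.
  So finiteness of \<open>\<Phi>\<close> alone forces almost sure termination.
\<close>

lemma ert_While_le:
  assumes exit: "\<And>s. fst s i = 0 \<Longrightarrow> 1 + f s \<le> \<Phi> s"
    and step: "\<And>s. fst s i \<noteq> 0 \<Longrightarrow> 1 + ert p \<Phi> s \<le> \<Phi> s"
  shows "ert (While i p) f s \<le> \<Phi> s"
proof -
  define w where "w x = (case x of None \<Rightarrow> \<top> | Some (s', t) \<Rightarrow> of_nat t + f s')" for x :: "(state \<times> nat) option"
  define G where "G K s = (\<integral>\<^sup>+ x. min (of_nat K) (w x) \<partial>measure_pmf (run (While i p) s))" for K s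
  have \<Phi>1: "1 \<le> \<Phi> s" for s
    using exit[of s] step[of s] by (cases "fst s i = 0") (auto intro: order_trans[rotated])
  have GK: "G K s \<le> of_nat K" for K s
  proof -
    have "G K s \<le> (\<integral>\<^sup>+ x. of_nat K \<partial>measure_pmf (run (While i p) s))"
      unfolding G_def by (intro nn_integral_mono) auto
    then show ?thesis by (simp add: measure_pmf.emeasure_space_1[simplified])
  qed
  have min_add: "min k (c + z) \<le> c + min k z" for k c z :: ennreal
    by (auto simp: min_def intro: add_increasing)
  have Gstep: "G K s \<le> 1 + ert p (G K) s" if "fst s i \<noteq> 0" for K s
  proof -
    obtain R M where s: "s = (R, M)" by fastforce
    have "G K s \<le> (\<integral>\<^sup>+ x. 1 + (case x of None \<Rightarrow> \<top> | Some (s', t) \<Rightarrow>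
        (\<integral>\<^sup>+ y. of_nat t + min (of_nat K) (w y) \<partial>measure_pmf (run (While i p) s'))) \<partial>measure_pmf (run p s))"
      unfolding G_def s using that
      by (subst (1) run.simps)
        (auto simp: s bind_spmf_def nn_integral_pmf_add_const[symmetric] w_def add.assoc
           intro!: nn_integral_mono order_trans[OF min_add] add_mono split: option.split)
    also have "\<dots> = 1 + (\<integral>\<^sup>+ x. (case x of None \<Rightarrow> \<top> | Some (s', t) \<Rightarrow> of_nat t + G K s') \<partial>measure_pmf (run p s))"
      unfolding nn_integral_pmf_add_const G_def by simp
    finally show ?thesis by (simp add: ert_def)
  qed
  have Gexit: "G K s \<le> \<Phi> s" if "fst s i = 0" for K s
  proof -
    obtain R M where s: "s = (R, M)" by fastforce
    have "G K s = min (of_nat K) (1 + f s)"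
      using that by (simp add: G_def s run.simps w_def)
    then show ?thesis using exit[OF that] by (auto simp: min_def)
  qed
  have G\<Phi>: "G K s \<le> \<Phi> s" if K: "K > 0" for K s
  proof -
    (* the factor reached after n improvements of the trivial bound *)
    define \<alpha> where "\<alpha> n = 1 + real K * (1 - 1 / real K) ^ n" for n
    have \<alpha>1: "\<alpha> n \<ge> 1" for n using K by (simp add: \<alpha>_def)
    have le_scaled: "c \<le> ennreal (\<alpha> n) * c" for n c
      using mult_right_mono[of 1 "ennreal (\<alpha> n)" c] \<alpha>1[of n] by simp
    have \<alpha>Suc: "\<alpha> n - \<alpha> (Suc n) = (\<alpha> n - 1) / K" for n
      using K by (simp add: \<alpha>_def field_simps)
    have bound: "G K s \<le> ennreal (\<alpha> n) * \<Phi> s" for n s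
    proof (induction n arbitrary: s)
      case 0
      have "G K s \<le> of_nat K" by (rule GK)
      also have "\<dots> \<le> ennreal (\<alpha> 0)" by (simp add: \<alpha>_def ennreal_of_nat_eq_real_of_nat ennreal_leI)
      also have "\<dots> \<le> ennreal (\<alpha> 0) * \<Phi> s" using mult_left_mono[OF \<Phi>1[of s], of "ennreal (\<alpha> 0)"] by simp
      finally show ?case .
    next
      case (Suc n)
      have triv: "\<Phi> s \<le> ennreal (\<alpha> (Suc n)) * \<Phi> s"
        by (rule le_scaled)
      consider "fst s i = 0" | "\<Phi> s \<ge> of_nat K" | "fst s i \<noteq> 0" "\<Phi> s < of_nat K" by force
      then show ?case
      proof cases
        case 1 then show ?thesis using Gexit triv by (meson order_trans)
      next
        case 2 then show ?thesis using GK triv by (meson order_trans)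
      next
        case 3
        have "\<Phi> s \<noteq> \<top>" using 3(2) by auto
        then obtain \<phi> where \<phi>: "\<Phi> s = ennreal \<phi>" "\<phi> \<ge> 0" by (cases "\<Phi> s") auto
        have "\<phi> < K" using 3(2) \<phi> by (simp add: ennreal_of_nat_eq_real_of_nat ennreal_less_iff)
        have st: "1 + ert p \<Phi> s \<le> ennreal \<phi>" using step[OF 3(1)] \<phi> by simp
        then have "ert p \<Phi> s \<noteq> \<top>" by (auto simp: top_unique)
        then obtain e where e: "ert p \<Phi> s = ennreal e" "e \<ge> 0" by (cases "ert p \<Phi> s") auto
        have e1: "1 + e \<le> \<phi>" using st e \<phi>(2) by (simp flip: ennreal_1 ennreal_plus)
        have "G K s \<le> 1 + ert p (G K) s" by (rule Gstep[OF 3(1)])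
        also have "ert p (G K) s \<le> ert p (\<lambda>s. ennreal (\<alpha> n) * \<Phi> s) s"
          by (rule ert_mono) (rule Suc)
        also have "\<dots> \<le> (\<integral>\<^sup>+ x. ennreal (\<alpha> n) * (case x of None \<Rightarrow> \<top> | Some (s', t) \<Rightarrow> of_nat t + \<Phi> s') \<partial>measure_pmf (run p s))"
          unfolding ert_def
        proof (intro nn_integral_mono)
          fix x :: "(state \<times> nat) option"
          have "ennreal (\<alpha> n) * \<top> = \<top>" using \<alpha>1[of n] by (auto simp: ennreal_mult_top)
          then show "(case x of None \<Rightarrow> \<top> | Some (s', t) \<Rightarrow> of_nat t + ennreal (\<alpha> n) * \<Phi> s')
             \<le> ennreal (\<alpha> n) * (case x of None \<Rightarrow> \<top> | Some (s', t) \<Rightarrow> of_nat t + \<Phi> s')"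
            using le_scaled by (auto split: option.split simp: distrib_left intro: add_right_mono)
        qed
        also have "\<dots> = ennreal (\<alpha> n) * ennreal e"
          unfolding e(1)[symmetric] ert_def by (simp add: nn_integral_cmult)
        also have "1 + ennreal (\<alpha> n) * ennreal e = ennreal (1 + \<alpha> n * e)"
          using \<alpha>1[of n] e(2) by (simp add: ennreal_mult[symmetric] flip: ennreal_1 ennreal_plus)
        also have "\<dots> \<le> ennreal (\<alpha> (Suc n) * \<phi>)"
        proof (rule ennreal_leI)
          have "\<alpha> n * e \<le> \<alpha> n * (\<phi> - 1)" using e1 \<alpha>1[of n] by (intro mult_left_mono) auto
          moreover have "(\<alpha> n - \<alpha> (Suc n)) * \<phi> \<le> (\<alpha> n - \<alpha> (Suc n)) * K"
            unfolding \<alpha>Suc using \<alpha>1[of n] \<open>\<phi> < K\<close> by (intro mult_left_mono) auto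
          moreover have "(\<alpha> n - \<alpha> (Suc n)) * K = \<alpha> n - 1" unfolding \<alpha>Suc using K by simp
          ultimately show "1 + \<alpha> n * e \<le> \<alpha> (Suc n) * \<phi>" by (simp add: algebra_simps)
        qed
        also have "\<dots> = ennreal (\<alpha> (Suc n)) * \<Phi> s"
          using \<alpha>1[of "Suc n"] \<phi> by (simp add: ennreal_mult)
        finally show ?thesis by (simp add: add_left_mono)
      qed
    qed
    show ?thesis
    proof (cases "\<Phi> s")
      case (real \<phi>)
      have "(\<lambda>n. \<alpha> n * \<phi>) \<longlonglongrightarrow> (1 + real K * 0) * \<phi>"
        unfolding \<alpha>_def using K by (intro tendsto_intros LIMSEQ_power_zero) auto
      then have lim: "(\<lambda>n. ennreal (\<alpha> n * \<phi>)) \<longlonglongrightarrow> ennreal \<phi>" by (intro tendsto_ennrealI) simp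
      have "G K s \<le> ennreal (\<alpha> n * \<phi>)" for n
        using bound[of s n] \<alpha>1[of n] real by (simp add: ennreal_mult)
      then show ?thesis using LIMSEQ_le_const[OF lim, of "G K s"] real by auto
    qed simp
  qed
  have "ert (While i p) f s = (\<integral>\<^sup>+ x. (SUP K. min (of_nat K) (w x)) \<partial>measure_pmf (run (While i p) s))"
  proof -
    have "(SUP K. min (of_nat K) y) = y" for y :: ennreal
    proof -
      have "(SUP K. inf (of_nat K) y) = inf (SUP K. of_nat K) y"
        by (rule SUP_inf[symmetric])
      then show ?thesis by (simp add: ennreal_SUP_of_nat_eq_top inf_min)
    qed
    then show ?thesis by (simp add: ert_def w_def)
  qed
  also have "\<dots> = (SUP K. G K s)"
    unfolding G_def by (intro nn_integral_monotone_convergence_SUP)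
      (auto simp: incseq_def le_fun_def intro!: min.coboundedI1)
  also have "\<dots> \<le> \<Phi> s"
  proof (rule SUP_least)
    fix K show "G K s \<le> \<Phi> s"
      using G\<Phi>[of K s] GK[of 0 s] by (cases "K = 0") auto
  qed
  finally show ?thesis .
qed

section \<open>The program\<close>

notation Seq (infixr ";;" 60)

text \<open>
  Registers 1 to 8 hold the number \<open>n\<close> of vertices, the address \<open>AL\<close> of the block labels, the address \<open>AG\<close>
  of the adjacency matrix of \<open>G\<close>, the number \<open>2 r\<close>, the address \<open>SB\<close> of the chosen vertices (indexed by
  block label), the address \<open>ZB\<close> of an array of marks, and the constants 1 and 0. Register 10 is the
  vertex \<open>u\<close> being scanned; 11 and 12 are its last two chosen neighbours, 13 is the address of the
  matrix row of the vertex in register 12, and 14 counts the chosen neighbours. Registers 15 and 16 are the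
  ends of the edge to be resampled, 17 is zero if a repair is due, 18 is the guard of the outer loops.
  Register 20 is the sampled vertex and 25 a block label. Assigning to register 19 stands for doing nothing;
  the registers not mentioned are temporary.
\<close>

text \<open>
  Register 22 is the number of equally likely values of register 20.
\<close>

definition draw where
  "draw = Const 20 0 ;; Const 22 1 ;; Sub 23 1 22 ;;
     While 23 (Flip 24 ;; Add 20 20 20 ;; Add 20 20 24 ;; Add 22 22 22 ;; Sub 23 1 22)"

text \<open>
  Rejection sampling of a marked vertex. Numbers from \<open>n\<close> on are rejected too, because the memory behind the marks
  is zero.
\<close>

definition sample where
  "sample = Const 21 1 ;; While 21 (draw ;; Add 24 6 20 ;; Load 24 24 ;; Sub 21 7 24)"

definition "mark = Const 26 0 ;; Sub 27 1 26 ;; While 27 (Add 28 2 26 ;; Load 28 28 ;; Sub 29 28 25 ;; Sub 28 25 28 ;;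
   Add 28 28 29 ;; Sub 28 7 28 ;; Add 29 6 26 ;; Store 29 28 ;; Add 26 26 7 ;; Sub 27 1 26)"

definition "resample j = Add 25 2 j ;; Load 25 25 ;; mark ;; sample ;; Add 25 5 25 ;; Store 25 20"

text \<open>
  With truncated subtraction, \<open>1 - ((x - y) + (y - x))\<close> is the truth value of \<open>x = y\<close>.
\<close>

definition "test_selected d s = Add d 2 s ;; Load d d ;; Add d 5 d ;; Load d d ;; Sub (d+1) d s ;; Sub d s d ;; Add d d (d+1) ;; Sub d 7 d"

text \<open>
  Adding the truth values of the three conditions for a chosen neighbour and subtracting 2 forms their conjunction.
  The matrix is read along the column of \<open>u\<close>, which by symmetry equals the row, so that register 31 is
  the row address of the current neighbour.
\<close>

definition "scan_body = Add 35 31 10 ;; Load 35 35 ;; Add 35 35 34 ;; test_selected 36 30 ;; Add 35 35 36 ;; Const 36 2 ;; Sub 35 35 36 ;;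
  Add 36 6 30 ;; Store 36 35 ;; If 35 (Add 11 12 8 ;; Add 12 30 8 ;; Add 13 31 8 ;; Add 14 14 7) (Const 19 0) ;;
  Add 30 30 7 ;; Add 31 31 1 ;; Sub 33 1 30"

definition "scan = Const 11 0 ;; Const 12 0 ;; Const 13 0 ;; Const 14 0 ;; Const 30 0 ;; Add 31 3 8 ;; test_selected 34 10 ;; Sub 33 1 30 ;;
  While 33 scan_body"

text \<open>
  Register 17 vanishes if \<open>u\<close> has at least \<open>r\<close> chosen neighbours. Register 35 vanishes if \<open>r = 3\<close> and \<open>u\<close> has exactly two; only
  then do registers 13 and 11 add up to the address of the matrix entry of these two. If they are
  adjacent, \<open>u\<close> is marked as well, to represent the edge opposite to \<open>u\<close> in the triangle.
\<close>

definition "judge = Add 17 14 14 ;; Sub 17 4 17 ;; Const 35 6 ;; Sub 36 35 4 ;; Sub 35 4 35 ;; Add 35 35 36 ;;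
  Const 36 2 ;; Sub 37 36 14 ;; Sub 36 14 36 ;; Add 35 35 36 ;; Add 35 35 37 ;;
  If 35 (Const 19 0) (Add 36 13 11 ;; Load 36 36 ;; If 36 (Add 35 6 10 ;; Store 35 7 ;; Const 17 0) (Const 19 0))"

text \<open>
  A marked vertex \<open>x\<close> stands for the edge from \<open>u\<close> to \<open>x\<close>, or, if \<open>x = u\<close>, for the edge between the two
  chosen neighbours of \<open>u\<close>. Afterwards the scan starts again.
\<close>

definition "repair = sample ;; Sub 35 20 10 ;; Sub 36 10 20 ;; Add 35 35 36 ;;
  If 35 (Add 15 10 8 ;; Add 16 20 8) (Add 15 11 8 ;; Add 16 12 8) ;; resample 15 ;; resample 16 ;; Const 10 0"

definition "main_body = scan ;; judge ;; If 17 (Add 10 10 7) repair ;; Sub 18 1 10"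

definition "search = Const 10 0 ;; Sub 18 1 10 ;; While 18 main_body"

text \<open>
  A block is sampled once for each of its vertices, which does not affect the distribution of the result.
\<close>

definition "fill = Const 10 0 ;; Sub 18 1 10 ;; While 18 (resample 10 ;; Add 10 10 7 ;; Sub 18 1 10)"

text \<open>
  The output overwrites the input from address 0 on. It never reaches the labels, which start behind
  an \<open>n\<close> by \<open>n\<close> matrix.
\<close>

definition "emit = Const 10 0 ;; Const 0 0 ;; Sub 18 1 10 ;; While 18 (Add 28 2 10 ;; Load 28 28 ;; Sub 29 10 28 ;; Sub 28 28 10 ;; Add 29 29 28 ;;
   If 29 (Const 19 0) (Add 28 5 10 ;; Load 28 28 ;; Store 0 28 ;; Add 0 0 7) ;; Add 10 10 7 ;; Sub 18 1 10)"

text \<open>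
  The labels occupy the last \<open>n\<close> cells of the input. Subtracting \<open>n\<close> from their address \<open>n\<close> times gives the address of the matrix
  of \<open>G\<close>. The entries of the matrix of \<open>H\<close> add up to \<open>2 r\<close>.
\<close>

definition "prepare = Const 7 1 ;; Load 1 7 ;; Sub 2 0 1 ;; Add 5 0 8 ;; Add 6 0 1 ;; Add 3 2 8 ;; Add 26 1 8 ;;
  While 26 (Sub 3 3 1 ;; Sub 26 26 7) ;; Const 4 0 ;; Const 26 2 ;; Sub 27 3 26 ;;
  While 27 (Load 28 26 ;; Add 4 4 28 ;; Add 26 26 7 ;; Sub 27 3 26)"

definition "solve = prepare ;; fill ;; search ;; emit"

section \<open>Counting loops and uniform sampling\<close>

lemma ert_for:
  assumes body: "\<And>k s. k < N \<Longrightarrow> J k s \<Longrightarrow> fst s i \<noteq> 0 \<and>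
      ert p (\<lambda>s'. if J (Suc k) s' then F (Suc k) s' else \<top>) s \<le> of_nat T + F k s"
    and exit: "\<And>s. J N s \<Longrightarrow> fst s i = 0 \<and> f s \<le> F N s"
    and init: "J k s" "k \<le> N"
  shows "ert (While i p) f s \<le> of_nat ((N - k) * (T + 1) + 1) + F k s"
  using init
proof (induction "N - k" arbitrary: k s)
  case 0
  then have "k = N" by simp
  then show ?case using exit[of s] 0 by (subst ert_While) (auto intro: add_left_mono)
next
  case (Suc m)
  then have k: "k < N" "N - Suc k = m" by auto
  have "ert (While i p) f s = 1 + ert p (ert (While i p) f) s"
    using body[OF k(1) Suc.prems(1)] by (subst ert_While) simp
  also have "ert p (ert (While i p) f) s \<le>
      ert p (\<lambda>s'. of_nat (m * (T + 1) + 1) + (if J (Suc k) s' then F (Suc k) s' else \<top>)) s"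
  proof (rule ert_mono)
    fix s' show "ert (While i p) f s' \<le> of_nat (m * (T + 1) + 1) + (if J (Suc k) s' then F (Suc k) s' else \<top>)"
      using Suc(1)[of "Suc k" s'] k by auto
  qed
  also have "\<dots> = of_nat (m * (T + 1) + 1) + ert p (\<lambda>s'. if J (Suc k) s' then F (Suc k) s' else \<top>) s"
    by (rule ert_add_const)
  also have "\<dots> \<le> of_nat (m * (T + 1) + 1) + (of_nat T + F k s)"
    using body[OF k(1) Suc.prems(1)] by (intro add_left_mono) auto
  finally show ?case using Suc(2)[symmetric] by (simp add: algebra_simps add_left_mono)
qed

definition avg :: "'x set \<Rightarrow> ('x \<Rightarrow> ennreal) \<Rightarrow> ennreal" where
  "avg A g = sum g A / of_nat (card A)"

lemma avg_add_const:
  assumes "finite A" "A \<noteq> {}" shows "avg A (\<lambda>x. c + g x) = c + avg A g"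
proof -
  have "of_nat (card A) * c / of_nat (card A) = c"
    using assms by (metis card_0_eq ennreal_mult_divide_eq mult.commute of_nat_eq_0_iff of_nat_less_top order_less_irrefl)
  then show ?thesis by (simp add: avg_def sum.distrib add_divide_distrib_ennreal)
qed

lemma half_add: "(a + b) / 2 + T = ((a + T) + (b + T)) / (2::ennreal)"
proof -
  have "((a + T) + (b + T)) / 2 = ((a + b) + T * 2) / 2" by (simp add: algebra_simps mult_2_right)
  also have "\<dots> = (a + b) / 2 + T"
    by (subst add_divide_distrib_ennreal) (simp add: ennreal_mult_divide_eq)
  finally show ?thesis by simp
qed

definition bits :: "nat \<Rightarrow> nat" where "bits n = (LEAST k. n \<le> 2 ^ k)"

lemma bits: "n \<le> 2 ^ bits n" "k < bits n \<Longrightarrow> 2 ^ k < n" "bits n \<le> n" "n > 0 \<Longrightarrow> 2 ^ bits n \<le> 2 * n"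
proof -
  have n: "n \<le> 2 ^ n" by (simp add: less_imp_le)
  show 1: "n \<le> 2 ^ bits n" unfolding bits_def by (rule LeastI[of "\<lambda>k. n \<le> 2 ^ k", OF n])
  show 2: "k < bits n \<Longrightarrow> 2 ^ k < n" for k using not_less_Least[of k "\<lambda>k. n \<le> 2 ^ k"] by (simp add: bits_def)
  show "bits n \<le> n" unfolding bits_def by (rule Least_le[of "\<lambda>k. n \<le> 2 ^ k", OF n])
  show "2 ^ bits n \<le> 2 * n" if "n > 0"
    using 2[of "bits n - 1"] that by (cases "bits n") auto
qed

lemma ert_draw:
  assumes R: "R 1 = n"
    and f: "\<And>x R'. x < 2 ^ bits n \<Longrightarrow> (\<And>i. i \<notin> {20..24} \<Longrightarrow> R' i = R i) \<Longrightarrow> R' 20 = x \<Longrightarrow> f (R', M) \<le> g x"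
  shows "ert draw f (R, M) \<le> of_nat (6 * bits n + 4) + avg {..<2 ^ bits n} g"
proof -
  define k where "k = bits n"
  define p where "p = Flip 24 ;; Add 20 20 20 ;; Add 20 20 24 ;; Add 22 22 22 ;; Sub 23 1 22"
  have loop: "ert (While 23 p) f (R', M) \<le> of_nat (6 * j + 1) + (\<Sum>y<2^j. g (x * 2 ^ j + y)) / 2 ^ j"
    if "j \<le> k" "\<And>i. i \<notin> {20..24} \<Longrightarrow> R' i = R i" "R' 20 = x" "R' 22 = 2 ^ (k - j)" "R' 23 = n - 2 ^ (k - j)" "(x + 1) * 2 ^ j \<le> 2 ^ k" for j R' x
    using that
  proof (induction j arbitrary: R' x)
    case 0
    have "n \<le> 2 ^ k" using bits(1) by (simp add: k_def)
    then show ?case using 0 f[of x R'] by (subst ert_While) (auto simp: k_def divide_ennreal_def intro: add_left_mono)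
  next
    case (Suc j)
    have nz: "R' 23 \<noteq> 0" using Suc.prems bits(2)[of "k - Suc j" n] by (simp add: k_def)
    define S where "S b = (\<Sum>y<2^j. g ((2 * x + b) * 2 ^ j + y)) / 2 ^ j" for b
    define R1 where "R1 b = R'(24 := b, 20 := 2 * x + b, 22 := 2 ^ (k - j), 23 := n - 2 ^ (k - j))" for b
    have kj: "2 ^ (k - Suc j) + 2 ^ (k - Suc j) = (2::nat) ^ (k - j)"
      using Suc.prems(1) by (simp flip: power_Suc mult_2 add: Suc_diff_Suc)
    have bnd: "(2 * x + b + 1) * 2 ^ j \<le> 2 ^ k" if "b \<le> 1" for b
    proof -
      have "(2 * x + b + 1) * 2 ^ j \<le> (2 * x + 2) * 2 ^ j" using that by (intro mult_right_mono) auto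
      also have "\<dots> = (x + 1) * 2 ^ Suc j" by simp
      finally show ?thesis using Suc.prems(6) by linarith
    qed
    have IH: "ert (While 23 p) f (R1 b, M) \<le> of_nat (6 * j + 1) + S b" if "b \<le> 1" for b
      unfolding S_def using Suc.prems bnd[OF that] by (intro Suc.IH) (auto simp: R1_def)
    have inv: "inverse (2 * 2 ^ j) = inverse 2 * inverse (2 ^ j :: ennreal)"
      by (rule ennreal_inverse_mult) (auto simp: power_less_top_ennreal)
    have halves: "(S 0 + S 1) / 2 = (\<Sum>y<2^Suc j. g (x * 2 ^ Suc j + y)) / 2 ^ Suc j"
    proof -
      have "(\<Sum>y<2^Suc j. g (x * 2 ^ Suc j + y)) = (\<Sum>y<2^j. g (x * 2 ^ Suc j + y)) + (\<Sum>y\<in>{2^j..<2^j+2^j}. g (x * 2 ^ Suc j + y))"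
        by (subst sum.atLeastLessThan_concat[symmetric, of 0 "2^j", simplified atLeast0LessThan]) (auto simp: mult_2 atLeast0LessThan)
      also have "(\<Sum>y\<in>{2^j..<2^j+2^j}. g (x * 2 ^ Suc j + y)) = (\<Sum>y<2^j. g ((2 * x + 1) * 2 ^ j + y))"
        using sum.shift_bounds_nat_ivl[of "\<lambda>y. g (x * 2 ^ Suc j + y)" 0 "2^j" "2^j"] by (simp add: atLeast0LessThan algebra_simps)
      finally show ?thesis
        by (simp add: S_def divide_ennreal_def inv algebra_simps)
    qed
    have body: "ert p F (R', M) = 1 + ((4 + F (R1 0, M)) + (4 + F (R1 1, M))) / 2" for F
      using Suc.prems kj assms(1) by (simp add: p_def R1_def mult_2 add.assoc[symmetric])
    have "ert (While 23 p) f (R', M) = 1 + (1 + ((4 + ert (While 23 p) f (R1 0, M)) + (4 + ert (While 23 p) f (R1 1, M))) / 2)"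
      using nz by (subst ert_While) (simp add: body)
    also have "\<dots> \<le> 1 + (1 + ((4 + (of_nat (6 * j + 1) + S 0)) + (4 + (of_nat (6 * j + 1) + S 1))) / 2)"
      using IH[of 0] IH[of 1] by (intro add_left_mono divide_right_mono_ennreal add_mono) auto
    also have "\<dots> = 1 + (1 + ((S 0 + S 1) / 2 + of_nat (6 * j + 5)))"
    proof -
      have "4 + (of_nat (6 * j + 1) + a) = a + of_nat (6 * j + 5)" for a :: ennreal
        by (simp add: algebra_simps)
      then show ?thesis by (simp only: half_add)
    qed
    also have "\<dots> = of_nat (6 * Suc j + 1) + (S 0 + S 1) / 2"
    proof -
      have "of_nat (6 * Suc j + 1) = (1 + (1 + of_nat (6 * j + 5)) :: ennreal)"
        by (simp flip: of_nat_Suc)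
      then show ?thesis by (simp only: ac_simps)
    qed
    finally show ?case unfolding halves .
  qed
  have "ert draw f (R, M) = 3 + ert (While 23 p) f (R(20 := 0, 22 := 1, 23 := n - 1), M)"
    using R by (simp add: draw_def p_def algebra_simps)
  also have "\<dots> \<le> 3 + (of_nat (6 * k + 1) + (\<Sum>y<2^k. g (0 * 2 ^ k + y)) / 2 ^ k)"
    using R by (intro add_left_mono loop) auto
  also have "\<dots> = of_nat (6 * k + 4) + (\<Sum>y<2^k. g (0 * 2 ^ k + y)) / 2 ^ k"
  proof -
    have "of_nat (6 * k + 4) = (of_nat 3 + of_nat (6 * k + 1) :: ennreal)"
      by (simp only: of_nat_add[symmetric]) simp
    then show ?thesis by (simp only: ac_simps of_nat_numeral)
  qed
  finally show ?thesis by (simp add: k_def avg_def)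
qed

text \<open>
  A round costs \<open>t + c\<close> and succeeds with probability at least \<open>1 / W\<close>; \<open>K\<close> is the allowance for all rounds to come.
\<close>

lemma rejection_step:
  fixes g :: "nat \<Rightarrow> ennreal"
  assumes Z: "Z \<subseteq> {..<W}" "Z \<noteq> {}" and K: "K = 1 + W * (t + c)"
  shows "of_nat c + avg {..<W} (\<lambda>x. of_nat t + (if x \<in> Z then 1 + g x else of_nat K + avg Z g)) \<le> of_nat K + avg Z g"
proof (cases "avg Z g")
  case (real A)
  have finZ: "finite Z" using Z(1) finite_subset by blast
  define z where "z = card Z"
  have z: "z > 0" "z \<le> W" using finZ Z card_mono[OF _ Z(1)] by (auto simp: z_def card_gt_0_iff)
  have "sum g Z \<noteq> \<top>"
  proof (rule notI)
    assume "sum g Z = \<top>"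
    then have "avg Z g = \<top>" using z by (simp add: avg_def ennreal_top_divide of_nat_less_top flip: z_def)
    then show False using real by simp
  qed
  then obtain S where S: "sum g Z = ennreal S" "S \<ge> 0" by (cases "sum g Z") auto
  have A: "A = S / z" using real S z by (simp add: avg_def ennreal_of_nat_eq_real_of_nat divide_ennreal flip: z_def)
  have "(\<Sum>x<W. of_nat t + (if x \<in> Z then 1 + g x else of_nat K + avg Z g)) =
     (\<Sum>x\<in>Z. of_nat t + (1 + g x)) + (\<Sum>x\<in>{..<W} - Z. of_nat t + (of_nat K + avg Z g))"
    using Z(1) by (subst sum.subset_diff[of Z]) (auto simp: add.commute intro!: arg_cong2[where f="(+)"] sum.cong)
  also have "\<dots> = ennreal (real z * (t + 1) + S + (real W - z) * (t + K + A))"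
  proof -
    have "(\<Sum>x\<in>Z. of_nat t + (1 + g x)) = of_nat (z * (t + 1)) + ennreal S"
      by (simp add: sum.distrib S(1) z_def algebra_simps)
    moreover have "(\<Sum>x\<in>{..<W} - Z. of_nat t + (of_nat K + avg Z g)) = of_nat (W - z) * (of_nat (t + K) + ennreal A)"
      using finZ Z(1) by (simp add: card_Diff_subset real z_def algebra_simps)
    moreover have "\<dots> = ennreal ((real W - z) * (t + K + A))"
      using z real by (simp add: ennreal_of_nat_eq_real_of_nat of_nat_diff flip: ennreal_plus ennreal_mult)
    ultimately show ?thesis
      using z S(2) real by (simp add: ennreal_of_nat_eq_real_of_nat add.assoc distrib_left flip: ennreal_plus)
  qed
  finally have "of_nat c + avg {..<W} (\<lambda>x. of_nat t + (if x \<in> Z then 1 + g x else of_nat K + avg Z g))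
     = ennreal (c + (real z * (t + 1) + S + (real W - z) * (t + K + A)) / W)"
    using z S(2) real by (simp add: avg_def ennreal_of_nat_eq_real_of_nat divide_ennreal flip: ennreal_plus)
  also have "\<dots> \<le> ennreal (K + A)"
  proof (rule ennreal_leI)
    have "real z * (t + 1) + S + (real W - z) * (t + K + A) = z + z * A + t * W + (real W - z) * K + (real W - z) * A"
      using A z by (simp add: algebra_simps)
    also have "\<dots> = W * A + t * W + W * K - z * (real K - 1)" by (simp add: algebra_simps)
    also have "\<dots> \<le> W * A + t * W + W * K - 1 * (real K - 1)"
      using z K by (intro diff_left_mono mult_right_mono) auto
    also have "\<dots> = W * (A + K - c)" by (simp add: K algebra_simps)
    finally show "c + (real z * (t + 1) + S + (real W - z) * (t + K + A)) / W \<le> K + A"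
      using z by (simp add: field_simps)
  qed
  also have "\<dots> = of_nat K + avg Z g" using real by (simp add: ennreal_of_nat_eq_real_of_nat)
  finally show ?thesis .
qed simp

definition sample_cost where "sample_cost n = 2 + 2 ^ bits n * (6 * bits n + 8)"

lemma ert_sample:
  assumes R: "R 1 = n" "R 6 = b" "R 7 = 1"
    and M: "\<And>x. x < n \<Longrightarrow> M (b + x) \<le> 1" "\<And>a. a \<ge> b + n \<Longrightarrow> M a = 0"
    and Z: "Z = {x. x < n \<and> M (b + x) \<noteq> 0}" "Z \<noteq> {}"
    and f: "\<And>x R'. x \<in> Z \<Longrightarrow> (\<And>i. i \<notin> {20..24} \<Longrightarrow> R' i = R i) \<Longrightarrow> R' 20 = x \<Longrightarrow> f (R', M) \<le> g x"
  shows "ert sample f (R, M) \<le> of_nat (sample_cost n) + avg Z g"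
proof -
  define k where "k = bits n"
  define K where "K = 1 + 2 ^ k * (3 + (6 * k + 5))"
  define p where "p = draw ;; Add 24 6 20 ;; Load 24 24 ;; Sub 21 7 24"
  define \<Phi> :: "state \<Rightarrow> ennreal" where "\<Phi> s = (if snd s = M \<and> (\<forall>i. i \<notin> {20..24} \<longrightarrow> fst s i = R i) then
      (if fst s 21 = 0 then (if fst s 20 \<in> Z then 1 + g (fst s 20) else \<top>) else of_nat K + avg Z g) else \<top>)" for s
  have "ert (While 21 p) f (R(21 := 1), M) \<le> \<Phi> (R(21 := 1), M)"
  proof (rule ert_While_le)
    fix s :: state assume s: "fst s 21 = 0"
    show "1 + f s \<le> \<Phi> s"
    proof (cases "\<Phi> s = \<top>")
      case False
      obtain R' M' where RM: "s = (R', M')" by fastforce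
      show ?thesis using False s f[of "R' 20" R'] by (auto simp: \<Phi>_def RM split: if_splits intro: add_left_mono)
    qed simp
  next
    fix s :: state assume s: "fst s 21 \<noteq> 0"
    show "1 + ert p \<Phi> s \<le> \<Phi> s"
    proof (cases "snd s = M \<and> (\<forall>i. i \<notin> {20..24} \<longrightarrow> fst s i = R i)")
      case True
      define R' where "R' = fst s"
      have RM: "s = (R', M)" using True by (auto simp: R'_def)
      have R': "R' i = R i" if "i \<notin> {20..24}" for i using True that by (simp add: R'_def)
      have "ert p \<Phi> s \<le> of_nat (6 * k + 4) + avg {..<2 ^ k} (\<lambda>x. of_nat 3 + (if x \<in> Z then 1 + g x else of_nat K + avg Z g))"
        unfolding p_def ert_Seq RM k_def
      proof (rule ert_draw)
        show "R' 1 = n" using R R' by simp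
        fix x R'' assume a: "\<And>i. i \<notin> {20..24} \<Longrightarrow> R'' i = R' i" "R'' 20 = x"
        have R'': "R'' i = R i" if "i \<notin> {20..24}" for i using a R' that by simp
        have M0: "M (b + x) = of_bool (x \<in> Z)"
          using M(1)[of x] M(2)[of "b + x"] Z(1) by (cases "x < n") (auto simp: le_Suc_eq)
        show "ert (Add 24 6 20) (ert (Load 24 24) (ert (Sub 21 7 24) \<Phi>)) (R'', M)
           \<le> of_nat 3 + (if x \<in> Z then 1 + g x else of_nat K + avg Z g)"
          using R'' R a(2) M0 by (auto simp: \<Phi>_def add.assoc[symmetric])
      qed
      then have "1 + ert p \<Phi> s \<le> 1 + (of_nat (6 * k + 4) + avg {..<2 ^ k} (\<lambda>x. of_nat 3 + (if x \<in> Z then 1 + g x else of_nat K + avg Z g)))"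
        by (rule add_left_mono)
      also have "\<dots> = of_nat (Suc (6 * k + 4)) + avg {..<2 ^ k} (\<lambda>x. of_nat 3 + (if x \<in> Z then 1 + g x else of_nat K + avg Z g))"
        by (simp only: of_nat_Suc add.assoc)
      also have "\<dots> \<le> of_nat K + avg Z g"
        using Z bits(1)[of n] by (intro rejection_step) (auto simp: K_def k_def)
      also have "\<dots> = \<Phi> s" using True s by (simp add: \<Phi>_def)
      finally show ?thesis .
    qed (auto simp: \<Phi>_def)
  qed
  also have "\<Phi> (R(21 := 1), M) = of_nat K + avg Z g" by (simp add: \<Phi>_def)
  finally have "1 + ert (While 21 p) f (R(21 := 1), M) \<le> 1 + (of_nat K + avg Z g)" by (rule add_left_mono)
  also have "\<dots> = of_nat (1 + K) + avg Z g" by (simp only: of_nat_add of_nat_1 add.assoc)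
  also have "1 + K = sample_cost n" by (simp add: K_def sample_cost_def k_def)
  finally show ?thesis by (simp only: sample_def p_def ert_Seq ert_basic)
qed

section \<open>Resampling one block\<close>

text \<open>
  The memory map: matrix of \<open>G\<close> from \<open>AG\<close> on, then the block labels, the chosen vertices and the marks.
\<close>

locale layout =
  fixes n AG r :: nat and adj :: "nat \<Rightarrow> nat \<Rightarrow> bool" and lab :: "nat \<Rightarrow> nat"
  assumes lab_lt: "v < n \<Longrightarrow> lab v < n" and lab_idem: "v < n \<Longrightarrow> lab (lab v) = lab v"
begin

definition "AL = AG + n * n"
definition "SB = AL + n"
definition "ZB = SB + n"

definition registers_ok :: "(nat \<Rightarrow> nat) \<Rightarrow> bool" where
  "registers_ok R \<longleftrightarrow> R 1 = n \<and> R 2 = AL \<and> R 3 = AG \<and> R 4 = 2 * r \<and> R 5 = SB \<and> R 6 = ZB \<and> R 7 = 1 \<and> R 8 = 0"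
definition memory_ok :: "(nat \<Rightarrow> nat) \<Rightarrow> bool" where
  "memory_ok M \<longleftrightarrow> (\<forall>v<n. M (AL + v) = lab v) \<and> (\<forall>u<n. \<forall>v<n. M (AG + v * n + u) = of_bool (adj v u)) \<and> (\<forall>a\<ge>ZB + n. M a = 0)"

lemma registers_okD: assumes "registers_ok R" shows "R 1 = n" "R (Suc 0) = n" "R 2 = AL" "R 3 = AG" "R 4 = 2 * r" "R 5 = SB" "R 6 = ZB" "R 7 = 1" "R 8 = 0"
  using assms by (auto simp: registers_ok_def)
lemma registers_ok_cong: "registers_ok R \<Longrightarrow> (\<And>i. i < 10 \<Longrightarrow> R' i = R i) \<Longrightarrow> registers_ok R'"
  by (simp add: registers_ok_def)
lemma memory_okD: assumes "memory_ok M" shows "v < n \<Longrightarrow> M (AL + v) = lab v" "u < n \<Longrightarrow> v < n \<Longrightarrow> M (AG + v * n + u) = of_bool (adj v u)"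
    "a \<ge> ZB + n \<Longrightarrow> M a = 0"
  using assms by (auto simp: memory_ok_def)

lemma adj_addr: "v < n \<Longrightarrow> u < n \<Longrightarrow> AG + v * n + u < AL"
proof -
  assume "v < n" "u < n"
  then have "v * n + u < Suc v * n" by simp
  also have "\<dots> \<le> n * n" using \<open>v < n\<close> by (intro mult_right_mono) auto
  finally show ?thesis by (simp add: AL_def)
qed

text \<open>
  The chosen vertices and the marks occupy the addresses from \<open>SB\<close> to below \<open>ZB + n\<close>, and may be overwritten.
\<close>

lemma memory_ok_cong: "memory_ok M \<Longrightarrow> (\<And>a. a < SB \<or> a \<ge> ZB + n \<Longrightarrow> M' a = M a) \<Longrightarrow> memory_ok M'"
proof -
  assume M: "memory_ok M" and eq: "\<And>a. a < SB \<or> a \<ge> ZB + n \<Longrightarrow> M' a = M a"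
  have "M' (AG + v * n + u) = M (AG + v * n + u)" if "u < n" "v < n" for u v
    using adj_addr[OF that(2,1)] by (intro eq) (simp add: SB_def)
  then show ?thesis using M eq by (auto simp: memory_ok_def SB_def)
qed

lemma eq_test: "Suc 0 - ((a - b) + (b - a)) = of_bool (a = b)" for a b :: nat by auto

lemma ert_mark:
  assumes R: "registers_ok R" and M: "memory_ok M" and l: "R 25 = l"
    and f: "\<And>R' M'. (\<And>i. i \<notin> {26..29} \<Longrightarrow> R' i = R i) \<Longrightarrow>
        M' = (\<lambda>a. if ZB \<le> a \<and> a < ZB + n then of_bool (lab (a - ZB) = l) else M a) \<Longrightarrow> f (R', M') \<le> X"
  shows "ert mark f (R, M) \<le> of_nat (11 * n + 3) + X"
proof -
  define J where "J v s \<longleftrightarrow> (\<forall>i. i \<notin> {26..29} \<longrightarrow> fst s i = R i) \<and> fst s 26 = v \<and> fst s 27 = n - v \<and>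
      snd s = (\<lambda>a. if ZB \<le> a \<and> a < ZB + v then of_bool (lab (a - ZB) = l) else M a)" for v and s :: state
  define p where "p = Add 28 2 26 ;; Load 28 28 ;; Sub 29 28 25 ;; Sub 28 25 28 ;;
   Add 28 28 29 ;; Sub 28 7 28 ;; Add 29 6 26 ;; Store 29 28 ;; Add 26 26 7 ;; Sub 27 1 26"
  have loop: "ert (While 27 p) f (R(26 := 0, 27 := n), M) \<le> of_nat ((n - 0) * (10 + 1) + 1) + X"
  proof (rule ert_for[where J = J and F = "\<lambda>_ _. X" and N = n and k = 0])
    fix v s assume v: "v < n" and Js: "J v s"
    obtain R' M' where s: "s = (R', M')" by fastforce
    have R': "R' i = R i" if "i \<notin> {26..29}" for i using Js that by (simp add: J_def s)
    have c: "R' 26 = v" "R' 27 = n - v" "R' 2 = AL" "R' 25 = l" "R' 7 = 1" "R' 6 = ZB" "R' (Suc 0) = n"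
      using Js R l R' by (auto simp: J_def s registers_okD)
    have M': "M' (AL + v) = lab v"
      using Js memory_okD(1)[OF M v] v by (simp add: J_def s ZB_def SB_def)
    let ?s = "(R'(28 := of_bool (l = lab v), 29 := ZB + v, 26 := Suc v, 27 := n - Suc v), M'(ZB + v := of_bool (l = lab v)))"
    have J': "J (Suc v) ?s"
      using Js R' by (auto simp: J_def s fun_eq_iff less_Suc_eq)
    have "ert p F s = 10 + F ?s" for F
      using c M' by (simp add: p_def s eq_test add.assoc[symmetric] fun_upd_twist[of 29 28])
    then show "fst s 27 \<noteq> 0 \<and> ert p (\<lambda>s'. if J (Suc v) s' then X else \<top>) s \<le> of_nat 10 + X"
      using J' c v by (simp add: s)
  next
    fix s assume Js: "J n s"
    obtain R' M' where s: "s = (R', M')" by fastforce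
    show "fst s 27 = 0 \<and> f s \<le> X" using Js f[of R' M'] by (auto simp: J_def s)
  qed (auto simp: J_def)
  have "ert mark f (R, M) = 2 + ert (While 27 p) f (R(26 := 0, 27 := n), M)"
    using R by (simp add: mark_def p_def registers_okD add.assoc[symmetric])
  also have "\<dots> \<le> 2 + (of_nat ((n - 0) * (10 + 1) + 1) + X)" by (rule add_left_mono[OF loop])
  also have "\<dots> = of_nat (2 + ((n - 0) * (10 + 1) + 1)) + X" by (simp only: of_nat_add of_nat_numeral add.assoc)
  also have "2 + ((n - 0) * (10 + 1) + 1) = 11 * n + 3" by simp
  finally show ?thesis .
qed

definition "block_of v = {x. x < n \<and> lab x = lab v}"

definition "resample_cost = 11 * n + 7 + sample_cost n"

lemma ert_resample:
  assumes R: "registers_ok R" and M: "memory_ok M" and j: "j < 20" "R j = v" "v < n"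
    and f: "\<And>x R' M'. x \<in> block_of v \<Longrightarrow> (\<And>i. i < 20 \<Longrightarrow> R' i = R i) \<Longrightarrow> memory_ok M' \<Longrightarrow>
      (\<And>l. l < n \<Longrightarrow> M' (SB + l) = (if l = lab v then x else M (SB + l))) \<Longrightarrow> f (R', M') \<le> g x"
  shows "ert (resample j) f (R, M) \<le> of_nat resample_cost + avg (block_of v) g"
proof -
  have l: "M (AL + v) = lab v" using memory_okD(1)[OF M j(3)] .
  define M1 where "M1 = (\<lambda>a. if ZB \<le> a \<and> a < ZB + n then of_bool (lab (a - ZB) = lab v) else M a)"
  have M1: "memory_ok M1" by (rule memory_ok_cong[OF M]) (auto simp: M1_def ZB_def)
  have Z: "block_of v = {x. x < n \<and> M1 (ZB + x) \<noteq> 0}" by (auto simp: block_of_def M1_def)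
  have "ert (resample j) f (R, M) = 2 + ert mark (ert sample (ert (Add 25 5 25) (ert (Store 25 20) f))) (R(25 := lab v), M)"
    using R j l by (simp add: resample_def registers_okD add.assoc[symmetric])
  also have "ert mark (ert sample (ert (Add 25 5 25) (ert (Store 25 20) f))) (R(25 := lab v), M)
     \<le> of_nat (11 * n + 3) + (of_nat (sample_cost n) + avg (block_of v) (\<lambda>x. 2 + g x))"
  proof (rule ert_mark[OF _ M])
    show "registers_ok (R(25 := lab v))" using R by (rule registers_ok_cong) simp
    show "(R(25 := lab v)) 25 = lab v" by simp
    fix R' M' assume R': "\<And>i. i \<notin> {26..29} \<Longrightarrow> R' i = (R(25 := lab v)) i"
      and M': "M' = (\<lambda>a. if ZB \<le> a \<and> a < ZB + n then of_bool (lab (a - ZB) = lab v) else M a)"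
    have M1': "M' = M1" by (simp add: M' M1_def)
    have eR': "registers_ok R'" using R by (rule registers_ok_cong) (simp add: R')
    show "ert sample (ert (Add 25 5 25) (ert (Store 25 20) f)) (R', M')
       \<le> of_nat (sample_cost n) + avg (block_of v) (\<lambda>x. 2 + g x)"
      unfolding M1'
    proof (rule ert_sample[where b = ZB])
      show "R' 1 = n" "R' 6 = ZB" "R' 7 = 1" using registers_okD[OF eR'] by simp_all
      show "M1 (ZB + x) \<le> 1" if "x < n" for x using that by (simp add: M1_def)
      show "M1 a = 0" if "a \<ge> ZB + n" for a using memory_okD(3)[OF M1 that] .
      show "block_of v = {x. x < n \<and> M1 (ZB + x) \<noteq> 0}" by (rule Z)
      show "block_of v \<noteq> {}" using j(3) by (auto simp: block_of_def)
      fix x R'' assume x: "x \<in> block_of v" and R'': "\<And>i. i \<notin> {20..24} \<Longrightarrow> R'' i = R' i" "R'' 20 = x"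
      have c: "R'' 5 = SB" "R'' 25 = lab v" using R'' R' R by (simp_all add: registers_okD)
      have "f (R''(25 := SB + lab v), M1(SB + lab v := x)) \<le> g x"
      proof (rule f[OF x])
        show "(R''(25 := SB + lab v)) i = R i" if "i < 20" for i using that R'' R' by simp
        show "memory_ok (M1(SB + lab v := x))"
          using lab_lt[OF j(3)] by (intro memory_ok_cong[OF M1]) (auto simp: ZB_def)
        show "(M1(SB + lab v := x)) (SB + l) = (if l = lab v then x else M (SB + l))" if "l < n" for l
          using that by (simp add: M1_def ZB_def)
      qed
      then show "ert (Add 25 5 25) (ert (Store 25 20) f) (R'', M1) \<le> 2 + g x"
        using c R''(2) by (simp add: add.assoc[symmetric] add_left_mono)
    qed
  qed
  also have "avg (block_of v) (\<lambda>x. 2 + g x) = 2 + avg (block_of v) g"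
    by (rule avg_add_const) (use j in \<open>auto simp: block_of_def\<close>)
  also have "2 + (of_nat (11 * n + 3) + (of_nat (sample_cost n) + (2 + avg (block_of v) g))) =
     of_nat (2 + (11 * n + 3) + sample_cost n + 2) + avg (block_of v) g"
    by (simp only: of_nat_add of_nat_numeral add.assoc)
  also have "2 + (11 * n + 3) + sample_cost n + 2 = resample_cost" by (simp add: resample_cost_def)
  finally show ?thesis by (simp add: add_left_mono)
qed

end

section \<open>Detecting and repairing a violation\<close>

locale adjacency_layout = layout +
  assumes adj_sym: "adj u v = adj v u" and adj_irrefl: "\<not> adj u u"
begin

definition "sel M v \<longleftrightarrow> M (SB + lab v) = v"
definition "nbrs M u = {v. v < n \<and> adj v u \<and> sel M v \<and> sel M u}"

lemma finite_nbrs [simp]: "finite (nbrs M u)" by (simp add: nbrs_def)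

lemma ert_test_selected:
  assumes "registers_ok R" "M (AL + v) = lab v" "R s = v" "d \<ge> 10" "s \<noteq> d" "s \<noteq> d + 1"
  shows "ert (test_selected d s) f (R, M) = 8 + f (R(d := of_bool (sel M v), d + 1 := M (SB + lab v) - v), M)"
proof -
  have "R(d := a, d + 1 := c, d := b) = R(d := b, d + 1 := c)" for a b c by (auto simp: fun_eq_iff)
  then show ?thesis using assms
    by (simp add: test_selected_def registers_okD eq_test sel_def eq_commute[of v] add.assoc[symmetric])
qed

text \<open>
  Two neighbours suffice as a record, because a triangle at \<open>u\<close> has to be recognised only if \<open>u\<close> has no third
  chosen neighbour.
\<close>

definition scanned :: "(nat \<Rightarrow> nat) \<Rightarrow> nat \<Rightarrow> nat \<Rightarrow> (nat \<Rightarrow> nat) \<Rightarrow> (nat \<Rightarrow> nat) \<Rightarrow> bool" where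
  "scanned M u v R' M' \<longleftrightarrow> (let N = nbrs M u \<inter> {..<v} in
     registers_ok R' \<and> R' 10 = u \<and> R' 14 = card N \<and>
     M' = (\<lambda>a. if ZB \<le> a \<and> a < ZB + v then of_bool (a - ZB \<in> N) else M a) \<and>
     (N \<noteq> {} \<longrightarrow> R' 12 \<in> N \<and> R' 13 = AG + R' 12 * n) \<and>
     (card N \<ge> 2 \<longrightarrow> R' 11 \<in> N \<and> R' 11 \<noteq> R' 12))"

lemma ert_scan:
  assumes R: "registers_ok R" and M: "memory_ok M" and u: "R 10 = u" "u < n"
    and f: "\<And>R' M'. scanned M u n R' M' \<Longrightarrow> f (R', M') \<le> X"
  shows "ert scan f (R, M) \<le> of_nat (25 * n + 16) + X"
proof -
  define J where "J v s \<longleftrightarrow> scanned M u v (fst s) (snd s) \<and> fst s 30 = v \<and> fst s 31 = AG + v * n \<and> fst s 33 = n - v \<and>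
     fst s 34 = of_bool (sel M u)" for v and s :: state
  define R0 where "R0 = R(11 := 0, 12 := 0, 13 := 0, 14 := 0, 30 := 0, 31 := AG, 34 := of_bool (sel M u), 35 := M (SB + lab u) - u, 33 := n)"
  have loop: "ert (While 33 scan_body) f (R0, M) \<le> of_nat ((n - 0) * (24 + 1) + 1) + X"
  proof (rule ert_for[where J = J and F = "\<lambda>_ _. X" and N = n and k = 0])
    fix v s assume v: "v < n" and Js: "J v s"
    obtain R' M' where s: "s = (R', M')" by fastforce
    define N where "N = nbrs M u \<inter> {..<v}"
    have N': "nbrs M u \<inter> {..<Suc v} = (if v \<in> nbrs M u then insert v N else N)" by (auto simp: N_def less_Suc_eq)
    have vN: "v \<notin> N" "finite N" by (auto simp: N_def)
    have eR: "registers_ok R'" and c: "R' 30 = v" "R' 31 = AG + v * n" "R' 33 = n - v" "R' 34 = of_bool (sel M u)" "R' 10 = u" "R' 14 = card N"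
      and M': "M' = (\<lambda>a. if ZB \<le> a \<and> a < ZB + v then of_bool (a - ZB \<in> N) else M a)"
      and q: "N \<noteq> {} \<Longrightarrow> R' 12 \<in> N \<and> R' 13 = AG + R' 12 * n" and p: "card N \<ge> 2 \<Longrightarrow> R' 11 \<in> N \<and> R' 11 \<noteq> R' 12"
      using Js by (auto simp: J_def s scanned_def Let_def N_def)
    have low: "M' a = M a" if "a < ZB" for a using that by (simp add: M')
    have m1: "M' (AL + v) = lab v" using memory_okD(1)[OF M v] v by (subst low) (auto simp: ZB_def SB_def)
    have m2: "M' (AG + v * n + u) = of_bool (adj v u)"
      using memory_okD(2)[OF M u(2) v] adj_addr[OF v u(2)] by (subst low) (auto simp: ZB_def SB_def)
    have m3: "sel M' v = sel M v" using lab_lt[OF v] unfolding sel_def by (subst low) (auto simp: ZB_def)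
    define z where "z = (of_bool (v \<in> nbrs M u) :: nat)"
    have z: "of_bool (adj v u) + of_bool (sel M u) + of_bool (sel M v) - 2 = z"
      using v by (auto simp: z_def nbrs_def)
    define R1 where "R1 = R'(35 := z, 36 := ZB + v, 37 := M' (SB + lab v) - v)"
    define R2 where "R2 = (if v \<in> nbrs M u then R1(11 := R' 12, 12 := v, 13 := AG + v * n, 14 := Suc (card N)) else R1(19 := 0))"
    define R3 where "R3 = R2(30 := Suc v, 31 := AG + Suc v * n, 33 := n - Suc v)"
    define M3 where "M3 = M'(ZB + v := z)"
    have "J (Suc v) (R3, M3)"
    proof -
      have "registers_ok R3" using eR by (rule registers_ok_cong) (simp add: R3_def R2_def R1_def)
      moreover have "M3 = (\<lambda>a. if ZB \<le> a \<and> a < ZB + Suc v then of_bool (a - ZB \<in> (if v \<in> nbrs M u then insert v N else N)) else M a)"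
        by (auto simp: M3_def M' z_def N_def fun_eq_iff less_Suc_eq)
      moreover have "card (insert v N) = Suc (card N)" using vN by simp
      moreover have "R' 12 \<in> N" if "Suc (card N) \<ge> 2"
      proof -
        have "N \<noteq> {}" using that by auto
        then show ?thesis using q by blast
      qed
      ultimately show ?thesis
        using c q p vN unfolding J_def scanned_def N' Let_def
        by (cases "v \<in> nbrs M u") (auto simp: R3_def R2_def R1_def)
    qed
    moreover have "ert scan_body F s \<le> of_nat 24 + F (R3, M3)" for F
    proof -
      have e36: "registers_ok (R'(35 := x))" for x using eR by (rule registers_ok_cong) simp
      have sel36: "ert (test_selected 36 30) G (R'(35 := x), M') = 8 + G (R'(35 := x, 36 := of_bool (sel M v), 37 := M' (SB + lab v) - v), M')" for G x
        using ert_test_selected[OF e36[of x], of M' v 30 36 G] m1 m3 c by simp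
      define Q where "Q = If 35 (Add 11 12 8 ;; Add 12 30 8 ;; Add 13 31 8 ;; Add 14 14 7) (Const 19 0)"
      have "ert scan_body F s = 16 + ert Q (ert (Add 30 30 7) (ert (Add 31 31 1) (ert (Sub 33 1 30) F))) (R1, M3)"
        using c eR m2 z unfolding scan_body_def s Q_def[symmetric]
        by (simp add: sel36 registers_okD R1_def M3_def add.assoc[symmetric] fun_upd_twist[of 36 35] fun_upd_twist[of 37 35] fun_upd_twist[of 37 36])
      also have "\<dots> \<le> 16 + (8 + F (R3, M3))"
      proof (rule add_left_mono, cases "v \<in> nbrs M u")
        case True
        then show "ert Q
          (ert (Add 30 30 7) (ert (Add 31 31 1) (ert (Sub 33 1 30) F))) (R1, M3) \<le> 8 + F (R3, M3)"
          using c eR by (simp add: Q_def R3_def R2_def R1_def z_def registers_okD add.assoc[symmetric] add.commute[of n])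
      next
        case False
        then have "ert Q
          (ert (Add 30 30 7) (ert (Add 31 31 1) (ert (Sub 33 1 30) F))) (R1, M3) = 5 + F (R3, M3)"
          using c eR by (simp add: Q_def R3_def R2_def R1_def z_def registers_okD add.assoc[symmetric] add.commute[of n])
        also have "\<dots> \<le> 8 + F (R3, M3)" by (rule add_right_mono) simp
        finally show "ert Q
          (ert (Add 30 30 7) (ert (Add 31 31 1) (ert (Sub 33 1 30) F))) (R1, M3) \<le> 8 + F (R3, M3)" .
      qed
      also have "\<dots> = of_nat 24 + F (R3, M3)" by (simp add: add.assoc[symmetric])
      finally show ?thesis .
    qed
    from this[of "\<lambda>s'. if J (Suc v) s' then X else \<top>"]
    show "fst s 33 \<noteq> 0 \<and> ert scan_body (\<lambda>s'. if J (Suc v) s' then X else \<top>) s \<le> of_nat 24 + X"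
      using calculation c v by (simp add: s)
  next
    fix s assume Js: "J n s"
    obtain R' M' where s: "s = (R', M')" by fastforce
    show "fst s 33 = 0 \<and> f s \<le> X" using Js f[of R' M'] by (auto simp: J_def s)
  next
    have "registers_ok R0" using R by (rule registers_ok_cong) (simp add: R0_def)
    then show "J 0 (R0, M)" using u by (auto simp: J_def R0_def scanned_def Let_def)
  qed simp
  define R1 where "R1 = R(11 := 0, 12 := 0, 13 := 0, 14 := 0, 30 := 0, 31 := AG)"
  have e1: "registers_ok R1" using R by (rule registers_ok_cong) (simp add: R1_def)
  have "R1 10 = u" using u by (simp add: R1_def)
  then have "ert (test_selected 34 10) F (R1, M) = 8 + F (R1(34 := of_bool (sel M u), 34 + 1 := M (SB + lab u) - u), M)" for F
    using ert_test_selected[OF e1, of M u 10 34 F] memory_okD(1)[OF M u(2)] by simp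
  then have "ert scan f (R, M) = 15 + ert (While 33 scan_body) f (R0, M)"
    using R u by (simp add: scan_def registers_okD R1_def R0_def add.assoc[symmetric])
  also have "\<dots> \<le> 15 + (of_nat ((n - 0) * (24 + 1) + 1) + X)" by (rule add_left_mono[OF loop])
  also have "\<dots> = of_nat (15 + ((n - 0) * (24 + 1) + 1)) + X" by (simp only: of_nat_add of_nat_numeral add.assoc)
  also have "15 + ((n - 0) * (24 + 1) + 1) = 25 * n + 16" by simp
  finally show ?thesis .
qed

text \<open>
  The three outcomes are: no violation at \<open>u\<close>; a star with centre \<open>u\<close>, whose leaves are marked; a triangle at \<open>u\<close>, in
  which case \<open>u\<close> is marked too.
\<close>

definition verdict :: "(nat \<Rightarrow> nat) \<Rightarrow> nat \<Rightarrow> nat set \<Rightarrow> (nat \<Rightarrow> nat) \<Rightarrow> bool" where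
  "verdict M u Z R' \<longleftrightarrow>
     R' 17 \<noteq> 0 \<and> card (nbrs M u) < r \<and> \<not> (r = 3 \<and> card (nbrs M u) = 2 \<and> (\<forall>x\<in>nbrs M u. \<forall>y\<in>nbrs M u. x \<noteq> y \<longrightarrow> adj x y)) \<or>
     R' 17 = 0 \<and> card (nbrs M u) \<ge> r \<and> Z = nbrs M u \<or>
     R' 17 = 0 \<and> r = 3 \<and> nbrs M u = {R' 11, R' 12} \<and> R' 11 \<noteq> R' 12 \<and> adj (R' 11) (R' 12) \<and> Z = insert u (nbrs M u)"

lemma ert_judge:
  assumes M: "memory_ok M" and sc: "scanned M u n R M1" and u: "u < n"
    and f: "\<And>R' M' Z. registers_ok R' \<Longrightarrow> R' 10 = u \<Longrightarrow> memory_ok M' \<Longrightarrow> (\<And>l. l < n \<Longrightarrow> M' (SB + l) = M (SB + l)) \<Longrightarrow>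
      (\<And>x. x < n \<Longrightarrow> M' (ZB + x) = of_bool (x \<in> Z)) \<Longrightarrow> verdict M u Z R' \<Longrightarrow> f (R', M') \<le> X"
  shows "ert judge f (R, M1) \<le> 18 + X"
proof -
  define N where "N = nbrs M u"
  have Nn: "nbrs M u \<inter> {..<n} = N" by (auto simp: N_def nbrs_def)
  have eR: "registers_ok R" and c: "R 10 = u" "R 14 = card N"
    and M1: "M1 = (\<lambda>a. if ZB \<le> a \<and> a < ZB + n then of_bool (a - ZB \<in> N) else M a)"
    and q: "N \<noteq> {} \<Longrightarrow> R 12 \<in> N \<and> R 13 = AG + R 12 * n" and p: "card N \<ge> 2 \<Longrightarrow> R 11 \<in> N \<and> R 11 \<noteq> R 12"
    using sc by (auto simp: scanned_def Let_def Nn)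
  have finN: "finite N" by (simp add: N_def)
  have iM1: "memory_ok M1" by (rule memory_ok_cong[OF M]) (auto simp: M1 ZB_def)
  have st1: "M1 (SB + l) = M (SB + l)" if "l < n" for l using that by (simp add: M1 ZB_def)
  have z1: "M1 (ZB + x) = of_bool (x \<in> N)" if "x < n" for x using that by (simp add: M1)
  define d where "d = (2 * r - 6) + (6 - 2 * r) + (card N - 2) + (2 - card N)"
  have d0: "d = 0 \<longleftrightarrow> r = 3 \<and> card N = 2" by (auto simp: d_def)
  define w where "w = 2 * r - (card N + card N)"
  define P where "P = If 35 (Const 19 0) (Add 36 13 11 ;; Load 36 36 ;; If 36 (Add 35 6 10 ;; Store 35 7 ;; Const 17 0) (Const 19 0))"
  define R1 where "R1 = R(17 := w, 35 := d, 36 := card N - 2, 37 := 2 - card N)"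
  have eR1: "registers_ok R1" using eR by (rule registers_ok_cong) (simp add: R1_def)
  have start: "ert judge f (R, M1) = 11 + ert P f (R1, M1)"
    using c eR unfolding judge_def P_def[symmetric] R1_def d_def w_def
    by (simp add: registers_okD fun_upd_twist[of 36 35] fun_upd_twist[of 37 35] fun_upd_twist[of 37 36] add.assoc[symmetric])
  have done1: "f (R1', M1) \<le> X" if "registers_ok R1'" "R1' 10 = u" "verdict M u N R1'" for R1'
    using that(1,2) iM1 st1 z1 that(3) by (rule f)
  have "ert P f (R1, M1) \<le> 7 + X"
  proof (cases "d = 0")
    case False
    have "f (R1(19 := 0), M1) \<le> X"
    proof (rule done1)
      show "registers_ok (R1(19 := 0))" using eR1 by (rule registers_ok_cong) simp
      show "verdict M u N (R1(19 := 0))" using False unfolding verdict_def d0 N_def[symmetric] by (auto simp: R1_def w_def)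
    qed (simp add: R1_def c)
    then have "2 + f (R1(19 := 0), M1) \<le> 7 + X" by (intro add_mono) auto
    then show ?thesis using False by (simp add: P_def R1_def add.assoc[symmetric])
  next
    case True
    then have r3: "r = 3" and cN: "card N = 2" using d0 by auto
    then have "N \<noteq> {}" by auto
    then have q: "R 12 \<in> N" "R 13 = AG + R 12 * n" and p: "R 11 \<in> N" "R 11 \<noteq> R 12" using q p cN by auto
    have N: "N = {R 11, R 12}"
      using q p cN finN by (intro card_seteq[symmetric]) auto
    have lt: "R 12 < n" "R 11 < n" using q(1) p(1) by (auto simp: N_def nbrs_def)
    have m: "M1 (AG + R 12 * n + R 11) = of_bool (adj (R 12) (R 11))" using memory_okD(2)[OF iM1 lt(2,1)] .
    show ?thesis
    proof (cases "adj (R 12) (R 11)")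
      case False
      define R2 where "R2 = R1(36 := 0, 19 := 0)"
      have "f (R2, M1) \<le> X"
      proof (rule done1)
        show "registers_ok R2" using eR1 by (rule registers_ok_cong) (simp add: R2_def)
        show "verdict M u N R2" using False r3 cN N p q unfolding verdict_def N_def[symmetric]
          by (auto simp: R2_def R1_def w_def)
      qed (simp add: R1_def R2_def c)
      then have "5 + f (R2, M1) \<le> 7 + X" by (intro add_mono) auto
      then show ?thesis using True False m q by (simp add: P_def R1_def R2_def add.assoc[symmetric])
    next
      case adj: True
      define R2 where "R2 = R1(36 := 1, 35 := ZB + u, 17 := 0)"
      define M2 where "M2 = M1(ZB + u := 1)"
      have "f (R2, M2) \<le> X"
      proof (rule f)
        show "registers_ok R2" using eR1 by (rule registers_ok_cong) (simp add: R2_def)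
        show "memory_ok M2" by (rule memory_ok_cong[OF iM1]) (use u in \<open>auto simp: M2_def ZB_def\<close>)
        show "M2 (SB + l) = M (SB + l)" if "l < n" for l using st1[OF that] that by (simp add: M2_def ZB_def)
        show "M2 (ZB + x) = of_bool (x \<in> insert u N)" if "x < n" for x using z1[OF that] by (simp add: M2_def)
        show "verdict M u (insert u N) R2" using adj adj_sym r3 N p unfolding verdict_def N_def[symmetric]
          by (auto simp: R2_def R1_def)
      qed (simp add: R1_def R2_def c)
      then have "7 + f (R2, M2) \<le> 7 + X" by (intro add_mono) auto
      then show ?thesis using True adj m q eR c by (simp add: P_def R1_def R2_def M2_def registers_okD add.assoc[symmetric])
    qed
  qed
  then have "11 + ert P f (R1, M1) \<le> 11 + (7 + X)"
    by (rule add_left_mono)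
  then show ?thesis unfolding start by (simp add: add.assoc[symmetric])
qed

definition "repair_cost = sample_cost n + 2 * resample_cost + 7"

lemma ert_repair:
  assumes R: "registers_ok R" and M: "memory_ok M" and u: "R 10 = u"
    and Z: "\<And>x. x < n \<Longrightarrow> M (ZB + x) = of_bool (x \<in> Z)" "Z \<subseteq> {..<n}" "Z \<noteq> {}"
    and ab: "\<And>x. x \<in> Z \<Longrightarrow> a x = (if x = u then R 11 else u)" "\<And>x. x \<in> Z \<Longrightarrow> b x = (if x = u then R 12 else x)"
      "\<And>x. x \<in> Z \<Longrightarrow> a x < n" "\<And>x. x \<in> Z \<Longrightarrow> b x < n"
    and f: "\<And>R' M' \<sigma>'. registers_ok R' \<Longrightarrow> R' 10 = 0 \<Longrightarrow> memory_ok M' \<Longrightarrow> (\<And>l. l < n \<Longrightarrow> M' (SB + l) = \<sigma>' l) \<Longrightarrow>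
       (\<exists>x\<in>Z. \<exists>y\<in>block_of (a x). \<exists>z\<in>block_of (b x). \<sigma>' = ((\<lambda>l. M (SB + l))(lab (a x) := y))(lab (b x) := z)) \<Longrightarrow>
       f (R', M') \<le> g \<sigma>'"
  shows "ert repair f (R, M) \<le> of_nat repair_cost +
     avg Z (\<lambda>x. avg (block_of (a x)) (\<lambda>y. avg (block_of (b x)) (\<lambda>z. g (((\<lambda>l. M (SB + l))(lab (a x) := y))(lab (b x) := z)))))"
proof -
  define \<sigma> where "\<sigma> = (\<lambda>l. M (SB + l))"
  define A where "A x = avg (block_of (a x)) (\<lambda>y. avg (block_of (b x)) (\<lambda>z. g ((\<sigma>(lab (a x) := y))(lab (b x) := z))))" for x
  define c2 where "c2 = 6 + (resample_cost + (resample_cost + 1))"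
  have blk_ne: "finite (block_of v)" "v < n \<Longrightarrow> block_of v \<noteq> {}" for v by (auto simp: block_of_def)
  have "ert repair f (R, M) \<le> of_nat (sample_cost n) + avg Z (\<lambda>x. of_nat c2 + A x)"
    unfolding repair_def ert_Seq
  proof (rule ert_sample[where b = ZB])
    show "R 1 = n" "R 6 = ZB" "R 7 = 1" using registers_okD[OF R] by simp_all
    show "M (ZB + x) \<le> 1" if "x < n" for x using Z(1)[OF that] by simp
    show "M a = 0" if "a \<ge> ZB + n" for a using memory_okD(3)[OF M that] .
    show "Z = {x. x < n \<and> M (ZB + x) \<noteq> 0}" using Z(1,2) by auto
    show "Z \<noteq> {}" by fact
    fix x R1 assume x: "x \<in> Z" and R1: "\<And>i. i \<notin> {20..24} \<Longrightarrow> R1 i = R i" "R1 20 = x"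
    have eR1: "registers_ok R1" using R by (rule registers_ok_cong) (simp add: R1)
    define R2 where "R2 = R1(35 := (x - u) + (u - x), 36 := u - x, 15 := a x, 16 := b x)"
    have eR2: "registers_ok R2" using eR1 by (rule registers_ok_cong) (simp add: R2_def)
    define pick where "pick F = ert (Sub 35 20 10) (ert (Sub 36 10 20) (ert (Add 35 35 36) (ert (If 35 (Add 15 10 8 ;; Add 16 20 8) (Add 15 11 8 ;; Add 16 12 8)) F)))" for F
    have "pick F (R1, M) = 6 + F (R2, M)" for F
    proof (cases "x = u")
      case True
      then show ?thesis using R1 u R x ab(1,2)[OF x]
        by (simp add: pick_def registers_okD R2_def add.assoc[symmetric] fun_upd_twist[of 36 35])
    next
      case False
      then have "(x - u) + (u - x) > 0" by arith
      then show ?thesis using False R1 u R x ab(1,2)[OF x]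
        by (simp add: pick_def registers_okD R2_def add.assoc[symmetric] fun_upd_twist[of 36 35] del: add_gr_0 zero_less_diff)
    qed
    moreover have "ert (resample 15) (ert (resample 16) (ert (Const 10 0) f)) (R2, M) \<le> of_nat resample_cost +
       avg (block_of (a x)) (\<lambda>y. of_nat (resample_cost + 1) + avg (block_of (b x)) (\<lambda>z. g ((\<sigma>(lab (a x) := y))(lab (b x) := z))))"
    proof (rule ert_resample[OF eR2 M])
      show "R2 15 = a x" by (simp add: R2_def)
      show "a x < n" by (rule ab(3)[OF x])
      fix y R3 M3 assume y: "y \<in> block_of (a x)" and R3: "\<And>i. i < 20 \<Longrightarrow> R3 i = R2 i" and iM3: "memory_ok M3"
        and M3: "\<And>l. l < n \<Longrightarrow> M3 (SB + l) = (if l = lab (a x) then y else M (SB + l))"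
      have eR3: "registers_ok R3" using eR2 by (rule registers_ok_cong) (simp add: R3)
      have "ert (resample 16) (ert (Const 10 0) f) (R3, M3) \<le> of_nat resample_cost +
         avg (block_of (b x)) (\<lambda>z. 1 + g ((\<sigma>(lab (a x) := y))(lab (b x) := z)))"
      proof (rule ert_resample[OF eR3 iM3])
        show "R3 16 = b x" by (simp add: R3 R2_def)
        show "b x < n" by (rule ab(4)[OF x])
        fix z R4 M4 assume z: "z \<in> block_of (b x)" and R4: "\<And>i. i < 20 \<Longrightarrow> R4 i = R3 i" and iM4: "memory_ok M4"
          and M4: "\<And>l. l < n \<Longrightarrow> M4 (SB + l) = (if l = lab (b x) then z else M3 (SB + l))"
        have "f (R4(10 := 0), M4) \<le> g ((\<sigma>(lab (a x) := y))(lab (b x) := z))"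
        proof (rule f[OF _ _ iM4])
          have "registers_ok R4" using eR3 by (rule registers_ok_cong) (simp add: R4)
          then show "registers_ok (R4(10 := 0))" by (rule registers_ok_cong) simp
          show "M4 (SB + l) = ((\<sigma>(lab (a x) := y))(lab (b x) := z)) l" if "l < n" for l
            using that by (simp add: M4 M3 \<sigma>_def)
        qed (use x y z in \<open>auto simp: \<sigma>_def\<close>)
        then show "ert (Const 10 0) f (R4, M4) \<le> 1 + g ((\<sigma>(lab (a x) := y))(lab (b x) := z))"
          by (simp add: add_left_mono)
      qed simp
      also have "\<dots> = of_nat (resample_cost + 1) + avg (block_of (b x)) (\<lambda>z. g ((\<sigma>(lab (a x) := y))(lab (b x) := z)))"
        using blk_ne ab(4)[OF x] by (simp add: avg_add_const add.assoc)
      finally show "ert (resample 16) (ert (Const 10 0) f) (R3, M3) \<le> of_nat (resample_cost + 1) +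
         avg (block_of (b x)) (\<lambda>z. g ((\<sigma>(lab (a x) := y))(lab (b x) := z)))" .
    qed simp
    moreover have "avg (block_of (a x)) (\<lambda>y. of_nat (resample_cost + 1) + avg (block_of (b x)) (\<lambda>z. g ((\<sigma>(lab (a x) := y))(lab (b x) := z))))
       = of_nat (resample_cost + 1) + A x"
      unfolding A_def using blk_ne ab(3)[OF x] by (intro avg_add_const) auto
    ultimately have "pick (ert (resample 15) (ert (resample 16) (ert (Const 10 0) f))) (R1, M) \<le> 6 + (of_nat resample_cost + (of_nat (resample_cost + 1) + A x))"
      by (simp add: add_left_mono)
    also have "\<dots> = of_nat c2 + A x" unfolding c2_def by (simp only: of_nat_add of_nat_numeral add.assoc)
    finally show "ert (Sub 35 20 10) (ert (Sub 36 10 20) (ert (Add 35 35 36) (ert (If 35 (Add 15 10 8 ;; Add 16 20 8) (Add 15 11 8 ;; Add 16 12 8))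
       (ert (resample 15) (ert (resample 16) (ert (Const 10 0) f)))))) (R1, M) \<le> of_nat c2 + A x"
      unfolding pick_def .
  qed
  also have "avg Z (\<lambda>x. of_nat c2 + A x) = of_nat c2 + avg Z A"
    using Z(2,3) finite_subset by (intro avg_add_const) auto
  also have "of_nat (sample_cost n) + (of_nat c2 + avg Z A) = of_nat (sample_cost n + c2) + avg Z A"
    by (simp only: of_nat_add add.assoc)
  also have "sample_cost n + c2 = repair_cost" by (simp add: repair_cost_def c2_def)
  finally show ?thesis by (simp add: A_def[abs_def] \<sigma>_def)
qed

end

section \<open>The search loop\<close>

lemma avg_affine:
  assumes "finite A" "A \<noteq> {}" shows "avg A (\<lambda>x. K + c * h x) = K + c * avg A h"
proof -
  have "avg A (\<lambda>x. K + c * h x) = K + avg A (\<lambda>x. c * h x)" using assms by (rule avg_add_const)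
  then show ?thesis by (simp add: avg_def ennreal_times_divide sum_distrib_left)
qed

locale machine = adjacency_layout n AG r adj lab + blocks "{..<n}" lab E r
  for n AG r :: nat and adj :: "nat \<Rightarrow> nat \<Rightarrow> bool" and lab :: "nat \<Rightarrow> nat" and E :: "nat set set" +
  assumes E_eq: "E = {{u, v} | u v. u < n \<and> v < n \<and> adj u v \<and> lab u \<noteq> lab v}"
begin

definition "selection M = (\<lambda>l. M (SB + l))"
definition "valid \<sigma> \<longleftrightarrow> (\<forall>v<n. \<sigma> (lab v) < n \<and> lab (\<sigma> (lab v)) = lab v)"
text \<open>
  If \<open>u\<close> has three chosen neighbours, then a triangle at \<open>u\<close> is no concern for \<open>r = 3\<close>, as a star is present already.
\<close>

definition "ok M u \<longleftrightarrow> card (nbrs M u) < r \<and>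
   \<not> (r = 3 \<and> card (nbrs M u) = 2 \<and> (\<forall>x\<in>nbrs M u. \<forall>y\<in>nbrs M u. x \<noteq> y \<longrightarrow> adj x y))"
definition "solved M \<longleftrightarrow> valid (selection M) \<and> (\<forall>u<n. ok M u)"

lemma block_of_eq: "block_of v = block (lab v)" by (auto simp: block_of_def block_def)

lemma labels_lt: "l \<in> labels \<Longrightarrow> l < n" using lab_lt by (auto simp: labels_def)

lemma finite_block_of [simp]: "finite (block_of v)" by (simp add: block_of_def)
lemma block_of_ne: "v < n \<Longrightarrow> block_of v \<noteq> {}" by (auto simp: block_of_def)

lemma avg_potential:
  assumes "v < n" shows "avg (block_of v) (\<lambda>x. potential D (\<sigma>(lab v := x))) = potential (insert (lab v) D) \<sigma>"
  using assms by (simp add: avg_def block_of_eq potential_resample labels_def)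

lemma nbrs_cong: "(\<And>l. l < n \<Longrightarrow> M' (SB + l) = M (SB + l)) \<Longrightarrow> u < n \<Longrightarrow> nbrs M' u = nbrs M u"
  using lab_lt by (auto simp: nbrs_def sel_def)

text \<open>
  The marked vertices represent the edges of a star or of a triangle, so the drift inequality applies to them.
\<close>

lemma mean_drift:
  assumes u: "u < n" and ver: "verdict M u Z R" and bad: "R 17 = 0"
    and a: "\<And>x. a x = (if x = u then R 11 else u)" and b: "\<And>x. b x = (if x = u then R 12 else x)"
    and \<sigma>: "\<sigma> = selection M"
  shows "Z \<subseteq> {..<n}" "Z \<noteq> {}" "\<And>x. x \<in> Z \<Longrightarrow> a x < n" "\<And>x. x \<in> Z \<Longrightarrow> b x < n"
    "1 + avg Z (\<lambda>x. avg (block_of (a x)) (\<lambda>y. avg (block_of (b x)) (\<lambda>z. potential {} ((\<sigma>(lab (a x) := y))(lab (b x) := z))))) \<le> potential {} \<sigma>"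
proof -
  define c where "c x = {a x, b x}" for x
  have N: "x < n \<and> adj x u \<and> sel M x \<and> sel M u \<and> x \<noteq> u" if "x \<in> nbrs M u" for x
    using that adj_irrefl by (auto simp: nbrs_def)
  consider (star) "card (nbrs M u) \<ge> r" "Z = nbrs M u"
    | (tri) "r = 3" "nbrs M u = {R 11, R 12}" "R 11 \<noteq> R 12" "adj (R 11) (R 12)" "Z = insert u (nbrs M u)"
    using ver bad unfolding verdict_def by auto
  then have key: "Z \<subseteq> {..<n} \<and> card Z \<ge> r \<and> inj_on c Z \<and>
     (\<forall>x\<in>Z. a x < n \<and> b x < n \<and> a x \<noteq> b x \<and> adj (a x) (b x) \<and> sel M (a x) \<and> sel M (b x)) \<and>
     (\<forall>x\<in>Z. \<forall>y\<in>Z. c x \<inter> c y \<noteq> {})"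
  proof cases
    case star
    have "a x = u" "b x = x" if "x \<in> Z" for x using N[of x] that star a b by auto
    then show ?thesis using star N u adj_sym unfolding inj_on_def c_def
      by (auto simp: doubleton_eq_iff)
  next
    case tri
    have p: "R 11 \<in> nbrs M u" "R 12 \<in> nbrs M u" using tri by auto
    have ab: "a u = R 11" "b u = R 12" "a (R 11) = u" "b (R 11) = R 11" "a (R 12) = u" "b (R 12) = R 12"
      using N[OF p(1)] N[OF p(2)] by (auto simp: a b)
    have Z: "Z = {u, R 11, R 12}" using tri by simp
    have ne: "u \<noteq> R 11" "u \<noteq> R 12" using N p by auto
    have cc: "c u = {R 11, R 12}" "c (R 11) = {u, R 11}" "c (R 12) = {u, R 12}" by (simp_all add: c_def ab)
    have "card Z \<ge> r" using tri(1,3) ne by (simp add: Z)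
    moreover have "inj_on c Z" unfolding Z inj_on_def using cc tri(3) ne by (auto simp: doubleton_eq_iff)
    moreover have "\<forall>x\<in>Z. a x < n \<and> b x < n \<and> a x \<noteq> b x \<and> adj (a x) (b x) \<and> sel M (a x) \<and> sel M (b x)"
      unfolding Z using ab N[OF p(1)] N[OF p(2)] tri(3,4) u adj_sym by auto
    moreover have "\<forall>x\<in>Z. \<forall>y\<in>Z. c x \<inter> c y \<noteq> {}" unfolding Z using cc by auto
    ultimately show ?thesis using u N[OF p(1)] N[OF p(2)] by (simp add: Z)
  qed
  show Zn: "Z \<subseteq> {..<n}" using key by blast
  show Zne: "Z \<noteq> {}" using key r_pos by auto
  show an: "\<And>x. x \<in> Z \<Longrightarrow> a x < n" and bn: "\<And>x. x \<in> Z \<Longrightarrow> b x < n" using key by auto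
  have sel: "\<sigma> (lab v) = v" if "sel M v" for v using that by (simp add: sel_def \<sigma> selection_def)
  have "1 + (\<Sum>x\<in>Z. potential (lab ` c x) \<sigma>) / of_nat (card Z) \<le> potential {} \<sigma>"
  proof (rule potential_drift)
    show "finite Z" using Zn finite_subset by blast
    show "r \<le> card Z" "inj_on c Z" using key by auto
    show "c x \<inter> c y \<noteq> {}" if "x \<in> Z" "y \<in> Z" for x y using key that by blast
    fix x assume x: "x \<in> Z"
    have x': "a x < n" "b x < n" "a x \<noteq> b x" "adj (a x) (b x)" "sel M (a x)" "sel M (b x)" using key x by auto
    have "lab (a x) \<noteq> lab (b x)" using sel[OF x'(5)] sel[OF x'(6)] x'(3) by metis
    then show "c x \<in> E" using x' unfolding E_eq c_def by blast
    show "\<sigma> l \<in> c x" if "l \<in> lab ` c x" for l using that sel[OF x'(5)] sel[OF x'(6)] by (auto simp: c_def)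
  qed
  moreover have "avg (block_of (a x)) (\<lambda>y. avg (block_of (b x)) (\<lambda>z. potential {} ((\<sigma>(lab (a x) := y))(lab (b x) := z)))) = potential (lab ` c x) \<sigma>"
    if "x \<in> Z" for x
    using an[OF that] bn[OF that] by (simp add: avg_potential c_def)
  ultimately show "1 + avg Z (\<lambda>x. avg (block_of (a x)) (\<lambda>y. avg (block_of (b x)) (\<lambda>z. potential {} ((\<sigma>(lab (a x) := y))(lab (b x) := z))))) \<le> potential {} \<sigma>"
    by (simp add: avg_def[of Z])
qed

definition "step_cost = 25 * n + 38"
definition "round_cost = 25 * n + 37 + repair_cost + n * step_cost"

text \<open>
  A repair sends the scan back to the first vertex. The scans that are lost in this way are paid for, together with the
  repair, by the expected drop of the potential by 1.
\<close>

lemma ert_search: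
  assumes R: "registers_ok R" and M: "memory_ok M" and val: "valid (selection M)"
    and f: "\<And>R' M'. registers_ok R' \<Longrightarrow> memory_ok M' \<Longrightarrow> solved M' \<Longrightarrow> f (R', M') \<le> B"
  shows "ert search f (R, M) \<le> of_nat (n * step_cost + 3) + B + of_nat round_cost * potential {} (selection M)"
proof -
  define I where "I s \<longleftrightarrow> (case s of (R, M) \<Rightarrow> registers_ok R \<and> memory_ok M \<and> valid (selection M) \<and> R 10 \<le> n \<and> R 18 = n - R 10 \<and> (\<forall>u<R 10. ok M u))" for s
  define \<Psi> where "\<Psi> s = (if I s then of_nat ((n - fst s 10) * step_cost + 1) + B + of_nat round_cost * potential {} (selection (snd s)) else \<top>)" for s
  have "ert (While 18 main_body) f (R(10 := 0, 18 := n), M) \<le> \<Psi> (R(10 := 0, 18 := n), M)"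
  proof (rule ert_While_le)
    fix s :: state assume s0: "fst s 18 = 0"
    obtain R M where s: "s = (R, M)" by fastforce
    show "1 + f s \<le> \<Psi> s"
    proof (cases "I s")
      case True
      then have h: "registers_ok R" "memory_ok M" "valid (selection M)" "\<forall>u<R 10. ok M u" and "R 10 \<le> n" "R 18 = n - R 10"
        by (simp_all add: I_def s)
      moreover have R10: "R 10 = n" using calculation s0 by (simp add: s)
      ultimately have "solved M" by (simp add: solved_def)
      then have "f s \<le> B" unfolding s using h by (intro f)
      moreover have "B \<le> B + of_nat round_cost * potential {} (selection M)" by simp
      ultimately have "1 + f s \<le> 1 + (B + of_nat round_cost * potential {} (selection M))" by (meson add_left_mono order_trans)
      then show ?thesis using True R10 by (simp add: \<Psi>_def s add.assoc)
    qed (simp add: \<Psi>_def)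
  next
    fix s :: state assume s0: "fst s 18 \<noteq> 0"
    obtain R M where s: "s = (R, M)" by fastforce
    show "1 + ert main_body \<Psi> s \<le> \<Psi> s"
    proof (cases "I s")
      case True
      define u where "u = R 10"
      have R: "registers_ok R" and M: "memory_ok M" and val: "valid (selection M)" and u: "u < n" and okM: "\<And>v. v < u \<Longrightarrow> ok M v"
        using True s0 by (auto simp: I_def s u_def)
      define \<sigma> where "\<sigma> = selection M"
      (* what is left of the allowance after scanning and judging u *)
      define X2 where "X2 = of_nat ((n - Suc u) * step_cost + 4) + B + of_nat round_cost * potential {} \<sigma>"
      have "ert scan (ert judge (ert (If 17 (Add 10 10 7) repair) (ert (Sub 18 1 10) \<Psi>))) (R, M) \<le> of_nat (25 * n + 16) + (18 + X2)"
      proof (rule ert_scan[OF R M _ u])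
        show "R 10 = u" by (simp add: u_def)
        fix R1 M1 assume sc: "scanned M u n R1 M1"
        show "ert judge (ert (If 17 (Add 10 10 7) repair) (ert (Sub 18 1 10) \<Psi>)) (R1, M1) \<le> 18 + X2"
        proof (rule ert_judge[OF M sc u])
          fix R2 M2 Z assume R2: "registers_ok R2" "R2 10 = u" and M2: "memory_ok M2"
            and st2: "\<And>l. l < n \<Longrightarrow> M2 (SB + l) = M (SB + l)"
            and Z: "\<And>x. x < n \<Longrightarrow> M2 (ZB + x) = of_bool (x \<in> Z)" and ver: "verdict M u Z R2"
          have val2: "valid (selection M2)" using val st2 lab_lt by (simp add: valid_def selection_def)
          have ok2: "ok M2 v \<longleftrightarrow> ok M v" if "v < n" for v using nbrs_cong[of M2 M v] st2 that by (simp add: ok_def)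
          have Phi2: "potential D (selection M2) = potential D \<sigma>" for D
            using st2 labels_lt by (intro potential_cong) (auto simp: selection_def \<sigma>_def)
          show "ert (If 17 (Add 10 10 7) repair) (ert (Sub 18 1 10) \<Psi>) (R2, M2) \<le> X2"
          proof (cases "R2 17 = 0")
            case False
            then have "ok M u" using ver by (auto simp: verdict_def ok_def)
            then have okSuc: "ok M2 v" if "v < Suc u" for v using ok2 okM that u by (metis less_SucE less_trans)
            define R3 where "R3 = R2(10 := Suc u, 18 := n - Suc u)"
            have "registers_ok R3" using R2(1) by (rule registers_ok_cong) (simp add: R3_def)
            then have "I (R3, M2)" using M2 val2 okSuc u by (auto simp: I_def R3_def)
            then have "\<Psi> (R3, M2) = of_nat ((n - Suc u) * step_cost + 1) + B + of_nat round_cost * potential {} \<sigma>"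
              by (simp add: \<Psi>_def R3_def Phi2)
            moreover have "ert (If 17 (Add 10 10 7) repair) (ert (Sub 18 1 10) \<Psi>) (R2, M2) = 3 + \<Psi> (R3, M2)"
              using False R2 by (simp add: registers_okD R3_def add.assoc[symmetric])
            ultimately have "ert (If 17 (Add 10 10 7) repair) (ert (Sub 18 1 10) \<Psi>) (R2, M2) = of_nat (3 + ((n - Suc u) * step_cost + 1)) + B + of_nat round_cost * potential {} \<sigma>"
              by (simp only: of_nat_add of_nat_numeral add.assoc)
            also have "3 + ((n - Suc u) * step_cost + 1) = (n - Suc u) * step_cost + 4" by simp
            finally show ?thesis by (simp add: X2_def)
          next
            case True
            define a where "a x = (if x = u then R2 11 else u)" for x
            define b where "b x = (if x = u then R2 12 else x)" for x
            note D = mean_drift[OF u ver True a_def b_def \<sigma>_def]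
            define G where "G = avg Z (\<lambda>x. avg (block_of (a x)) (\<lambda>y. avg (block_of (b x)) (\<lambda>z. potential {} ((\<sigma>(lab (a x) := y))(lab (b x) := z)))))"
            define K where "K = of_nat (n * step_cost + 2) + B"
            have finZ: "finite Z" using D(1) finite_subset by blast
            have "ert repair (ert (Sub 18 1 10) \<Psi>) (R2, M2) \<le> of_nat repair_cost +
               avg Z (\<lambda>x. avg (block_of (a x)) (\<lambda>y. avg (block_of (b x)) (\<lambda>z.
                 K + of_nat round_cost * potential {} (((\<lambda>l. M2 (SB + l))(lab (a x) := y))(lab (b x) := z)))))"
            proof (rule ert_repair[OF R2(1) M2 R2(2) Z D(1,2) _ _ D(3,4)])
              fix R3 M3 \<sigma>' assume R3: "registers_ok R3" "R3 10 = 0" and M3: "memory_ok M3" and st3: "\<And>l. l < n \<Longrightarrow> M3 (SB + l) = \<sigma>' l"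
                and \<sigma>': "\<exists>x\<in>Z. \<exists>y\<in>block_of (a x). \<exists>z\<in>block_of (b x). \<sigma>' = ((\<lambda>l. M2 (SB + l))(lab (a x) := y))(lab (b x) := z)"
              obtain x y z where yz: "y < n" "lab y = lab (a x)" "z < n" "lab z = lab (b x)"
                and \<sigma>'_eq: "\<sigma>' = ((\<lambda>l. M2 (SB + l))(lab (a x) := y))(lab (b x) := z)"
                using \<sigma>' unfolding block_of_def by blast
              have "valid \<sigma>'"
                using val2 yz unfolding \<sigma>'_eq valid_def selection_def by simp
              then have val3: "valid (selection M3)" using st3 lab_lt by (simp add: valid_def selection_def)
              have "potential {} (selection M3) = potential {} \<sigma>'" using st3 labels_lt by (intro potential_cong) (auto simp: selection_def)
              moreover have "registers_ok (R3(18 := n))" using R3(1) by (rule registers_ok_cong) simp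
              then have "I (R3(18 := n), M3)" using M3 val3 R3 by (auto simp: I_def)
              ultimately have "\<Psi> (R3(18 := n), M3) = of_nat (n * step_cost + 1) + B + of_nat round_cost * potential {} \<sigma>'"
                using R3 by (simp add: \<Psi>_def)
              then have "ert (Sub 18 1 10) \<Psi> (R3, M3) = of_nat (1 + (n * step_cost + 1)) + B + of_nat round_cost * potential {} \<sigma>'"
                using R3 by (simp add: registers_okD add.assoc)
              then show "ert (Sub 18 1 10) \<Psi> (R3, M3) \<le> K + of_nat round_cost * potential {} \<sigma>'" by (simp add: K_def)
            qed (auto simp: a_def b_def)
            also have "(\<lambda>x. avg (block_of (a x)) (\<lambda>y. avg (block_of (b x)) (\<lambda>z.
                 K + of_nat round_cost * potential {} (((\<lambda>l. M2 (SB + l))(lab (a x) := y))(lab (b x) := z))))) =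
              (\<lambda>x. avg (block_of (a x)) (\<lambda>y. avg (block_of (b x)) (\<lambda>z.
                 K + of_nat round_cost * potential {} ((\<sigma>(lab (a x) := y))(lab (b x) := z)))))"
            proof -
              have "potential {} (((\<lambda>l. M2 (SB + l))(lab (a x) := y))(lab (b x) := z)) = potential {} ((\<sigma>(lab (a x) := y))(lab (b x) := z))" for x y z
                using st2 labels_lt by (intro potential_cong) (auto simp: selection_def \<sigma>_def)
              then show ?thesis by simp
            qed
            also have "avg Z (\<lambda>x. avg (block_of (a x)) (\<lambda>y. avg (block_of (b x)) (\<lambda>z. K + of_nat round_cost * potential {} ((\<sigma>(lab (a x) := y))(lab (b x) := z)))))
               = avg Z (\<lambda>x. K + of_nat round_cost * avg (block_of (a x)) (\<lambda>y. avg (block_of (b x)) (\<lambda>z. potential {} ((\<sigma>(lab (a x) := y))(lab (b x) := z)))))"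
              unfolding avg_def[of Z] using D(3,4) block_of_ne
              by (intro arg_cong2[where f="(/)"] sum.cong refl) (simp add: avg_affine)
            also have "\<dots> = K + of_nat round_cost * G" unfolding G_def using finZ D(2) by (rule avg_affine)
            finally have rep: "ert repair (ert (Sub 18 1 10) \<Psi>) (R2, M2) \<le> of_nat repair_cost + (K + of_nat round_cost * G)" .
            have "of_nat round_cost * (1 + G) \<le> of_nat round_cost * potential {} \<sigma>" unfolding G_def by (intro mult_left_mono D(5)) simp
            then have G: "of_nat round_cost + of_nat round_cost * G \<le> of_nat round_cost * potential {} \<sigma>" by (simp add: distrib_left)
            have "ert (If 17 (Add 10 10 7) repair) (ert (Sub 18 1 10) \<Psi>) (R2, M2) = 1 + ert repair (ert (Sub 18 1 10) \<Psi>) (R2, M2)"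
              using True by simp
            also have "\<dots> \<le> 1 + (of_nat repair_cost + (K + of_nat round_cost * G))" by (rule add_left_mono[OF rep])
            also have "\<dots> = of_nat (1 + repair_cost + (n * step_cost + 2)) + B + of_nat round_cost * G"
              by (simp only: K_def of_nat_add of_nat_1 add.assoc)
            also have "\<dots> \<le> of_nat (round_cost + 4 + (n - Suc u) * step_cost) + B + of_nat round_cost * G"
              by (intro add_right_mono of_nat_mono) (simp add: round_cost_def)
            also have "\<dots> = of_nat ((n - Suc u) * step_cost + 4) + B + (of_nat round_cost + of_nat round_cost * G)"
              by (simp only: of_nat_add ac_simps)
            also have "\<dots> \<le> X2" unfolding X2_def by (intro add_left_mono G)
            finally show ?thesis .
          qed
        qed
      qed
      then have "1 + ert main_body \<Psi> s \<le> 1 + (of_nat (25 * n + 16) + (18 + X2))"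
        by (simp add: main_body_def s add_left_mono)
      also have "\<dots> = of_nat (1 + (25 * n + 16) + 18 + ((n - Suc u) * step_cost + 4)) + B + of_nat round_cost * potential {} \<sigma>"
        unfolding X2_def by (simp only: of_nat_add of_nat_1 of_nat_numeral add.assoc)
      also have "1 + (25 * n + 16) + 18 + ((n - Suc u) * step_cost + 4) = (n - u) * step_cost + 1"
      proof -
        have "n - u = Suc (n - Suc u)" using u by simp
        then show ?thesis by (simp add: step_cost_def)
      qed
      also have "of_nat ((n - u) * step_cost + 1) + B + of_nat round_cost * potential {} \<sigma> = \<Psi> s"
        using True by (simp add: \<Psi>_def s u_def \<sigma>_def)
      finally show ?thesis .
    qed (simp add: \<Psi>_def)
  qed
  also have "I (R(10 := 0, 18 := n), M)"
    using registers_ok_cong[OF R, of "R(10 := 0, 18 := n)"] M val by (simp add: I_def)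
  then have "\<Psi> (R(10 := 0, 18 := n), M) = of_nat (n * step_cost + 1) + B + of_nat round_cost * potential {} (selection M)"
    by (simp add: \<Psi>_def)
  finally have "2 + ert (While 18 main_body) f (R(10 := 0, 18 := n), M) \<le> 2 + (of_nat (n * step_cost + 1) + B + of_nat round_cost * potential {} (selection M))"
    by (rule add_left_mono)
  also have "\<dots> = of_nat (2 + (n * step_cost + 1)) + B + of_nat round_cost * potential {} (selection M)"
    by (simp only: of_nat_add of_nat_numeral add.assoc)
  also have "2 + (n * step_cost + 1) = n * step_cost + 3" by simp
  also have "2 + ert (While 18 main_body) f (R(10 := 0, 18 := n), M) = ert search f (R, M)"
    using R by (simp add: search_def registers_okD add.assoc[symmetric])
  finally show ?thesis .
qed

text \<open>
  Before vertex \<open>u\<close> is treated, the blocks of the vertices from \<open>u\<close> on count as undrawn; at the start these are all blocks,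
  and the potential is at most \<open>n\<close>.
\<close>

lemma ert_fill:
  assumes R: "registers_ok R" and M: "memory_ok M"
    and f: "\<And>R' M'. registers_ok R' \<Longrightarrow> memory_ok M' \<Longrightarrow> valid (selection M') \<Longrightarrow> f (R', M') \<le> B + of_nat C * potential {} (selection M')"
  shows "ert fill f (R, M) \<le> of_nat (n * (resample_cost + 3) + 3) + B + of_nat C * of_nat n"
proof -
  define J where "J u s \<longleftrightarrow> (case s of (R, M) \<Rightarrow> registers_ok R \<and> memory_ok M \<and> R 10 = u \<and> R 18 = n - u \<and>
     (\<forall>v<u. selection M (lab v) < n \<and> lab (selection M (lab v)) = lab v))" for u and s :: state
  define F where "F u s = B + of_nat C * potential (lab ` {u..<n}) (selection (snd s))" for u and s :: state
  have loop: "ert (While 18 (resample 10 ;; Add 10 10 7 ;; Sub 18 1 10)) f (R(10 := 0, 18 := n), M)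
     \<le> of_nat ((n - 0) * ((resample_cost + 2) + 1) + 1) + F 0 (R(10 := 0, 18 := n), M)"
  proof (rule ert_for[where J = J and k = 0 and N = n])
    fix u s assume u: "u < n" and Js: "J u s"
    obtain R M where s: "s = (R, M)" by fastforce
    have R: "registers_ok R" and M: "memory_ok M" and c: "R 10 = u" "R 18 = n - u" and val: "\<And>v. v < u \<Longrightarrow> selection M (lab v) < n \<and> lab (selection M (lab v)) = lab v"
      using Js by (auto simp: J_def s)
    let ?g = "\<lambda>s'. if J (Suc u) s' then F (Suc u) s' else \<top>"
    have "ert (resample 10) (ert (Add 10 10 7) (ert (Sub 18 1 10) ?g)) (R, M)
       \<le> of_nat resample_cost + avg (block_of u) (\<lambda>x. (2 + B) + of_nat C * potential (lab ` {Suc u..<n}) ((selection M)(lab u := x)))"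
    proof (rule ert_resample[OF R M])
      fix x R1 M1 assume x: "x \<in> block_of u" and R1: "\<And>i. i < 20 \<Longrightarrow> R1 i = R i" and M1: "memory_ok M1"
        and st1: "\<And>l. l < n \<Longrightarrow> M1 (SB + l) = (if l = lab u then x else M (SB + l))"
      define R2 where "R2 = R1(10 := Suc u, 18 := n - Suc u)"
      have "registers_ok R2" using R by (rule registers_ok_cong) (simp add: R2_def R1)
      moreover have "selection M1 (lab v) < n \<and> lab (selection M1 (lab v)) = lab v" if "v < Suc u" for v
      proof -
        have "v < n" using that u by simp
        then have "selection M1 (lab v) = (if lab v = lab u then x else selection M (lab v))" using st1[OF lab_lt] by (simp add: selection_def)
        then show ?thesis using x val[of v] that by (auto simp: block_of_def less_Suc_eq)
      qed
      ultimately have "J (Suc u) (R2, M1)" using M1 by (simp add: J_def R2_def)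
      moreover have "potential (lab ` {Suc u..<n}) (selection M1) = potential (lab ` {Suc u..<n}) ((selection M)(lab u := x))"
        using st1 labels_lt by (intro potential_cong) (auto simp: selection_def)
      ultimately have "?g (R2, M1) = B + of_nat C * potential (lab ` {Suc u..<n}) ((selection M)(lab u := x))"
        by (simp add: F_def)
      moreover have "ert (Add 10 10 7) (ert (Sub 18 1 10) ?g) (R1, M1) = 2 + ?g (R2, M1)"
        using c R R1 by (simp only: ert_basic) (simp add: registers_okD R2_def add.assoc[symmetric])
      ultimately show "ert (Add 10 10 7) (ert (Sub 18 1 10) ?g) (R1, M1) \<le> (2 + B) + of_nat C * potential (lab ` {Suc u..<n}) ((selection M)(lab u := x))"
        by (simp add: add.assoc)
    qed (use c u in auto)
    also have "avg (block_of u) (\<lambda>x. (2 + B) + of_nat C * potential (lab ` {Suc u..<n}) ((selection M)(lab u := x)))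
      = (2 + B) + of_nat C * potential (insert (lab u) (lab ` {Suc u..<n})) (selection M)"
      using u block_of_ne by (simp add: avg_affine avg_potential)
    also have "insert (lab u) (lab ` {Suc u..<n}) = lab ` {u..<n}"
    proof -
      have "{u..<n} = insert u {Suc u..<n}" using u by auto
      then show ?thesis by (simp only: image_insert)
    qed
    also have "of_nat resample_cost + (2 + B + of_nat C * potential (lab ` {u..<n}) (selection M)) = of_nat (resample_cost + 2) + F u s"
      by (simp add: F_def s add.assoc)
    finally show "fst s 18 \<noteq> 0 \<and> ert (resample 10 ;; Add 10 10 7 ;; Sub 18 1 10) ?g s \<le> of_nat (resample_cost + 2) + F u s"
      using c u by (simp add: s)
  next
    fix s assume Js: "J n s"
    obtain R M where s: "s = (R, M)" by fastforce
    show "fst s 18 = 0 \<and> f s \<le> F n s" using Js f[of R M] by (auto simp: J_def s F_def valid_def)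
  next
    show "J 0 (R(10 := 0, 18 := n), M)" using registers_ok_cong[OF R, of "R(10 := 0, 18 := n)"] M by (simp add: J_def)
  qed simp
  have "lab ` {0..<n} = labels" by (simp add: labels_def atLeast0LessThan)
  moreover have "card labels \<le> n" unfolding labels_def using card_image_le[of "{..<n}" lab] by simp
  then have "potential labels \<sigma> \<le> of_nat n" for \<sigma> using potential_labels[of \<sigma>] by (meson of_nat_mono order_trans)
  ultimately have F0: "F 0 (R(10 := 0, 18 := n), M) \<le> B + of_nat C * of_nat n"
    by (simp add: F_def add_left_mono mult_left_mono)
  have "ert fill f (R, M) = 2 + ert (While 18 (resample 10 ;; Add 10 10 7 ;; Sub 18 1 10)) f (R(10 := 0, 18 := n), M)"
    using R by (simp add: fill_def registers_okD add.assoc[symmetric])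
  also have "\<dots> \<le> 2 + (of_nat ((n - 0) * ((resample_cost + 2) + 1) + 1) + (B + of_nat C * of_nat n))"
    by (intro add_left_mono order_trans[OF loop] F0)
  also have "\<dots> = of_nat (2 + ((n - 0) * ((resample_cost + 2) + 1) + 1)) + B + of_nat C * of_nat n"
    by (simp only: of_nat_add of_nat_numeral add.assoc)
  also have "2 + ((n - 0) * ((resample_cost + 2) + 1) + 1) = n * (resample_cost + 3) + 3" by (simp add: algebra_simps)
  finally show ?thesis .
qed

end

section \<open>Reading the input and writing the output\<close>

lemma ert_finite:
  assumes "ert c f s < \<top>"
  shows "lossless_spmf (run c s)" "\<And>s' t. (s', t) \<in> set_spmf (run c s) \<Longrightarrow> f s' \<noteq> \<top>"
    "(\<integral>\<^sup>+ x. of_nat (snd x) \<partial>measure_spmf (run c s)) \<le> ert c f s"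
proof -
  define g where "g x = (case x of None \<Rightarrow> \<top> | Some (s', t) \<Rightarrow> of_nat t + f s')" for x :: "(state \<times> nat) option"
  have "(\<integral>\<^sup>+ x. g x \<partial>measure_pmf (run c s)) \<noteq> \<infinity>"
    using assms by (simp add: ert_def g_def[abs_def])
  then have "AE x in measure_pmf (run c s). g x \<noteq> \<infinity>" by (intro nn_integral_PInf_AE) auto
  then have fin: "g x \<noteq> \<top>" if "x \<in> set_pmf (run c s)" for x using that by (auto simp: AE_measure_pmf_iff)
  show "lossless_spmf (run c s)" using fin[of None] by (auto simp: lossless_iff_set_pmf_None g_def)
  show "f s' \<noteq> \<top>" if "(s', t) \<in> set_spmf (run c s)" for s' t
    using fin[of "Some (s', t)"] that by (auto simp: in_set_spmf g_def)
  have "(\<integral>\<^sup>+ x. of_nat (snd x) \<partial>measure_spmf (run c s)) =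
     (\<integral>\<^sup>+ x. of_nat (snd (the x)) * indicator (range Some) x \<partial>measure_pmf (run c s))"
    by (simp add: nn_integral_measure_spmf_conv_measure_pmf nn_integral_restrict_space o_def)
  also have "\<dots> \<le> (\<integral>\<^sup>+ x. g x \<partial>measure_pmf (run c s))"
    by (intro nn_integral_mono) (auto simp: g_def split: option.split split_indicator)
  finally show "(\<integral>\<^sup>+ x. of_nat (snd x) \<partial>measure_spmf (run c s)) \<le> ert c f s"
    by (simp add: ert_def g_def[abs_def])
qed

context layout
begin

definition "reps v = filter (\<lambda>v. lab v = v) [0..<v]"
definition "chosen M v = map (\<lambda>l. M (SB + l)) (reps v)"

lemma length_reps: "length (reps v) \<le> v"
  unfolding reps_def by (rule order_trans[OF length_filter_le]) simp

lemma ert_emit: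
  assumes R: "registers_ok R" and M: "memory_ok M"
    and f: "\<And>R' M'. output_of (R', M') = chosen M n \<Longrightarrow> f (R', M') \<le> B"
  shows "ert emit f (R, M) \<le> of_nat (13 * n + 4) + B"
proof -
  define J where "J v s \<longleftrightarrow> (case s of (R', M') \<Rightarrow> registers_ok R' \<and> R' 10 = v \<and> R' 18 = n - v \<and> R' 0 = length (reps v) \<and>
     (\<forall>i<length (reps v). M' i = chosen M v ! i) \<and> (\<forall>a\<ge>n. M' a = M a))" for v and s :: state
  define p where "p = Add 28 2 10 ;; Load 28 28 ;; Sub 29 10 28 ;; Sub 28 28 10 ;; Add 29 29 28 ;;
   If 29 (Const 19 0) (Add 28 5 10 ;; Load 28 28 ;; Store 0 28 ;; Add 0 0 7) ;; Add 10 10 7 ;; Sub 18 1 10"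
  have loop: "ert (While 18 p) f (R(10 := 0, 0 := 0, 18 := n), M) \<le> of_nat ((n - 0) * (12 + 1) + 1) + B"
  proof (rule ert_for[where J = J and k = 0 and N = n and F = "\<lambda>_ _. B"])
    fix v s assume v: "v < n" and Js: "J v s"
    obtain R' M' where s: "s = (R', M')" by fastforce
    have eR: "registers_ok R'" and c: "R' 10 = v" "R' 18 = n - v" "R' 0 = length (reps v)"
      and out: "\<And>i. i < length (reps v) \<Longrightarrow> M' i = chosen M v ! i" and hi: "\<And>a. a \<ge> n \<Longrightarrow> M' a = M a"
      using Js by (auto simp: J_def s)
    have "n \<le> n * n" by (cases n) auto
    then have nAL: "n \<le> AL" by (simp only: AL_def trans_le_add2)
    have m1: "M' (AL + v) = lab v" using memory_okD(1)[OF M v] nAL by (subst hi) auto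
    have m2: "M' (SB + v) = M (SB + v)" using nAL by (subst hi) (auto simp: SB_def)
    define t where "t = v - lab v + (lab v - v)"
    have t: "t = 0 \<longleftrightarrow> lab v = v" by (auto simp: t_def)
    define R1 where "R1 = R'(28 := lab v - v, 29 := t)"
    define Q where "Q = If 29 (Const 19 0) (Add 28 5 10 ;; Load 28 28 ;; Store 0 28 ;; Add 0 0 7)"
    have head: "ert p G (R', M') = 5 + ert Q (ert (Add 10 10 7) (ert (Sub 18 1 10) G)) (R1, M')" for G
      using c eR m1 unfolding p_def Q_def[symmetric]
      by (simp add: registers_okD R1_def t_def add.assoc[symmetric] fun_upd_twist[of 29 28])
    show "fst s 18 \<noteq> 0 \<and> ert p (\<lambda>s'. if J (Suc v) s' then B else \<top>) s \<le> of_nat 12 + B"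
    proof (cases "lab v = v")
      case True
      define R2 where "R2 = R1(28 := M (SB + v), 0 := Suc (length (reps v)), 10 := Suc v, 18 := n - Suc v)"
      define M2 where "M2 = M'(length (reps v) := M (SB + v))"
      have "registers_ok R2" using eR by (simp add: registers_ok_def R2_def R1_def)
      then have "J (Suc v) (R2, M2)"
        using out hi True length_reps[of v] v
        by (auto simp: J_def R2_def M2_def reps_def chosen_def nth_append less_Suc_eq)
      moreover have "ert Q (ert (Add 10 10 7) (ert (Sub 18 1 10) G)) (R1, M') = 7 + G (R2, M2)" for G
        using True t eR c m2 by (simp add: Q_def R1_def R2_def M2_def registers_okD add.assoc[symmetric] fun_upd_twist[of 29 28])
      ultimately show ?thesis using c v by (simp add: s head add.assoc[symmetric])
    next
      case False
      define R2 where "R2 = R1(19 := 0, 10 := Suc v, 18 := n - Suc v)"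
      have "registers_ok R2" using eR by (simp add: registers_ok_def R2_def R1_def)
      then have "J (Suc v) (R2, M')"
        using out hi False c by (auto simp: J_def R2_def R1_def reps_def chosen_def)
      moreover have "ert Q (ert (Add 10 10 7) (ert (Sub 18 1 10) G)) (R1, M') = 4 + G (R2, M')" for G
        using False t eR c by (simp add: Q_def R1_def R2_def registers_okD add.assoc[symmetric])
      moreover have "9 + B \<le> 12 + B" by (intro add_right_mono) simp
      ultimately show ?thesis using c v by (simp add: s head add.assoc[symmetric])
    qed
  next
    fix s assume Js: "J n s"
    obtain R' M' where s: "s = (R', M')" by fastforce
    have j: "R' 0 = length (reps n)" "\<forall>i<length (reps n). M' i = chosen M n ! i" "R' 18 = 0"
      using Js by (simp_all add: J_def s)
    moreover have "length (chosen M n) = length (reps n)" by (simp add: chosen_def)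
    ultimately have "output_of (R', M') = chosen M n"
      unfolding output_of_def by (intro nth_equalityI) simp_all
    then show "fst s 18 = 0 \<and> f s \<le> B" using j f by (simp add: s)
  next
    have "registers_ok (R(10 := 0, 0 := 0, 18 := n))" using R by (simp add: registers_ok_def)
    then show "J 0 (R(10 := 0, 0 := 0, 18 := n), M)" by (simp add: J_def reps_def)
  qed simp
  have "ert emit f (R, M) = 3 + ert (While 18 p) f (R(10 := 0, 0 := 0, 18 := n), M)"
    using R by (simp add: emit_def p_def registers_okD add.assoc[symmetric])
  also have "\<dots> \<le> 3 + (of_nat ((n - 0) * (12 + 1) + 1) + B)" by (rule add_left_mono[OF loop])
  also have "\<dots> = of_nat (3 + ((n - 0) * (12 + 1) + 1)) + B" by (simp only: of_nat_add of_nat_numeral add.assoc)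
  also have "3 + ((n - 0) * (12 + 1) + 1) = 13 * n + 4" by simp
  finally show ?thesis .
qed

lemma ert_prepare:
  assumes R: "R 0 = SB" "R 8 = 0" and M: "M 1 = n" and AG: "AG \<ge> 2" and sum: "(\<Sum>i\<in>{2..<AG}. M i) = 2 * r"
    and f: "\<And>R'. registers_ok R' \<Longrightarrow> f (R', M) \<le> B"
  shows "ert prepare f (R, M) \<le> of_nat (3 * n + 5 * AG + 12) + B"
proof -
  define R0 where "R0 = R(7 := 1, 1 := n, 2 := AL, 5 := SB, 6 := ZB, 3 := AL, 26 := n)"
  define base where "base R' \<longleftrightarrow> R' 1 = n \<and> R' 2 = AL \<and> R' 5 = SB \<and> R' 6 = ZB \<and> R' 7 = 1 \<and> R' 8 = 0" for R' :: "nat \<Rightarrow> nat"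
  define p where "p = Load 28 26 ;; Add 4 4 28 ;; Add 26 26 7 ;; Sub 27 3 26"
  define J1 where "J1 k s \<longleftrightarrow> (case s of (R', M') \<Rightarrow> M' = M \<and> base R' \<and> R' 3 = AL - k * n \<and> R' 26 = n - k)" for k and s :: state
  define J2 where "J2 k s \<longleftrightarrow> (case s of (R', M') \<Rightarrow> M' = M \<and> base R' \<and> R' 3 = AG \<and> R' 4 = (\<Sum>i\<in>{2..<2 + k}. M i) \<and> R' 26 = 2 + k \<and> R' 27 = AG - (2 + k))" for k and s :: state
  have second: "ert (While 27 p) f (R', M) \<le> of_nat ((AG - 2 - 0) * (4 + 1) + 1) + B"
    if "base R'" "R' 3 = AG" "R' 4 = 0" "R' 26 = 2" "R' 27 = AG - 2" for R'
  proof (rule ert_for[where J = J2 and N = "AG - 2" and k = 0 and F = "\<lambda>_ _. B"])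
    fix k s assume "k < AG - 2" "J2 k s"
    then show "fst s 27 \<noteq> 0 \<and> ert p (\<lambda>s'. if J2 (Suc k) s' then B else \<top>) s \<le> of_nat 4 + B"
      by (cases s) (simp add: J2_def p_def base_def add.assoc[symmetric])
  next
    fix s assume J: "J2 (AG - 2) s"
    obtain R' M' where s: "s = (R', M')" by fastforce
    have e: "2 + (AG - 2) = AG" using AG by simp
    have "M' = M" "registers_ok R'" "R' 27 = 0" using J sum unfolding J2_def e by (simp_all add: s base_def registers_ok_def)
    then show "fst s 27 = 0 \<and> f s \<le> B" using f by (simp add: s)
  qed (use that in \<open>auto simp: J2_def\<close>)
  define rest where "rest = ert (Const 4 0) (ert (Const 26 2) (ert (Sub 27 3 26) (ert (While 27 p) f)))"
  have rest: "rest (R', M) \<le> of_nat (3 + ((AG - 2 - 0) * (4 + 1) + 1)) + B" if "base R'" "R' 3 = AG" for R'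
  proof -
    have "rest (R', M) = 3 + ert (While 27 p) f (R'(4 := 0, 26 := 2, 27 := AG - 2), M)"
      using that by (simp add: rest_def add.assoc[symmetric])
    also have "\<dots> \<le> 3 + (of_nat ((AG - 2 - 0) * (4 + 1) + 1) + B)"
      using that by (intro add_left_mono second) (auto simp: base_def)
    also have "\<dots> = of_nat (3 + ((AG - 2 - 0) * (4 + 1) + 1)) + B" by (simp only: of_nat_add of_nat_numeral add.assoc)
    finally show ?thesis .
  qed
  define T where "T = 3 + ((AG - 2 - 0) * (4 + 1) + 1)"
  have first: "ert (While 26 (Sub 3 3 1 ;; Sub 26 26 7)) rest (R0, M) \<le> of_nat ((n - 0) * (2 + 1) + 1) + (of_nat T + B)"
  proof (rule ert_for[where J = J1 and N = n and k = 0 and F = "\<lambda>_ _. of_nat T + B"])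
    fix k s assume k: "k < n" and J: "J1 k s"
    obtain R' M' where s: "s = (R', M')" by fastforce
    define s1 where "s1 = (R'(3 := AL - Suc k * n, 26 := n - Suc k), M)"
    have "AL - k * n - n = AL - Suc k * n" "n - k - 1 = n - Suc k" by simp_all
    then have run1: "ert (Sub 3 3 1 ;; Sub 26 26 7) G s = 2 + G s1" for G
      using J by (simp add: J1_def s s1_def base_def add.assoc[symmetric] del: mult_Suc diff_diff_left)
    have J1: "J1 (Suc k) s1"
      using J by (simp add: J1_def s s1_def base_def del: mult_Suc)
    show "fst s 26 \<noteq> 0 \<and> ert (Sub 3 3 1 ;; Sub 26 26 7) (\<lambda>s'. if J1 (Suc k) s' then of_nat T + B else \<top>) s \<le> of_nat 2 + (of_nat T + B)"
      unfolding run1 if_P[OF J1] using J k by (simp add: J1_def s)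
  next
    fix s assume J: "J1 n s"
    obtain R' M' where s: "s = (R', M')" by fastforce
    have r: "M' = M" "base R'" "R' 3 = AG" "R' 26 = 0" using J by (simp_all add: J1_def s AL_def)
    then show "fst s 26 = 0 \<and> rest s \<le> of_nat T + B"
      using rest[OF r(2,3)] by (simp only: s T_def fst_conv simp_thms)
  next
    show "J1 0 (R0, M)" using R by (simp add: J1_def R0_def base_def)
  qed simp
  have "ert prepare f (R, M) = 7 + ert (While 26 (Sub 3 3 1 ;; Sub 26 26 7)) rest (R0, M)"
    using R M by (simp add: prepare_def p_def[symmetric] rest_def R0_def SB_def ZB_def add.assoc[symmetric])
  also have "\<dots> \<le> 7 + (of_nat ((n - 0) * (2 + 1) + 1) + (of_nat T + B))"
    by (rule add_left_mono[OF first])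
  also have "\<dots> = of_nat (7 + ((n - 0) * (2 + 1) + 1) + T) + B"
    by (simp only: of_nat_add of_nat_numeral add.assoc)
  also have "\<dots> \<le> of_nat (3 * n + 5 * AG + 12) + B"
    by (intro add_right_mono of_nat_mono) (simp add: T_def)
  finally show ?thesis .
qed

end

context machine
begin

definition "time_bound = (3 * n + 5 * AG + 12) + (n * (resample_cost + 3) + 3) + (n * step_cost + 3) + (13 * n + 4) + round_cost * n"

lemma ert_solve:
  assumes R: "R 0 = SB" "R 8 = 0" and M: "M 1 = n" "memory_ok M" and AG: "AG \<ge> 2" and sum: "(\<Sum>i\<in>{2..<AG}. M i) = 2 * r"
    and f: "\<And>R' M'' M'. solved M' \<Longrightarrow> output_of (R', M'') = chosen M' n \<Longrightarrow> f (R', M'') \<le> 0"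
  shows "ert solve f (R, M) \<le> of_nat time_bound"
proof -
  have "ert prepare (ert fill (ert search (ert emit f))) (R, M) \<le> of_nat (3 * n + 5 * AG + 12) +
     (of_nat (n * (resample_cost + 3) + 3) + (of_nat (n * step_cost + 3) + (of_nat (13 * n + 4) + 0)) + of_nat round_cost * of_nat n)"
  proof (rule ert_prepare[OF R M(1) AG sum])
    fix R1 assume R1: "registers_ok R1"
    show "ert fill (ert search (ert emit f)) (R1, M) \<le> of_nat (n * (resample_cost + 3) + 3) + (of_nat (n * step_cost + 3) + (of_nat (13 * n + 4) + 0)) + of_nat round_cost * of_nat n"
    proof (rule ert_fill[OF R1 M(2)])
      fix R2 M2 assume 2: "registers_ok R2" "memory_ok M2" "valid (selection M2)"
      show "ert search (ert emit f) (R2, M2) \<le> of_nat (n * step_cost + 3) + (of_nat (13 * n + 4) + 0) + of_nat round_cost * potential {} (selection M2)"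
      proof (rule ert_search[OF 2])
        fix R3 M3 assume 3: "registers_ok R3" "memory_ok M3" "solved M3"
        show "ert emit f (R3, M3) \<le> of_nat (13 * n + 4) + 0"
          by (rule ert_emit[OF 3(1,2)]) (rule f[OF 3(3)])
      qed
    qed
  qed
  also have "\<dots> = of_nat time_bound" unfolding time_bound_def by (simp only: of_nat_add of_nat_mult add.assoc add_0_right of_nat_0)
  finally show ?thesis by (simp add: solve_def)
qed

text \<open>
  A star with \<open>r\<close> edges gives its centre \<open>r\<close> chosen neighbours. In a triangle, \<open>r = 3\<close>, and a vertex without a third chosen
  neighbour has exactly the other two, which are adjacent.
\<close>

lemma solved_good:
  assumes sol: "solved M"
    and C: "C \<subseteq> E" "card C = r" "\<And>e l. e \<in> C \<Longrightarrow> l \<in> lab ` e \<Longrightarrow> selection M l \<in> e" "\<And>e f. e \<in> C \<Longrightarrow> f \<in> C \<Longrightarrow> e \<inter> f \<noteq> {}"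
  shows False
proof -
  have val: "valid (selection M)" and ok: "\<And>u. u < n \<Longrightarrow> ok M u" using sol by (auto simp: solved_def)
  have finC: "finite C" using C(1) finite_E finite_subset by blast
  have lt: "v < n" if "e \<in> C" "v \<in> e" for e v using E_sub[of e] that C(1) by auto
  have sel: "sel M v" if "e \<in> C" "v \<in> e" for e v
  proof -
    have "selection M (lab v) \<in> e" using C(3) that by blast
    moreover have "lab (selection M (lab v)) = lab v" using val lt[OF that] by (simp add: valid_def)
    moreover have "inj_on lab e" using E_inj that C(1) by blast
    ultimately have "selection M (lab v) = v" using that by (auto simp: inj_on_def)
    then show ?thesis by (simp add: sel_def selection_def)
  qed
  have adjC: "adj u v" if "{u, v} \<in> C" for u v
  proof -
    have "{u, v} \<in> E" using that C(1) by blast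
    then obtain u' v' where "{u, v} = {u', v'}" "adj u' v'" unfolding E_eq by blast
    then show ?thesis using adj_sym by (metis doubleton_eq_iff)
  qed
  have nb: "x \<in> nbrs M u" if "{u, x} \<in> C" for u x
    using lt[OF that] sel[OF that] adjC[OF that] adj_sym by (auto simp: nbrs_def)
  have card2: "card e = 2" if "e \<in> C" for e using E_card that C(1) by auto
  have ne: "C \<noteq> {}" using C(2) r_pos by auto
  have "(\<exists>u. \<forall>e\<in>C. u \<in> e) \<or> (\<exists>u p q. u \<noteq> p \<and> u \<noteq> q \<and> p \<noteq> q \<and> C = {{u, p}, {u, q}, {p, q}})"
    using card2 C(4) ne by (rule intersecting_star_or_triangle)
  then show False
  proof (elim disjE exE conjE)
    fix u assume u: "\<forall>e\<in>C. u \<in> e"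
    have "C \<subseteq> (\<lambda>x. {u, x}) ` nbrs M u"
    proof
      fix e assume e: "e \<in> C"
      obtain a b where ab: "e = {a, b}" using card2[OF e] by (auto simp: card_2_iff)
      then have "u = a \<or> u = b" using u e by auto
      then obtain x where "e = {u, x}" using ab by (metis insert_commute)
      then show "e \<in> (\<lambda>x. {u, x}) ` nbrs M u" using nb e by auto
    qed
    then have "card C \<le> card ((\<lambda>x. {u, x}) ` nbrs M u)" by (intro card_mono) auto
    also have "\<dots> \<le> card (nbrs M u)" by (rule card_image_le) simp
    finally have "r \<le> card (nbrs M u)" using C(2) by simp
    moreover obtain e where "e \<in> C" using ne by blast
    then have "u < n" using lt u by blast
    ultimately show False using ok[of u] by (simp add: ok_def)
  next
    fix u p q assume d: "u \<noteq> p" "u \<noteq> q" "p \<noteq> q" and Ceq: "C = {{u, p}, {u, q}, {p, q}}"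
    have r3: "r = 3" using C(2) d by (simp add: Ceq doubleton_eq_iff)
    have "{p, q} \<subseteq> nbrs M u" using nb by (auto simp: Ceq)
    have "u < n" using lt[of "{u, p}" u] by (simp add: Ceq)
    then have okU: "ok M u" by (rule ok)
    then have "card (nbrs M u) < r" by (simp add: ok_def)
    then have "card (nbrs M u) \<le> 2" using r3 by linarith
    then have N: "{p, q} = nbrs M u" using \<open>{p, q} \<subseteq> nbrs M u\<close> d by (intro card_seteq) auto
    have "adj p q" using adjC by (simp add: Ceq)
    then have "\<forall>x\<in>nbrs M u. \<forall>y\<in>nbrs M u. x \<noteq> y \<longrightarrow> adj x y" using adj_sym by (auto simp: N[symmetric])
    moreover have "card (nbrs M u) = 2" using d by (simp add: N[symmetric])
    ultimately show False using okU r3 unfolding ok_def by blast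
  qed
qed

lemma chosen_props:
  assumes "solved M"
  shows "distinct (chosen M n)" "set (chosen M n) = selection M ` lab ` {..<n}"
proof -
  have val: "valid (selection M)" using assms by (simp add: solved_def)
  have reps: "set (reps n) = lab ` {..<n}"
  proof
    show "set (reps n) \<subseteq> lab ` {..<n}"
    proof
      fix v assume "v \<in> set (reps n)"
      then have "v = lab v" "v \<in> {..<n}" by (simp_all add: reps_def)
      then show "v \<in> lab ` {..<n}" by (rule image_eqI)
    qed
    show "lab ` {..<n} \<subseteq> set (reps n)" by (auto simp: reps_def lab_lt lab_idem)
  qed
  show "set (chosen M n) = selection M ` lab ` {..<n}" by (simp add: chosen_def reps selection_def[abs_def])
  have "inj_on (\<lambda>l. M (SB + l)) (set (reps n))"
  proof (rule inj_onI)
    fix l m assume "l \<in> set (reps n)" "m \<in> set (reps n)" and eq: "M (SB + l) = M (SB + m)"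
    then have lm: "l < n" "lab l = l" "m < n" "lab m = m" by (auto simp: reps_def)
    have l: "lab (M (SB + l)) = l" using val lm(1,2) unfolding valid_def selection_def by metis
    have m: "lab (M (SB + m)) = m" using val lm(3,4) unfolding valid_def selection_def by metis
    show "l = m" using m unfolding eq[symmetric] l .
  qed
  then show "distinct (chosen M n)" by (simp add: chosen_def distinct_map reps_def)
qed

end

section \<open>Encoded instances\<close>

lemma length_rows: "length (concat (map (\<lambda>u. map (f u) [0..<n]) [0..<m])) = m * n"
  by (induction m) auto

lemma nth_rows: "u < m \<Longrightarrow> v < n \<Longrightarrow> concat (map (\<lambda>u. map (f u) [0..<n]) [0..<m]) ! (u * n + v) = f u v"
proof (induction m)
  case (Suc m)
  show ?case
  proof (cases "u = m")
    case True
    then show ?thesis using Suc.prems length_rows[of f n m] by (simp add: nth_append)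
  next
    case False
    then have u: "u < m" using Suc.prems by simp
    then have "Suc u * n \<le> m * n" by (intro mult_right_mono) auto
    then have "u * n + v < m * n" using Suc.prems by simp
    then show ?thesis using Suc.IH[OF u Suc.prems(2)] length_rows[of f n m] by (simp add: nth_append)
  qed
qed simp

lemma sum_list_rows: "sum_list (concat (map (\<lambda>u. map (f u) [0..<n]) [0..<m])) = (\<Sum>u<m. \<Sum>v<n. (f u v :: nat))"
proof (induction m)
  case (Suc m)
  have "sum_list (map (f m) [0..<n]) = (\<Sum>v<n. f m v)"
    by (simp add: interv_sum_list_conv_sum_set_nat atLeast0LessThan)
  then show ?case using Suc by simp
qed simp

text \<open>
  Every edge comes from two ordered pairs of vertices.
\<close>

lemma handshake:
  assumes "ugraph H" "numbered H"
  shows "(\<Sum>u<card (verts H). \<Sum>v<card (verts H). of_bool ({u, v} \<in> edges H)) = 2 * card (edges H)"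
proof -
  have V: "verts H = {..<card (verts H)}" using assms(2) by (simp add: numbered_def atLeast0LessThan)
  have e: "\<And>e. e \<in> edges H \<Longrightarrow> e \<subseteq> verts H \<and> card e = 2" and finV: "finite (verts H)"
    using assms(1) by (auto simp: ugraph_def)
  have finE: "finite (edges H)" using e finV by (meson Pow_iff finite_Pow_iff finite_subset subsetI)
  define A where "A d = {(u, v). {u, v} = d}" for d :: "nat set"
  have A: "card (A d) = 2 \<and> finite (A d)" if d: "d \<in> edges H" for d
  proof -
    obtain a b where ab: "d = {a, b}" "a \<noteq> b" using e[OF d] by (auto simp: card_2_iff)
    have "A d = {(a, b), (b, a)}" unfolding A_def ab(1) by (auto simp: doubleton_eq_iff)
    then show ?thesis using ab(2) by simp
  qed
  have "(\<Sum>u<card (verts H). \<Sum>v<card (verts H). of_bool ({u, v} \<in> edges H)) =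
     (\<Sum>p\<in>verts H \<times> verts H. of_bool ({fst p, snd p} \<in> edges H))"
    by (simp only: sum.cartesian_product V[symmetric] case_prod_unfold)
  also have "\<dots> = card ((verts H \<times> verts H) \<inter> {p. {fst p, snd p} \<in> edges H})"
    using finV by (simp add: sum_of_bool_eq)
  also have "(verts H \<times> verts H) \<inter> {p. {fst p, snd p} \<in> edges H} = (\<Union>d\<in>edges H. A d)"
    using e by (fastforce simp: A_def)
  also have "card \<dots> = (\<Sum>d\<in>edges H. card (A d))"
    using finE A by (intro card_UN_disjoint) (auto simp: A_def)
  also have "\<dots> = 2 * card (edges H)" using A by simp
  finally show ?thesis .
qed

definition label_of :: "nat set set \<Rightarrow> nat \<Rightarrow> nat" where
  "label_of P v = (LEAST u. \<exists>B\<in>P. u \<in> B \<and> v \<in> B)"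

lemma label_of:
  assumes "partition_on A P" "B \<in> P" "v \<in> B"
  shows "label_of P v = (LEAST u. u \<in> B)" "label_of P v \<in> B"
proof -
  have "B' = B" if "B' \<in> P" "v \<in> B'" for B'
    using assms that unfolding partition_on_def disjoint_def by blast
  then have "(\<exists>B'\<in>P. u \<in> B' \<and> v \<in> B') \<longleftrightarrow> u \<in> B" for u using assms by blast
  then show eq: "label_of P v = (LEAST u. u \<in> B)" by (simp add: label_of_def)
  show "label_of P v \<in> B" unfolding eq using assms(3) by (rule LeastI)
qed

lemma labels_blocks_label_of:
  assumes "partition_on A P" shows "labels_blocks (label_of P) P"
  unfolding labels_blocks_def
proof (intro ballI subset_antisym subsetI)
  fix B v w assume B: "B \<in> P" "v \<in> B" and w: "w \<in> {w \<in> \<Union>P. label_of P w = label_of P v}"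
  then obtain B' where B': "B' \<in> P" "w \<in> B'" by blast
  have "label_of P w \<in> B'" "label_of P v \<in> B" using label_of(2)[OF assms B'] label_of(2)[OF assms B] .
  then have "B \<inter> B' \<noteq> {}" using w by auto
  then have "B' = B" using assms B B' unfolding partition_on_def disjoint_def by blast
  then show "w \<in> B" using B' by simp
next
  fix B v w assume B: "B \<in> P" "v \<in> B" and w: "w \<in> B"
  have "label_of P w = label_of P v" using label_of(1)[OF assms B(1)] B(2) w by metis
  then show "w \<in> {w \<in> \<Union>P. label_of P w = label_of P v}" using B w by blast
qed

text \<open>
  Polymorphic, so that the same expression is a polynomial and its value at a number.
\<close>

definition cost_poly :: "'a::comm_semiring_1 \<Rightarrow> 'a" where
  "cost_poly x = (let s = 10 + 2 * x * (6 * x + 8); q = 11 * x + 7 + s; p = s + 2 * q + 7; c = 25 * x + 38; d = 25 * x + 37 + p + x * c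
     in (3 * x + 5 * x + 12) + (x * (q + 3) + 3) + (x * c + 3) + (13 * x + 4) + d * x)"

lemma cost_poly_eval: "poly (cost_poly [:0, 1:]) (l :: nat) = cost_poly l"
  by (simp add: cost_poly_def Let_def algebra_simps)

lemma sample_cost_le: "sample_cost n \<le> 10 + 2 * n * (6 * n + 8)"
proof (cases "n = 0")
  case True
  then have "bits n = 0" using bits(3)[of n] by simp
  then show ?thesis using True by (simp add: sample_cost_def)
next
  case False
  have "2 ^ bits n * (6 * bits n + 8) \<le> 2 * n * (6 * n + 8)"
    using bits(3,4)[of n] False by (intro mult_mono) auto
  then show ?thesis by (simp add: sample_cost_def)
qed

lemma (in machine) time_bound_le:
  assumes "n \<le> l" "AG \<le> l" shows "time_bound \<le> cost_poly l"
proof -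
  have s: "sample_cost n \<le> 10 + 2 * l * (6 * l + 8)"
    using assms by (intro order_trans[OF sample_cost_le] add_mono mult_mono) auto
  then have q: "resample_cost \<le> 11 * l + 7 + (10 + 2 * l * (6 * l + 8))" (is "_ \<le> ?q")
    unfolding resample_cost_def using assms by (intro add_mono mult_mono) auto
  have p: "repair_cost \<le> (10 + 2 * l * (6 * l + 8)) + 2 * ?q + 7"
    unfolding repair_cost_def using s q by (intro add_mono mult_mono) auto
  have c: "step_cost \<le> 25 * l + 38" unfolding step_cost_def using assms by (intro add_mono mult_mono) auto
  have d: "round_cost \<le> 25 * l + 37 + ((10 + 2 * l * (6 * l + 8)) + 2 * ?q + 7) + l * (25 * l + 38)"
    unfolding round_cost_def using assms p c by (intro add_mono mult_mono) auto
  show ?thesis unfolding time_bound_def cost_poly_def Let_def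
    using assms s q p c d by (intro add_mono mult_mono) auto
qed

lemma encoded_instance:
  assumes bs: "block_setting H r G P b d" and bd: "b \<ge> 4 * d / real r" and num: "numbered H" "numbered G"
  defines "n \<equiv> card (verts G)" and "AG \<equiv> 2 + card (verts H) * card (verts H)"
    and "adj \<equiv> \<lambda>u v. {u, v} \<in> edges G" and "lab \<equiv> label_of P"
    and "E \<equiv> cross (label_of P) G"
  shows "machine n r adj lab E"
    and "fst (input_state (encode (H, G, P))) 0 = layout.SB n AG"
    and "snd (input_state (encode (H, G, P))) 1 = n"
    and "layout.memory_ok n AG adj lab (snd (input_state (encode (H, G, P))))"
    and "(\<Sum>i\<in>{2..<AG}. snd (input_state (encode (H, G, P))) i) = 2 * r"
    and "n \<le> length (encode (H, G, P))" and "AG \<le> length (encode (H, G, P))"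
proof -
  have P: "partition_on (verts G) P" and uH: "ugraph H" and uG: "ugraph G" and r: "r = card (edges H)"
    using bs by (auto simp: block_setting_def)
  have VG: "verts G = {..<n}" using num by (simp add: numbered_def n_def atLeast0LessThan)
  have lb: "labels_blocks (label_of P) P" by (rule labels_blocks_label_of[OF P])
  have lab: "lab v < n \<and> lab (lab v) = lab v" if v: "v < n" for v
  proof -
    have UP: "\<Union>P = {..<n}" using P VG by (simp add: partition_on_def)
    then have "v \<in> \<Union>P" using v by simp
    then obtain B where B: "B \<in> P" "v \<in> B" by blast
    have "lab v \<in> B" using label_of(2)[OF P B] by (simp add: lab_def)
    moreover have "lab (lab v) = lab v"
      using label_of(1)[OF P B(1)] B(2) calculation by (simp add: lab_def)
    ultimately show ?thesis using UP B(1) by blast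
  qed
  have bl: "blocks {..<n} lab E r"
    using blocks_of_setting[OF bs bd lb] by (simp add: VG lab_def E_def)
  have edge: "e \<subseteq> {..<n}" "card e = 2" if "e \<in> edges G" for e using uG that VG by (auto simp: ugraph_def)
  have Eeq: "E = {{u, v} |u v. u < n \<and> v < n \<and> adj u v \<and> lab u \<noteq> lab v}"
  proof (intro subset_antisym subsetI)
    fix e assume e: "e \<in> E"
    then have "e \<in> edges G" and inj: "inj_on lab e" by (auto simp: E_def cross_def lab_def)
    then obtain u v where uv: "e = {u, v}" "u \<noteq> v" using edge(2) by (metis card_2_iff)
    have "lab u \<noteq> lab v" using inj uv by (auto simp: inj_on_def)
    moreover have "u < n" "v < n" using edge(1)[OF \<open>e \<in> edges G\<close>] uv by auto
    ultimately show "e \<in> {{u, v} |u v. u < n \<and> v < n \<and> adj u v \<and> lab u \<noteq> lab v}"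
      using uv \<open>e \<in> edges G\<close> unfolding adj_def by blast
  next
    fix e assume "e \<in> {{u, v} |u v. u < n \<and> v < n \<and> adj u v \<and> lab u \<noteq> lab v}"
    then obtain u v where "e = {u, v}" "{u, v} \<in> edges G" "lab u \<noteq> lab v" unfolding adj_def by blast
    then show "e \<in> E" by (auto simp: E_def cross_def lab_def)
  qed
  have lay: "layout n lab" using lab by unfold_locales auto
  have adjl: "adjacency_layout n adj lab"
  proof (intro adjacency_layout.intro lay adjacency_layout_axioms.intro)
    show "adj u v = adj v u" for u v by (simp add: adj_def insert_commute)
    show "\<not> adj u u" for u using edge(2)[of "{u}"] by (auto simp: adj_def)
  qed
  show "machine n r adj lab E"
    by (intro machine.intro machine_axioms.intro adjl bl Eeq)
  define k where "k = card (verts H)"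
  define fH where "fH u v = (of_bool ({u, v} \<in> edges H) :: nat)" for u v
  define fG where "fG u v = (of_bool ({u, v} \<in> edges G) :: nat)" for u v
  define w where "w = encode (H, G, P)"
  have aH: "adjacency H = concat (map (\<lambda>u. map (fH u) [0..<k]) [0..<k])"
    by (simp add: adjacency_def fH_def[abs_def] k_def)
  have aG: "adjacency G = concat (map (\<lambda>u. map (fG u) [0..<n]) [0..<n])"
    by (simp add: adjacency_def fG_def[abs_def] n_def)
  have lH: "length (adjacency H) = k * k" unfolding aH by (rule length_rows)
  have lG: "length (adjacency G) = n * n" unfolding aG by (rule length_rows)
  have bl': "block_labels G P = map lab [0..<n]" by (simp add: block_labels_def n_def lab_def label_of_def[abs_def])
  have w: "w = [k, n] @ adjacency H @ adjacency G @ map lab [0..<n]"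
    by (simp add: w_def encode_def bl' k_def n_def)
  have len: "length w = AG + n * n + n" by (simp add: w lH lG AG_def k_def)
  have AG: "AG = 2 + k * k" by (simp add: AG_def k_def)
  note lay_defs = layout.SB_def[OF lay] layout.AL_def[OF lay] layout.ZB_def[OF lay]
  show "fst (input_state (encode (H, G, P))) 0 = layout.SB n AG"
    by (simp add: input_state_def w_def[symmetric] len lay_defs)
  show "snd (input_state (encode (H, G, P))) 1 = n"
    by (simp add: input_state_def w_def[symmetric]) (simp add: w)
  show "n \<le> length (encode (H, G, P))" "AG \<le> length (encode (H, G, P))"
    by (simp_all add: w_def[symmetric] len)
  define M where "M = snd (input_state w)"
  have M: "M i = (if i < length w then w ! i else 0)" for i by (simp add: M_def input_state_def)
  have "layout.memory_ok n AG adj lab M"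
    unfolding layout.memory_ok_def[OF lay]
  proof (intro conjI allI impI)
    fix v assume v: "v < n"
    have "w ! (AG + n * n + v) = lab v"
      using v by (simp add: w nth_append lH lG AG)
    then show "M (layout.AL n AG + v) = lab v" using v by (simp add: M len lay_defs)
  next
    fix u v assume uv: "u < n" "v < n"
    have "Suc v * n \<le> n * n" using uv by (intro mult_right_mono) auto
    then have lt: "v * n + u < n * n" using uv by simp
    have "w ! (AG + (v * n + u)) = adjacency G ! (v * n + u)"
      using lt by (simp add: w nth_append lH lG AG)
    also have "\<dots> = fG v u" unfolding aG using uv by (intro nth_rows)
    finally show "M (AG + v * n + u) = of_bool (adj v u)"
      using lt by (simp add: M len fG_def adj_def add.assoc)
  next
    fix a assume "layout.ZB n AG + n \<le> a"
    then show "M a = 0" by (simp add: M len lay_defs)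
  qed
  then show "layout.memory_ok n AG adj lab (snd (input_state (encode (H, G, P))))" by (simp add: M_def w_def)
  have "(\<Sum>i\<in>{2..<AG}. M i) = (\<Sum>i<k * k. adjacency H ! i)"
  proof -
    have "(\<Sum>i\<in>{2..<AG}. M i) = (\<Sum>i\<in>{0 + 2..<k * k + 2}. M i)" by (simp only: AG add_0 add.commute[of 2 "k * k"])
    also have "\<dots> = (\<Sum>i\<in>{0..<k * k}. M (i + 2))" by (rule sum.shift_bounds_nat_ivl)
    also have "\<dots> = (\<Sum>i\<in>{0..<k * k}. adjacency H ! i)"
      by (intro sum.cong refl) (auto simp: M len AG, auto simp: w nth_append lH)
    finally show ?thesis by (simp add: atLeast0LessThan)
  qed
  also have "\<dots> = sum_list (adjacency H)" by (simp add: sum_list_sum_nth lH atLeast0LessThan)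
  also have "\<dots> = (\<Sum>u<k. \<Sum>v<k. fH u v)" unfolding aH by (rule sum_list_rows)
  also have "\<dots> = 2 * r" using handshake[OF uH num(1)] by (simp add: fH_def k_def r)
  finally show "(\<Sum>i\<in>{2..<AG}. snd (input_state (encode (H, G, P))) i) = 2 * r"
    by (simp add: M_def w_def)
qed

theorem theorem6p3:
  shows "(\<forall>(H :: 'h graph) r (G :: 'a graph) P b d.
            block_setting H r G P b d \<and> b \<ge> 4 * d / real r \<longrightarrow>
            (\<exists>A. transversal P A \<and> avoids G A H))
       \<and> randomized_poly_time encode
           {(H, G, P). numbered H \<and> numbered G \<and>
              (\<exists>r b d. block_setting H r G P b d \<and> b \<ge> 4 * d / real r)}
           (\<lambda>(H, G, P) ys. distinct ys \<and> transversal P (set ys) \<and> avoids G (set ys) H)"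
proof
  show "\<forall>(H :: 'h graph) r (G :: 'a graph) P b d.
            block_setting H r G P b d \<and> b \<ge> 4 * d / real r \<longrightarrow>
            (\<exists>A. transversal P A \<and> avoids G A H)"
    using ex_avoiding_transversal by blast
  have main: "lossless_spmf (run solve (input_state (encode (H, G, P)))) \<and>
      (\<forall>(s, t)\<in>set_spmf (run solve (input_state (encode (H, G, P)))).
         distinct (output_of s) \<and> transversal P (set (output_of s)) \<and> avoids G (set (output_of s)) H) \<and>
      expected_time solve (encode (H, G, P)) \<le> of_nat (poly (cost_poly [:0, 1:]) (length (encode (H, G, P))))"
    if num: "numbered H" "numbered G" and bs: "block_setting H r G P b d" and bd: "b \<ge> 4 * d / real r"
    for H G :: "nat graph" and P r b d
  proof -
    define n where "n = card (verts G)"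
    define AG where "AG = 2 + card (verts H) * card (verts H)"
    note inst = encoded_instance[OF bs bd num, folded n_def AG_def]
    interpret machine n AG r "\<lambda>u v. {u, v} \<in> edges G" "label_of P" "cross (label_of P) G"
      by (rule inst(1))
    define s0 where "s0 = input_state (encode (H, G, P))"
    define f where "f s = (if distinct (output_of s) \<and> transversal P (set (output_of s)) \<and> avoids G (set (output_of s)) H
      then 0 else \<top> :: ennreal)" for s
    have VG: "verts G = {..<n}" using num by (simp add: numbered_def n_def atLeast0LessThan)
    have lb: "labels_blocks (label_of P) P"
      using bs by (intro labels_blocks_label_of[of "verts G"]) (simp add: block_setting_def)
    have "ert solve f (fst s0, snd s0) \<le> of_nat time_bound"
    proof (rule ert_solve)
      show "fst s0 0 = SB" "snd s0 1 = n" "memory_ok (snd s0)" "(\<Sum>i\<in>{2..<AG}. snd s0 i) = 2 * r"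
        using inst(2-5) by (simp_all add: s0_def)
      show "fst s0 8 = 0" by (simp add: s0_def input_state_def)
      show "2 \<le> AG" by (simp add: AG_def)
      fix R' M'' M' assume sol: "solved M'" and out: "output_of (R', M'') = chosen M' n"
      have \<sigma>: "selection M' l \<in> verts G \<and> label_of P (selection M' l) = l" if "l \<in> label_of P ` verts G" for l
        using sol that by (auto simp: solved_def valid_def VG)
      have "transversal P (selection M' ` label_of P ` verts G)" "avoids G (selection M' ` label_of P ` verts G) H"
        using good_state_transversal[OF bs lb \<sigma>] solved_good[OF sol] by metis+
      then show "f (R', M'') \<le> 0"
        using chosen_props[OF sol] unfolding f_def out VG by simp
    qed
    also have "\<dots> \<le> of_nat (cost_poly (length (encode (H, G, P))))"
      using time_bound_le[OF inst(6,7)] by (rule of_nat_mono)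
    finally have le: "ert solve f s0 \<le> of_nat (poly (cost_poly [:0, 1:]) (length (encode (H, G, P))))"
      by (simp only: cost_poly_eval prod.collapse)
    then have fin: "ert solve f s0 < \<top>" by (rule le_less_trans) (rule of_nat_less_top)
    have "distinct (output_of s) \<and> transversal P (set (output_of s)) \<and> avoids G (set (output_of s)) H"
      if "(s, t) \<in> set_spmf (run solve s0)" for s t
      using ert_finite(2)[OF fin that] by (simp add: f_def split: if_splits)
    then show ?thesis
      using ert_finite(1,3)[OF fin] le unfolding expected_time_def s0_def by (auto intro: order_trans)
  qed
  show "randomized_poly_time encode
           {(H, G, P). numbered H \<and> numbered G \<and>
              (\<exists>r b d. block_setting H r G P b d \<and> b \<ge> 4 * d / real r)}
           (\<lambda>(H, G, P) ys. distinct ys \<and> transversal P (set ys) \<and> avoids G (set ys) H)"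
    unfolding randomized_poly_time_def
  proof (intro exI ballI)
    fix x assume "x \<in> {(H, G, P). numbered H \<and> numbered G \<and> (\<exists>r b d. block_setting H r G P b d \<and> b \<ge> 4 * d / real r)}"
    then obtain H G P r b d where x: "x = (H, G, P)"
      and *: "numbered H" "numbered G" "block_setting H r G P b d" "b \<ge> 4 * d / real r" by auto
    show "lossless_spmf (run solve (input_state (encode x))) \<and>
        (\<forall>(s, t)\<in>set_spmf (run solve (input_state (encode x))).
          (case x of (H, G, P) \<Rightarrow> \<lambda>ys. distinct ys \<and> transversal P (set ys) \<and> avoids G (set ys) H) (output_of s)) \<and>
        expected_time solve (encode x) \<le> of_nat (poly (cost_poly [:0, 1:]) (length (encode x)))"
      using main[OF *] by (simp add: x)
  qed
qed

end
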